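(* Suppose that $\mathcal{L}\in\mathbb{H}_\alpha$, and let $\widetilde\rho=(\widetilde\rho_1\ge\widetilde\rho_2\ge\cdots\ge\widetilde\rho_n)$ be the ranked values of the invariant probability vector $\hat\rho=(\rho_1+\cdots+\rho_n)^{-1}(\rho_1,\dots,\rho_n)$ of the random walk on the complete graph with i.i.d. edge weights of law $\mathcal{L}$. (i) If $\alpha\in(0,1)$, then, as $n\to\infty$, in distribution, $$\widetilde\rho\longrightarrow\tfrac12(V_1,V_1,V_2,V_2,\ldots),$$ where $V_1>V_2>\cdots$ is a Poisson–Dirichlet $\mathrm{PD}(\alpha,0)$ random vector. (ii) If $\alpha\in(1,2)$ and $\mathcal{L}$ has mean $1$, then with $\kappa_m=m a_m^{-1}$, as $n\to\infty$, in distribution, $$\kappa_{n(n+1)/2}\,\widetilde\rho\longrightarrow\tfrac12(x_1,x_1,x_2,x_2,\ldots),$$ where $x_1>x_2>\cdots$ denote the ranked points of the Poisson point process on $(0,\infty)$ with intensity measure $\alpha x^{-\alpha-1}\,dx$. Moreover, the same convergence holds for $\alpha=1$ provided $\kappa_m$ is replaced by $m a_m^{-1}w_m$, with $w_m=\int_0^{a_m}x\,\mathcal{L}(dx)$.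
   Context: For $\alpha>0$, $\mathbb{H}_\alpha$ is the class of probability laws $\mathcal{L}$ supported in $[0,\infty)$ with $G(t):=\mathcal{L}((t,\infty))=L(t)t^{-\alpha}$ for all $t>0$, $L$ slowly varying at $\infty$ (i.e. $L(xt)/L(t)\to1$ as $t\to\infty$ for every $x>0$). Set $a_n=\inf\{a>0: nG(a)\le1\}$. Let $(U_{i,j})_{1\le i\le j\le n}$ be i.i.d. of law $\mathcal{L}$, $U_{j,i}=U_{i,j}$, and $\rho_i=\sum_{j=1}^nU_{i,j}$. The random walk has transition matrix $K_{i,j}=U_{i,j}/\rho_i$, reversible with respect to $\rho$. (The probability that $\rho_1+\dots+\rho_n=0$ tends to $0$, and $\hat\rho$ may be defined arbitrarily on that event.) Convergence in distribution of ranked vectors: finite vectors are completed by zeros on the right and viewed as random elements of the space of sequences $v_1\ge v_2\ge\cdots\ge0$ with $v_j\to0$, equipped with the product topology; convergence in distribution there is equivalent to convergence of finite-dimensional distributions. $\mathrm{PD}(\alpha,0)$, $\alpha\in(0,1)$: the law of $\bigl(\gamma_k^{-1/\alpha}/\sum_{m\ge1}\gamma_m^{-1/\alpha}\bigr)_{k\ge1}$, where $\gamma_k=E_1+\dots+E_k$ and $E_1,E_2,\dots$ are i.i.d. exponential variables of mean 1. *)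

theory Defs
  imports "HOL-Probability.Probability"
begin

definition slowly_varying :: "(real \<Rightarrow> real) \<Rightarrow> bool" where
  "slowly_varying S \<longleftrightarrow> (\<forall>x>0. ((\<lambda>t. S (x * t) / S t) \<longlongrightarrow> 1) at_top)"

definition tail :: "real measure \<Rightarrow> real \<Rightarrow> real" where
  "tail \<L> t = measure \<L> {t<..}"

definition heavy_tailed :: "real \<Rightarrow> real measure set" where
  "heavy_tailed \<alpha> =
     {\<L>. prob_space \<L> \<and> sets \<L> = sets borel \<and> (AE x in \<L>. 0 \<le> x) \<and>
          (\<exists>S. slowly_varying S \<and> (\<forall>t>0. tail \<L> t = S t * t powr (- \<alpha>)))}"

definition tail_quantile :: "real measure \<Rightarrow> nat \<Rightarrow> real" where
  "tail_quantile \<L> m = Inf {a. 0 < a \<and> real m * tail \<L> a \<le> 1}"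

definition kappa :: "real measure \<Rightarrow> nat \<Rightarrow> real" where
  "kappa \<L> m = real m / tail_quantile \<L> m"

definition truncated_mean :: "real measure \<Rightarrow> nat \<Rightarrow> real" where
  "truncated_mean \<L> m = (LINT x:{0..tail_quantile \<L> m}|\<L>. x)"


definition row_sum :: "nat \<Rightarrow> (nat \<Rightarrow> nat \<Rightarrow> real) \<Rightarrow> nat \<Rightarrow> real" where
  "row_sum n u i = (\<Sum>j=1..n. u i j)"

definition transition_matrix :: "nat \<Rightarrow> (nat \<Rightarrow> nat \<Rightarrow> real) \<Rightarrow> nat \<Rightarrow> nat \<Rightarrow> real" where
  "transition_matrix n u i j = u i j / row_sum n u i"

text \<open>The vector of normalised row sums. If all row sums add up to 0 the formula makes no
  sense, and any nonnegative values are accepted.\<close>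

definition invariant_vector :: "nat \<Rightarrow> (nat \<Rightarrow> nat \<Rightarrow> real) \<Rightarrow> (nat \<Rightarrow> real) \<Rightarrow> bool" where
  "invariant_vector n u r \<longleftrightarrow>
     (if (\<Sum>k=1..n. row_sum n u k) \<noteq> 0
      then \<forall>i\<in>{1..n}. r i = row_sum n u i / (\<Sum>k=1..n. row_sum n u k)
      else \<forall>i\<in>{1..n}. 0 \<le> r i)"

lemma row_sum_reversible:
  assumes "\<And>i j. i \<in> {1..n} \<Longrightarrow> j \<in> {1..n} \<Longrightarrow> 0 \<le> u i j"
    and "i \<in> {1..n}" "j \<in> {1..n}"
  shows "row_sum n u i * transition_matrix n u i j = u i j"
proof (cases "row_sum n u i = 0")
  case True
  then have "u i j = 0"
    using assms sum_nonneg_eq_0_iff[of "{1..n}" "u i"] by (auto simp: row_sum_def)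
  with True show ?thesis by simp
qed (simp add: transition_matrix_def)

lemma invariant_vector_stationary:
  assumes nonneg: "\<And>i j. i \<in> {1..n} \<Longrightarrow> j \<in> {1..n} \<Longrightarrow> 0 \<le> u i j"
    and sym: "\<And>i j. i \<in> {1..n} \<Longrightarrow> j \<in> {1..n} \<Longrightarrow> u j i = u i j"
    and tot: "(\<Sum>k=1..n. row_sum n u k) \<noteq> 0"
    and inv: "invariant_vector n u r"
  shows "(\<Sum>i=1..n. r i) = 1"
    and "\<And>i. i \<in> {1..n} \<Longrightarrow> 0 \<le> r i"
    and "\<And>j. j \<in> {1..n} \<Longrightarrow> (\<Sum>i=1..n. r i * transition_matrix n u i j) = r j"
proof -
  let ?T = "\<Sum>k=1..n. row_sum n u k"
  have r: "r i = row_sum n u i / ?T" if "i \<in> {1..n}" for i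
    using inv tot that by (auto simp: invariant_vector_def)
  have pos: "0 \<le> row_sum n u i" if "i \<in> {1..n}" for i
    unfolding row_sum_def using nonneg that by (intro sum_nonneg) auto
  have "(\<Sum>i=1..n. r i) = (\<Sum>i=1..n. row_sum n u i / ?T)"
    by (intro sum.cong refl r)
  also have "\<dots> = 1" using tot by (simp add: sum_divide_distrib[symmetric])
  finally show "(\<Sum>i=1..n. r i) = 1" .
  show "0 \<le> r i" if "i \<in> {1..n}" for i
    using that by (simp only: r) (intro divide_nonneg_nonneg sum_nonneg pos, auto)
  show "(\<Sum>i=1..n. r i * transition_matrix n u i j) = r j" if j: "j \<in> {1..n}" for j
  proof -
    have "(\<Sum>i=1..n. r i * transition_matrix n u i j) = (\<Sum>i=1..n. u j i / ?T)"
    proof (rule sum.cong[OF refl])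
      fix i assume i: "i \<in> {1..n}"
      have "r i * transition_matrix n u i j =
            row_sum n u i * transition_matrix n u i j / ?T"
        using i by (simp add: r)
      also have "\<dots> = u j i / ?T"
        using row_sum_reversible[of n u i j, OF nonneg i j] sym[OF i j] by simp
      finally show "r i * transition_matrix n u i j = u j i / ?T" .
    qed
    also have "\<dots> = r j"
      using j by (simp add: r sum_divide_distrib[symmetric]) (simp add: row_sum_def)
    finally show ?thesis .
  qed
qed

text \<open>Limit sequences are indexed from 0, vertices from 1.\<close>

definition ranked_vector :: "nat \<Rightarrow> (nat \<Rightarrow> real) \<Rightarrow> nat \<Rightarrow> real" where
  "ranked_vector n r k = (if k < n then rev (sort (map r [1..<Suc n])) ! k else 0)"

definition half_doubled :: "(nat \<Rightarrow> real) \<Rightarrow> nat \<Rightarrow> real" where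
  "half_doubled v k = v (k div 2) / 2"

definition ranked_seqs :: "(nat \<Rightarrow> real) set" where
  "ranked_seqs = {v. antimono v \<and> (\<forall>k. 0 \<le> v k) \<and> v \<longlonglongrightarrow> 0}"

text \<open>Convergence in distribution of random elements of a subspace \<open>S\<close> (with the subspace
  topology), given as functions into the ambient type. On \<open>nat \<Rightarrow> real\<close> the ambient topology is
  the product topology. The indicator is there because the elements are only required to lie
  in \<open>S\<close> almost surely and a test function is arbitrary outside \<open>S\<close>.\<close>

definition converges_in_distribution_on ::
  "'b::topological_space set \<Rightarrow> (nat \<Rightarrow> 'a measure) \<Rightarrow> (nat \<Rightarrow> 'a \<Rightarrow> 'b) \<Rightarrow>
     'c measure \<Rightarrow> ('c \<Rightarrow> 'b) \<Rightarrow> bool" where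
  "converges_in_distribution_on S P X Q Y \<longleftrightarrow>
     (\<forall>n. X n \<in> borel_measurable (P n) \<and> (AE \<omega> in P n. X n \<omega> \<in> S)) \<and>
     Y \<in> borel_measurable Q \<and> (AE \<omega> in Q. Y \<omega> \<in> S) \<and>
     (\<forall>f::'b \<Rightarrow> real. continuous_on S f \<longrightarrow> bounded (f ` S) \<longrightarrow>
        (\<lambda>n. LINT \<omega>|P n. indicator S (X n \<omega>) * f (X n \<omega>))
          \<longlonglongrightarrow> (LINT \<omega>|Q. indicator S (Y \<omega>) * f (Y \<omega>)))"

definition poisson_dirichlet :: "real \<Rightarrow> (nat \<Rightarrow> real) measure" where
  "poisson_dirichlet \<alpha> =
     (let \<gamma> = (\<lambda>(e :: nat \<Rightarrow> real) k. \<Sum>i\<le>k. e i)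
      in distr (\<Pi>\<^sub>M i\<in>UNIV. density lborel (exponential_density 1)) borel
           (\<lambda>e k. \<gamma> e k powr (- 1 / \<alpha>) / (\<Sum>m. \<gamma> e m powr (- 1 / \<alpha>))))"

text \<open>A (simple) Poisson point process as a random set of points: numbers of points in disjoint
  sets are independent, and the number of points in \<open>B\<close> is Poisson with parameter \<open>\<nu>(B)\<close>.
  If \<open>\<nu>(B) = \<infinity>\<close>, no finite value has positive probability, so the number is almost surely infinite.\<close>

definition num_points :: "('w \<Rightarrow> 'a set) \<Rightarrow> 'a set \<Rightarrow> 'w \<Rightarrow> ennreal" where
  "num_points \<Xi> B \<omega> = emeasure (count_space UNIV) (\<Xi> \<omega> \<inter> B)"

definition poisson_point_process :: "'w measure \<Rightarrow> 'a measure \<Rightarrow> ('w \<Rightarrow> 'a set) \<Rightarrow> bool" where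
  "poisson_point_process Q \<nu> \<Xi> \<longleftrightarrow>
     prob_space Q \<and>
     (\<forall>B\<in>sets \<nu>. num_points \<Xi> B \<in> borel_measurable Q \<and>
        (\<forall>k::nat. measure Q {\<omega> \<in> space Q. num_points \<Xi> B \<omega> = of_nat k} =
           (if emeasure \<nu> B = \<infinity> then 0
            else measure \<nu> B ^ k / fact k * exp (- measure \<nu> B)))) \<and>
     (\<forall>(n::nat) B. (\<forall>i<n. B i \<in> sets \<nu>) \<longrightarrow> disjoint_family_on B {..<n} \<longrightarrow>
        prob_space.indep_vars Q (\<lambda>_. borel) (\<lambda>i. num_points \<Xi> (B i)) {..<n})"

definition power_intensity :: "real \<Rightarrow> real measure" where
  "power_intensity \<alpha> =
     density lborel (\<lambda>x. ennreal (indicator {0<..} x * (\<alpha> * x powr (- \<alpha> - 1))))"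

definition ranked_points :: "(nat \<Rightarrow> real) \<Rightarrow> real set \<Rightarrow> bool" where
  "ranked_points x A \<longleftrightarrow> (\<forall>k. x (Suc k) < x k) \<and> range x = A"

definition ranked_poisson_points ::
  "'w measure \<Rightarrow> real \<Rightarrow> ('w \<Rightarrow> nat \<Rightarrow> real) \<Rightarrow> bool" where
  "ranked_poisson_points Q \<alpha> x \<longleftrightarrow>
     x \<in> borel_measurable Q \<and>
     (\<exists>\<Xi>. poisson_point_process Q (power_intensity \<alpha>) \<Xi> \<and>
          (AE \<omega> in Q. ranked_points (x \<omega>) (\<Xi> \<omega>)))"

end

theory Submission
  imports Defs
begin

text \<open>
  Let \<open>a\<close> be the quantile at level \<open>1/m\<close>, \<open>m = n (n + 1) / 2\<close>. With high probability the edges of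
  weight above \<open>\<epsilon> a\<close> form a matching without loops, and by Chebyshev's inequality and Karamata's
  bound on truncated second moments the remaining edges at any vertex carry total weight
  \<open>\<le> \<delta> a\<close>. Hence the ranked vertex sums divided by \<open>a\<close> are close to the ranked edge weights,
  each taken twice. The numbers of edges above levels \<open>t a\<close> have generating functions of the form
  \<open>(1 - q)^m\<close>, which converge to those of a Poisson process with tail \<open>t powr (- \<alpha>)\<close>; by the
  Stone-Weierstrass theorem this yields convergence of expectations of all continuous functions of
  the counts, and the ranked weights are recovered from the counts on a fine grid up to its mesh.
  The points \<open>\<gamma>\<^sub>k powr (- 1 / \<alpha>)\<close> have the same generating functions, by uniqueness for a renewal
  equation. Finally, the sum of all vertex sums is asymptotic to \<open>2 a\<close> times the sum of the limit
  points when \<open>\<alpha> < 1\<close>, and obeys a weak law of large numbers when \<open>1 \<le> \<alpha> < 2\<close>; the quotient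
  passes to the limit by continuity.
\<close>

section \<open>Weak convergence in metric spaces\<close>

text \<open>The normaliser is a sum over all vertices, and summation is not continuous in the
  product topology on ranked sequences. It therefore travels as an extra coordinate 0 in front of
  the ranked vertex sums: both are approximated by continuous functions of the same counts, and
  division is continuous where that coordinate is positive. Counts N enter through
  \<open>exp (- N)\<close>, which lies in [0,1]: the cube is compact, so no tightness argument
  arises, and monomials in these coordinates are exactly generating functions. The condition
  \<alpha> < 2 comes from the vertices: Chebyshev's inequality at n vertices with n edges each,
  truncated at \<epsilon> a, fails with probability of order n^2 times the second moment over
  (\<delta> a)^2, hence \<epsilon>^(2-\<alpha>) / \<delta>^2. This does not vanish with n, but it
  does with \<epsilon>. Loops are too few (n/m tends to 0) and pairs of heavy edges at a vertex too
  rare (n^3/m^2 tends to 0) to matter. The factor 1/2 appears because every edge other than a loop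
  is counted at both ends.\<close>

definition lipschitz_convergence ::
  "(nat \<Rightarrow> 'a measure) \<Rightarrow> (nat \<Rightarrow> 'a \<Rightarrow> 'b::metric_space) \<Rightarrow> 'c measure \<Rightarrow> ('c \<Rightarrow> 'b) \<Rightarrow> bool" where
  "lipschitz_convergence P X Q Y \<longleftrightarrow>
     (\<forall>(g::'b \<Rightarrow> real) B L. (\<forall>x. \<bar>g x\<bar> \<le> B) \<longrightarrow> (\<forall>x y. \<bar>g x - g y\<bar> \<le> L * dist x y) \<longrightarrow>
        (\<lambda>n. LINT \<omega>|P n. g (X n \<omega>)) \<longlonglongrightarrow> (LINT \<omega>|Q. g (Y \<omega>)))"

lemma lipschitz_imp_continuous:
  fixes g :: "'b::metric_space \<Rightarrow> real"
  assumes "\<And>x y. \<bar>g x - g y\<bar> \<le> L * dist x y"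
  shows "continuous_on UNIV g"
proof (rule lipschitz_on_continuous_on)
  \<comment> \<open>\<open>lipschitz_on\<close> asks for a nonnegative constant, whereas a one-point
    space satisfies the hypothesis with any L.\<close>
  show "\<bar>L\<bar>-lipschitz_on UNIV g"
  proof (rule lipschitz_onI)
    fix x y
    have "\<bar>g x - g y\<bar> \<le> L * dist x y" by (rule assms)
    also have "\<dots> \<le> \<bar>L\<bar> * dist x y" by (intro mult_right_mono) auto
    finally show "dist (g x) (g y) \<le> \<bar>L\<bar> * dist x y" by (simp add: dist_real_def)
  qed simp
qed

lemma indicator_mult_borel_measurable:
  fixes f :: "'b::metric_space \<Rightarrow> real"
  assumes "S \<in> sets borel" "continuous_on S f"
  shows "(\<lambda>x. indicator S x * f x) \<in> borel_measurable borel"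
  using borel_measurable_continuous_on_indicator[OF assms] by simp

text \<open>Bounded continuous functions on a subspace are increasing limits of bounded Lipschitz functions
  on the whole space, so Lipschitz test functions suffice for convergence in distribution.\<close>

locale inf_convolution =
  fixes S :: "'b::metric_space set" and f :: "'b \<Rightarrow> real" and B :: real
  assumes S_ne: "S \<noteq> {}" and f_bound: "\<And>x. x \<in> S \<Longrightarrow> \<bar>f x\<bar> \<le> B" and f_cont: "continuous_on S f"
begin

text \<open>The infimum is the largest k-Lipschitz function on the whole space that lies below f on
  S. It grows linearly away from S, so the cap B keeps it an admissible bounded test
  function.\<close>

definition approx :: "nat \<Rightarrow> 'b \<Rightarrow> real" where
  "approx k x = min B (INF y\<in>S. f y + real k * dist x y)"

lemma bdd: "bdd_below ((\<lambda>y. f y + real k * dist x y) ` S)"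
proof (rule bdd_belowI2)
  fix y assume "y \<in> S"
  then have "- B \<le> f y" using f_bound[of y] by linarith
  then show "- B \<le> f y + real k * dist x y" by (simp add: add_increasing2)
qed

lemma B_nonneg: "0 \<le> B"
  using S_ne f_bound by fastforce

lemma INF_lower: "- B \<le> (INF y\<in>S. f y + real k * dist x y)"
proof (rule cINF_greatest[OF S_ne])
  fix y assume "y \<in> S"
  then have "- B \<le> f y" using f_bound[of y] by linarith
  then show "- B \<le> f y + real k * dist x y" by (simp add: add_increasing2)
qed

lemma approx_bound: "\<bar>approx k x\<bar> \<le> B"
  using INF_lower[of k x] B_nonneg by (auto simp: approx_def abs_le_iff)

lemma approx_le: "x \<in> S \<Longrightarrow> approx k x \<le> f x"
  using cINF_lower[OF bdd[of k x], of x] by (simp add: approx_def min.coboundedI2)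

lemma INF_lip: "(INF y\<in>S. f y + real k * dist x y) \<le> (INF y\<in>S. f y + real k * dist z y) + real k * dist x z"
proof -
  have "(INF y\<in>S. f y + real k * dist x y) - real k * dist x z \<le> (INF y\<in>S. f y + real k * dist z y)"
  proof (rule cINF_greatest[OF S_ne])
    fix y assume y: "y \<in> S"
    have "(INF y\<in>S. f y + real k * dist x y) \<le> f y + real k * dist x y"
      by (rule cINF_lower[OF bdd y])
    also have "\<dots> \<le> f y + real k * (dist x z + dist z y)"
      by (intro add_left_mono mult_left_mono dist_triangle) auto
    finally show "(INF y\<in>S. f y + real k * dist x y) - real k * dist x z \<le> f y + real k * dist z y"
      by (simp add: algebra_simps)
  qed
  then show ?thesis by simp
qed

lemma approx_lip: "\<bar>approx k x - approx k z\<bar> \<le> real k * dist x z"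
  using INF_lip[of k x z] INF_lip[of k z x] by (auto simp: approx_def dist_commute min_def)

lemma approx_tendsto:
  assumes x: "x \<in> S"
  shows "(\<lambda>k. approx k x) \<longlonglongrightarrow> f x"
proof (rule LIMSEQ_I)
  fix \<epsilon> :: real assume \<epsilon>: "0 < \<epsilon>"
  obtain \<delta> where \<delta>: "\<delta> > 0" "\<And>y. y \<in> S \<Longrightarrow> dist y x < \<delta> \<Longrightarrow> dist (f y) (f x) < \<epsilon>/2"
    using f_cont x \<epsilon> unfolding continuous_on_iff by (metis half_gt_zero)
  \<comment> \<open>The oscillation of f on S is at most 2 B, so from K on the penalty at distance
    \<delta> outweighs anything gained by moving that far from x.\<close>
  obtain K :: nat where K: "2 * B / \<delta> \<le> real K" using real_arch_simple by blast
  have "norm (approx k x - f x) < \<epsilon>" if k: "k \<ge> K" for k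
  proof -
    have "f x - \<epsilon>/2 \<le> (INF y\<in>S. f y + real k * dist x y)"
    proof (rule cINF_greatest[OF S_ne])
      fix y assume y: "y \<in> S"
      show "f x - \<epsilon>/2 \<le> f y + real k * dist x y"
      proof (cases "dist y x < \<delta>")
        case True
        then have "f x - \<epsilon>/2 \<le> f y" using \<delta>(2)[OF y True] unfolding dist_real_def by linarith
        then show ?thesis by (simp add: add_increasing2)
      next
        case False
        have "2 * B \<le> real k * \<delta>" using K k \<delta>(1) by (simp add: field_simps)
            (meson dual_order.trans mult_left_mono less_imp_le of_nat_mono)
        also have "\<dots> \<le> real k * dist x y" using False by (intro mult_left_mono) (auto simp: dist_commute)
        finally show ?thesis using f_bound[OF x] f_bound[OF y] \<epsilon> by linarith
      qed
    qed
    moreover have "f x \<le> B" using f_bound[OF x] by linarith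
    ultimately have "f x - \<epsilon>/2 \<le> approx k x" using \<epsilon> by (auto simp: approx_def)
    then show ?thesis using approx_le[OF x, of k] \<epsilon> by (auto simp: abs_if)
  qed
  then show "\<exists>no. \<forall>n\<ge>no. norm (approx n x - f x) < \<epsilon>" by blast
qed

lemma approx_measurable: "approx k \<in> borel_measurable borel"
  by (intro borel_measurable_continuous_onI lipschitz_imp_continuous[where L="real k"] approx_lip)

end

text \<open>The approximants lie below f on S, which gives the lower half of the convergence; the
  upper half is the same statement for -f. The variables X n may leave S with vanishing probability,
  as happens when S is the open set on which division is continuous.\<close>

lemma lipschitz_convergence_lower:
  fixes P :: "nat \<Rightarrow> 'a measure" and Q :: "'c measure" and X :: "nat \<Rightarrow> 'a \<Rightarrow> 'b::metric_space"
  assumes conv: "lipschitz_convergence P X Q Y"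
    and P: "\<And>n. prob_space (P n)" and Q: "prob_space Q"
    and X: "\<And>n. X n \<in> borel_measurable (P n)" and Y: "Y \<in> borel_measurable Q"
    and S: "S \<in> sets borel" and YS: "AE \<omega> in Q. Y \<omega> \<in> S"
    and XS: "(\<lambda>n. measure (P n) {\<omega> \<in> space (P n). X n \<omega> \<notin> S}) \<longlonglongrightarrow> 0"
    and f: "continuous_on S f" and B: "\<And>x. x \<in> S \<Longrightarrow> \<bar>f x\<bar> \<le> B" and \<epsilon>: "0 < (\<epsilon>::real)"
  shows "\<forall>\<^sub>F n in sequentially.
     (LINT \<omega>|Q. indicator S (Y \<omega>) * f (Y \<omega>)) - \<epsilon> < (LINT \<omega>|P n. indicator S (X n \<omega>) * f (X n \<omega>))"
proof -
  interpret Q: prob_space Q by fact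
  have "S \<noteq> {}"
  proof
    assume "S = {}"
    then have "AE \<omega> in Q. False" using YS by simp
    then show False by simp
  qed
  then interpret inf_convolution S f B using f B by unfold_locales auto
  note meas = measurable_compose[OF X indicator_mult_borel_measurable[OF S f]]
     measurable_compose[OF Y indicator_mult_borel_measurable[OF S f]]
     measurable_compose[OF X approx_measurable] measurable_compose[OF Y approx_measurable]
  have ind_bd: "\<bar>indicator S x * f x\<bar> \<le> B" for x
    using B B_nonneg by (auto simp: indicator_def)
  have "(\<lambda>k. LINT \<omega>|Q. approx k (Y \<omega>)) \<longlonglongrightarrow> (LINT \<omega>|Q. indicator S (Y \<omega>) * f (Y \<omega>))"
  proof (rule integral_dominated_convergence[where w="\<lambda>_. B"])
    show "AE \<omega> in Q. (\<lambda>k. approx k (Y \<omega>)) \<longlonglongrightarrow> indicator S (Y \<omega>) * f (Y \<omega>)"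
      using YS by eventually_elim (simp add: approx_tendsto)
  qed (use meas approx_bound in auto)
  from order_tendstoD(1)[OF this, of "(LINT \<omega>|Q. indicator S (Y \<omega>) * f (Y \<omega>)) - \<epsilon>/3"] \<epsilon>
  obtain k where k: "(LINT \<omega>|Q. indicator S (Y \<omega>) * f (Y \<omega>)) - \<epsilon>/3 < (LINT \<omega>|Q. approx k (Y \<omega>))"
    by (auto simp: eventually_sequentially)
  have "(\<lambda>n. LINT \<omega>|P n. approx k (X n \<omega>)) \<longlonglongrightarrow> (LINT \<omega>|Q. approx k (Y \<omega>))"
    by (rule conv[unfolded lipschitz_convergence_def, rule_format, OF approx_bound approx_lip])
  from order_tendstoD(1)[OF this k]
  have ev1: "\<forall>\<^sub>F n in sequentially. (LINT \<omega>|Q. indicator S (Y \<omega>) * f (Y \<omega>)) - \<epsilon>/3 < (LINT \<omega>|P n. approx k (X n \<omega>))" .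
  have ev2: "\<forall>\<^sub>F n in sequentially. B * measure (P n) {\<omega> \<in> space (P n). X n \<omega> \<notin> S} < \<epsilon>/3"
    by (rule order_tendstoD(2)[OF tendsto_mult_right_zero[OF XS]]) (use \<epsilon> in auto)
  show ?thesis using ev1 ev2
  proof eventually_elim
    case (elim n)
    interpret P: prob_space "P n" by fact
    let ?A = "{\<omega> \<in> space (P n). X n \<omega> \<notin> S}"
    have A[measurable]: "?A \<in> sets (P n)" using X S by measurable
    \<comment> \<open>Off S the approximant is only known to be at most B while the right-hand
      integrand vanishes there, whence the correction on \<open>?A\<close>.\<close>
    have "(LINT \<omega>|P n. approx k (X n \<omega>)) \<le> (LINT \<omega>|P n. indicator S (X n \<omega>) * f (X n \<omega>) + B * indicator ?A \<omega>)"
    proof (rule integral_mono)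
      show "integrable (P n) (\<lambda>\<omega>. approx k (X n \<omega>))"
        by (rule P.integrable_const_bound[of _ B]) (use meas approx_bound in auto)
      have "integrable (P n) (\<lambda>\<omega>. indicator S (X n \<omega>) * f (X n \<omega>))"
        by (rule P.integrable_const_bound[of _ B]) (use meas ind_bd in auto)
      then show "integrable (P n) (\<lambda>\<omega>. indicator S (X n \<omega>) * f (X n \<omega>) + B * indicator ?A \<omega>)"
        by (intro Bochner_Integration.integrable_add integrable_mult_right integrable_real_indicator A)
          (auto simp: less_top[symmetric])
      show "approx k (X n \<omega>) \<le> indicator S (X n \<omega>) * f (X n \<omega>) + B * indicator ?A \<omega>" if "\<omega> \<in> space (P n)" for \<omega>
        using that approx_le[of "X n \<omega>" k] approx_bound[of k "X n \<omega>"] by (auto simp: indicator_def)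
    qed
    also have "\<dots> = (LINT \<omega>|P n. indicator S (X n \<omega>) * f (X n \<omega>)) + B * measure (P n) ?A"
    proof (subst Bochner_Integration.integral_add)
      show "integrable (P n) (\<lambda>\<omega>. indicator S (X n \<omega>) * f (X n \<omega>))"
        by (rule P.integrable_const_bound[of _ B]) (use meas ind_bd in auto)
    qed (auto simp: less_top[symmetric])
    finally show ?case using elim \<epsilon> by linarith
  qed
qed

lemma lipschitz_convergence_imp_continuous:
  fixes P :: "nat \<Rightarrow> 'a measure" and Q :: "'c measure" and X :: "nat \<Rightarrow> 'a \<Rightarrow> 'b::metric_space"
    and f :: "'b \<Rightarrow> real"
  assumes conv: "lipschitz_convergence P X Q Y"
    and P: "\<And>n. prob_space (P n)" and Q: "prob_space Q"
    and X: "\<And>n. X n \<in> borel_measurable (P n)" and Y: "Y \<in> borel_measurable Q"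
    and S: "S \<in> sets borel" and YS: "AE \<omega> in Q. Y \<omega> \<in> S"
    and XS: "(\<lambda>n. measure (P n) {\<omega> \<in> space (P n). X n \<omega> \<notin> S}) \<longlonglongrightarrow> 0"
    and f: "continuous_on S f" and B: "\<And>x. x \<in> S \<Longrightarrow> \<bar>f x\<bar> \<le> B"
  shows "(\<lambda>n. LINT \<omega>|P n. indicator S (X n \<omega>) * f (X n \<omega>)) \<longlonglongrightarrow>
           (LINT \<omega>|Q. indicator S (Y \<omega>) * f (Y \<omega>))"
proof (rule order_tendstoI)
  fix a assume "a < (LINT \<omega>|Q. indicator S (Y \<omega>) * f (Y \<omega>))"
  then show "\<forall>\<^sub>F n in sequentially. a < (LINT \<omega>|P n. indicator S (X n \<omega>) * f (X n \<omega>))"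
    using lipschitz_convergence_lower[OF conv P Q X Y S YS XS f B,
      of "(LINT \<omega>|Q. indicator S (Y \<omega>) * f (Y \<omega>)) - a"] by simp
next
  fix a assume "(LINT \<omega>|Q. indicator S (Y \<omega>) * f (Y \<omega>)) < a"
  then show "\<forall>\<^sub>F n in sequentially. (LINT \<omega>|P n. indicator S (X n \<omega>) * f (X n \<omega>)) < a"
    using lipschitz_convergence_lower[OF conv P Q X Y S YS XS continuous_on_minus[OF f], of B
      "a - (LINT \<omega>|Q. indicator S (Y \<omega>) * f (Y \<omega>))"] B by simp
qed

text \<open>Closeness in the sense of the Ky Fan metric. The exceptional event is any measurable set
  that works, so the distance itself need not be shown measurable.\<close>

definition close_except :: "'a measure \<Rightarrow> real \<Rightarrow> ('a \<Rightarrow> 'b::metric_space) \<Rightarrow> ('a \<Rightarrow> 'b) \<Rightarrow> bool" where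
  "close_except M \<epsilon> X Z \<longleftrightarrow>
     (\<exists>A\<in>sets M. measure M A \<le> \<epsilon> \<and> (\<forall>\<omega>\<in>space M - A. dist (X \<omega>) (Z \<omega>) \<le> \<epsilon>))"

lemma integral_diff_le_off_set:
  fixes g :: "'b::metric_space \<Rightarrow> real"
  assumes "prob_space M" and X: "X \<in> borel_measurable M" and Z: "Z \<in> borel_measurable M"
    and B: "\<And>x. \<bar>g x\<bar> \<le> B" and L: "\<And>x y. \<bar>g x - g y\<bar> \<le> L * dist x y"
    and XZ: "close_except M \<epsilon> X Z"
  shows "\<bar>(LINT \<omega>|M. g (X \<omega>)) - (LINT \<omega>|M. g (Z \<omega>))\<bar> \<le> (\<bar>L\<bar> + 2 * B) * \<epsilon>"
proof -
  obtain A where A: "A \<in> sets M" "measure M A \<le> \<epsilon>"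
    and close: "\<And>\<omega>. \<omega> \<in> space M - A \<Longrightarrow> dist (X \<omega>) (Z \<omega>) \<le> \<epsilon>"
    using XZ by (auto simp: close_except_def)
  interpret prob_space M by fact
  have g: "g \<in> borel_measurable borel"
    by (intro borel_measurable_continuous_onI lipschitz_imp_continuous[OF L])
  note m = measurable_compose[OF X g] measurable_compose[OF Z g]
  have B0: "0 \<le> B" using B[of undefined] by linarith
  have \<epsilon>0: "0 \<le> \<epsilon>" using A(2) measure_nonneg[of M A] by linarith
  have iX: "integrable M (\<lambda>\<omega>. g (X \<omega>))" "integrable M (\<lambda>\<omega>. g (Z \<omega>))"
    by (auto intro!: integrable_const_bound[of _ B] m B)
  have "\<bar>(LINT \<omega>|M. g (X \<omega>)) - (LINT \<omega>|M. g (Z \<omega>))\<bar> = \<bar>LINT \<omega>|M. g (X \<omega>) - g (Z \<omega>)\<bar>"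
    using iX by simp
  also have "\<dots> \<le> (LINT \<omega>|M. \<bar>g (X \<omega>) - g (Z \<omega>)\<bar>)"
    using integral_norm_bound[of M "\<lambda>\<omega>. g (X \<omega>) - g (Z \<omega>)"] by simp
  also have "\<dots> \<le> (LINT \<omega>|M. \<bar>L\<bar> * \<epsilon> + 2 * B * indicator A \<omega>)"
  proof (rule integral_mono)
    show "integrable M (\<lambda>\<omega>. \<bar>g (X \<omega>) - g (Z \<omega>)\<bar>)" using iX by auto
    show "integrable M (\<lambda>\<omega>. \<bar>L\<bar> * \<epsilon> + 2 * B * indicator A \<omega>)"
      using A by (auto simp: less_top[symmetric])
    fix \<omega> assume w: "\<omega> \<in> space M"
    show "\<bar>g (X \<omega>) - g (Z \<omega>)\<bar> \<le> \<bar>L\<bar> * \<epsilon> + 2 * B * indicator A \<omega>"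
    proof (cases "\<omega> \<in> A")
      case True
      have "0 \<le> \<bar>L\<bar> * \<epsilon>" using \<epsilon>0 by simp
      then show ?thesis using True B[of "X \<omega>"] B[of "Z \<omega>"] by (simp add: abs_le_iff)
    next
      case False
      have "\<bar>g (X \<omega>) - g (Z \<omega>)\<bar> \<le> L * dist (X \<omega>) (Z \<omega>)" by (rule L)
      also have "\<dots> \<le> \<bar>L\<bar> * dist (X \<omega>) (Z \<omega>)" by (intro mult_right_mono) auto
      also have "\<dots> \<le> \<bar>L\<bar> * \<epsilon>" using close w False by (intro mult_left_mono) auto
      finally show ?thesis using False by simp
    qed
  qed
  also have "\<dots> = \<bar>L\<bar> * \<epsilon> + 2 * B * measure M A"
    using A by (simp add: less_top[symmetric] prob_space)
  also have "\<dots> \<le> \<bar>L\<bar> * \<epsilon> + 2 * B * \<epsilon>"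
    using A B0 by (intro add_left_mono mult_left_mono) auto
  finally show ?thesis by (simp add: algebra_simps)
qed

text \<open>The classical convergence-together argument: replacing X n by Z n moves the integral of
  a bounded Lipschitz g by at most a multiple of \<epsilon> that depends on g alone. The
  approximations may change with \<epsilon>, since g is fixed before \<epsilon> is chosen.\<close>

lemma lipschitz_convergence_approx:
  fixes P :: "nat \<Rightarrow> 'a measure" and Q :: "'c measure" and X :: "nat \<Rightarrow> 'a \<Rightarrow> 'b::metric_space"
  assumes P: "\<And>n. prob_space (P n)" and Q: "prob_space Q"
    and X: "\<And>n. X n \<in> borel_measurable (P n)" and Y: "Y \<in> borel_measurable Q"
    and approx: "\<And>\<epsilon>. 0 < \<epsilon> \<Longrightarrow> \<exists>Z Y'. (\<forall>n. Z n \<in> borel_measurable (P n)) \<and> Y' \<in> borel_measurable Q \<and>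
       lipschitz_convergence P Z Q Y' \<and> (\<forall>\<^sub>F n in sequentially. close_except (P n) \<epsilon> (X n) (Z n)) \<and>
       close_except Q \<epsilon> Y Y'"
  shows "lipschitz_convergence P X Q Y"
  unfolding lipschitz_convergence_def
proof (intro allI impI)
  fix g :: "'b \<Rightarrow> real" and B L
  assume B: "\<forall>x. \<bar>g x\<bar> \<le> B" and L: "\<forall>x y. \<bar>g x - g y\<bar> \<le> L * dist x y"
  have B0: "0 \<le> B" using B by (meson abs_ge_zero order_trans)
  show "(\<lambda>n. LINT \<omega>|P n. g (X n \<omega>)) \<longlonglongrightarrow> (LINT \<omega>|Q. g (Y \<omega>))"
  proof (rule tendstoI)
    fix e :: real assume e: "0 < e"
    \<comment> \<open>The summand 1 keeps the divisor positive when L and B are both 0.\<close>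
    define C where "C = \<bar>L\<bar> + 2 * B + 1"
    have C: "C > 0" using B0 by (simp add: C_def)
    define \<epsilon> where "\<epsilon> = e / (3 * C)"
    have \<epsilon>: "0 < \<epsilon>" using e C by (simp add: \<epsilon>_def)
    have C\<epsilon>: "(\<bar>L\<bar> + 2 * B) * \<epsilon> \<le> e / 3"
    proof -
      have "(\<bar>L\<bar> + 2 * B) * \<epsilon> \<le> C * \<epsilon>" using \<epsilon> by (intro mult_right_mono) (auto simp: C_def)
      also have "\<dots> = e / 3" using C by (simp add: \<epsilon>_def)
      finally show ?thesis .
    qed
    obtain Z Y' where Z: "\<And>n. Z n \<in> borel_measurable (P n)" and Y': "Y' \<in> borel_measurable Q"
      and conv: "lipschitz_convergence P Z Q Y'"
      and XZ: "\<forall>\<^sub>F n in sequentially. close_except (P n) \<epsilon> (X n) (Z n)" and YY': "close_except Q \<epsilon> Y Y'"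
      using approx[OF \<epsilon>] by blast
    have "(\<lambda>n. LINT \<omega>|P n. g (Z n \<omega>)) \<longlonglongrightarrow> (LINT \<omega>|Q. g (Y' \<omega>))"
      by (rule conv[unfolded lipschitz_convergence_def, rule_format, of g B L]) (use B L in auto)
    from tendstoD[OF this, of "e/3"] e
    have ev: "\<forall>\<^sub>F n in sequentially. dist (LINT \<omega>|P n. g (Z n \<omega>)) (LINT \<omega>|Q. g (Y' \<omega>)) < e/3" by simp
    have d2: "\<bar>(LINT \<omega>|Q. g (Y \<omega>)) - (LINT \<omega>|Q. g (Y' \<omega>))\<bar> \<le> e/3"
      by (rule order_trans[OF integral_diff_le_off_set[OF Q Y Y' _ _ YY'] C\<epsilon>]) (use B L in auto)
    show "\<forall>\<^sub>F n in sequentially. dist (LINT \<omega>|P n. g (X n \<omega>)) (LINT \<omega>|Q. g (Y \<omega>)) < e"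
      using ev XZ
    proof eventually_elim
      case (elim n)
      have "\<bar>(LINT \<omega>|P n. g (X n \<omega>)) - (LINT \<omega>|P n. g (Z n \<omega>))\<bar> \<le> e/3"
        by (rule order_trans[OF integral_diff_le_off_set[OF P X Z _ _ elim(2)] C\<epsilon>]) (use B L in auto)
      then show ?case using d2 elim(1) unfolding dist_real_def by linarith
    qed
  qed
qed

text \<open>The product metric adds up coordinate distances, capped at 1, with weights that are
  powers of 1/2; the total weight is 2.\<close>

lemma dist_fun_le:
  fixes x y :: "nat \<Rightarrow> real"
  assumes "\<And>k. \<bar>x k - y k\<bar> \<le> \<delta>"
  shows "dist x y \<le> 2 * \<delta>"
proof -
  have \<delta>: "0 \<le> \<delta>" using assms[of 0] by linarith
  have s: "summable (\<lambda>n. (1/2)^n * min (dist (x (from_nat n)) (y (from_nat n))) 1)"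
    by (rule summable_comparison_test'[of "\<lambda>n. (1/2)^n"]) (auto simp: summable_geometric_iff)
  have "dist x y \<le> (\<Sum>n. (1/2)^n * \<delta>)"
    unfolding dist_fun_def
    by (intro suminf_le s) (use assms in \<open>auto simp: dist_real_def summable_geometric_iff min.coboundedI1 summable_mult2\<close>)
  also have "\<dots> = 2 * \<delta>"
    using suminf_geometric[of "1/2::real"] by (subst suminf_mult2[symmetric]) (auto simp: summable_geometric_iff)
  finally show ?thesis .
qed

text \<open>Products enter only through one coordinate at a time. Inductions over polynomials can
  then move a single factor into a monomial; closure under general products is derived
  afterwards.\<close>

inductive_set coordinate_polynomials :: "((nat \<Rightarrow> real) \<Rightarrow> real) set" where
  const: "(\<lambda>_. c) \<in> coordinate_polynomials"
| add: "f \<in> coordinate_polynomials \<Longrightarrow> g \<in> coordinate_polynomials \<Longrightarrow> (\<lambda>x. f x + g x) \<in> coordinate_polynomials"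
| coord: "f \<in> coordinate_polynomials \<Longrightarrow> (\<lambda>x. x i * f x) \<in> coordinate_polynomials"

lemma coordinate_polynomials_mult:
  assumes f: "f \<in> coordinate_polynomials" and g: "g \<in> coordinate_polynomials"
  shows "(\<lambda>x. f x * g x) \<in> coordinate_polynomials"
  using f
proof induction
  case (const c)
  show ?case using g
  proof induction
    case (const d)
    show ?case using coordinate_polynomials.const[of "c * d"] by simp
  next
    case (add f g)
    then show ?case using coordinate_polynomials.add by (simp add: algebra_simps)
  next
    case (coord f i)
    from coordinate_polynomials.coord[OF coord.IH, of i] show ?case by (simp add: mult.left_commute)
  qed
next
  case (add f h)
  then show ?case using coordinate_polynomials.add by (simp add: algebra_simps)
next
  case (coord f i)
  then show ?case using coordinate_polynomials.coord[of _ i] by (simp add: mult.assoc)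
qed

lemma coordinate_polynomials_continuous:
  "f \<in> coordinate_polynomials \<Longrightarrow> continuous_on UNIV f"
  by (induction rule: coordinate_polynomials.induct)
    (intro continuous_on_const continuous_on_add continuous_on_mult continuous_on_product_coordinates | assumption)+

section \<open>Method of moments on the infinite-dimensional cube\<close>

lemma compact_unit_cube: "compact {x::nat \<Rightarrow> real. \<forall>i. x i \<in> {0..1}}"
proof -
  have "compactin (product_topology (\<lambda>i. euclidean) UNIV) (Pi\<^sub>E UNIV (\<lambda>i::nat. {0..1::real}))"
    by (subst compactin_PiE) auto
  moreover have "Pi\<^sub>E UNIV (\<lambda>i::nat. {0..1::real}) = {x. \<forall>i. x i \<in> {0..1}}" by (auto simp: PiE_def Pi_def)
  ultimately show ?thesis by (simp add: euclidean_product_topology)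
qed

lemma unit_cube_integrable:
  fixes X :: "'a \<Rightarrow> nat \<Rightarrow> real" and f :: "(nat \<Rightarrow> real) \<Rightarrow> real"
  assumes M: "prob_space M" and X: "X \<in> borel_measurable M" and X01: "\<And>\<omega> i. X \<omega> i \<in> {0..1}"
    and f: "continuous_on UNIV f"
  shows "integrable M (\<lambda>\<omega>. f (X \<omega>))"
proof -
  let ?K = "{x::nat \<Rightarrow> real. \<forall>i. x i \<in> {0..1}}"
  interpret prob_space M by fact
  have "compact (f ` ?K)"
    using compact_continuous_image[OF continuous_on_subset[OF f] compact_unit_cube] by auto
  then obtain C where C: "\<And>x. x \<in> ?K \<Longrightarrow> \<bar>f x\<bar> \<le> C"
    using compact_imp_bounded bounded_iff by (metis (no_types, lifting) imageI real_norm_def)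
  show ?thesis
    by (rule integrable_const_bound[of _ C])
      (use C X01 measurable_compose[OF X borel_measurable_continuous_onI[OF f]] in auto)
qed

lemma unit_cube_integral_diff:
  fixes X :: "'a \<Rightarrow> nat \<Rightarrow> real" and f g :: "(nat \<Rightarrow> real) \<Rightarrow> real"
  assumes M: "prob_space M" and X: "X \<in> borel_measurable M" and X01: "\<And>\<omega> i. X \<omega> i \<in> {0..1}"
    and f: "continuous_on UNIV f" and g: "continuous_on UNIV g"
    and close: "\<And>x. (\<And>i. x i \<in> {0..1}) \<Longrightarrow> \<bar>f x - g x\<bar> \<le> e"
  shows "\<bar>(LINT \<omega>|M. f (X \<omega>)) - (LINT \<omega>|M. g (X \<omega>))\<bar> \<le> e"
proof -
  interpret prob_space M by fact
  note i = unit_cube_integrable[OF M X X01 f] unit_cube_integrable[OF M X X01 g]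
  have "\<bar>(LINT \<omega>|M. f (X \<omega>)) - (LINT \<omega>|M. g (X \<omega>))\<bar> = \<bar>LINT \<omega>|M. f (X \<omega>) - g (X \<omega>)\<bar>"
    using i by simp
  also have "\<dots> \<le> (LINT \<omega>|M. \<bar>f (X \<omega>) - g (X \<omega>)\<bar>)"
    using integral_norm_bound[of M "\<lambda>\<omega>. f (X \<omega>) - g (X \<omega>)"] by simp
  also have "\<dots> \<le> (LINT \<omega>|M. e)"
    by (rule integral_mono) (use i close X01 in auto)
  finally show ?thesis by (simp add: prob_space)
qed

text \<open>Polynomials in the coordinates are uniformly dense among the continuous functions on the
  compact cube, so convergence of mixed moments already decides convergence of expectations.\<close>

lemma unit_cube_convergence:
  fixes \<xi> :: "nat \<Rightarrow> 'a \<Rightarrow> nat \<Rightarrow> real" and \<zeta> :: "'c \<Rightarrow> nat \<Rightarrow> real"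
  assumes P: "\<And>n. prob_space (P n)" and Q: "prob_space Q"
    and \<xi>: "\<And>n. \<xi> n \<in> borel_measurable (P n)" and \<zeta>: "\<zeta> \<in> borel_measurable Q"
    and \<xi>01: "\<And>n \<omega> i. \<xi> n \<omega> i \<in> {0..1}" and \<zeta>01: "\<And>\<omega> i. \<zeta> \<omega> i \<in> {0..1}"
    and mono: "\<And>(c::nat \<Rightarrow> nat) r. (\<lambda>n. LINT \<omega>|P n. (\<Prod>i<r. \<xi> n \<omega> i ^ c i)) \<longlonglongrightarrow> (LINT \<omega>|Q. (\<Prod>i<r. \<zeta> \<omega> i ^ c i))"
    and \<phi>: "continuous_on UNIV (\<phi> :: (nat \<Rightarrow> real) \<Rightarrow> real)"
  shows "(\<lambda>n. LINT \<omega>|P n. \<phi> (\<xi> n \<omega>)) \<longlonglongrightarrow> (LINT \<omega>|Q. \<phi> (\<zeta> \<omega>))"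
proof -
  let ?K = "{x::nat \<Rightarrow> real. \<forall>i. x i \<in> {0..1}}"
  note int = unit_cube_integrable
  \<comment> \<open>The monomial prefactor strengthens the claim: in the multiplication case the
    extra coordinate is absorbed into it.\<close>
  have poly: "(\<lambda>n. LINT \<omega>|P n. (\<Prod>i<r. \<xi> n \<omega> i ^ c i) * f (\<xi> n \<omega>)) \<longlonglongrightarrow> (LINT \<omega>|Q. (\<Prod>i<r. \<zeta> \<omega> i ^ c i) * f (\<zeta> \<omega>))"
    if "f \<in> coordinate_polynomials" for f and c :: "nat \<Rightarrow> nat" and r
    using that
  proof (induction arbitrary: c r)
    case (const d)
    show ?case using tendsto_mult_right[OF mono[where c=c and r=r], of d] by simp
  next
    case (add f g)
    have cont: "continuous_on UNIV (\<lambda>x. (\<Prod>i<r. x i ^ c i) * h x)" if "h \<in> coordinate_polynomials" for h :: "(nat \<Rightarrow> real) \<Rightarrow> real"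
      by (intro continuous_on_mult continuous_on_prod continuous_on_power
          continuous_on_product_coordinates coordinate_polynomials_continuous that)
    note i = int[OF _ _ _ cont[OF add.hyps(1)]] int[OF _ _ _ cont[OF add.hyps(2)]]
    have "(LINT \<omega>|P n. (\<Prod>i<r. \<xi> n \<omega> i ^ c i) * (f (\<xi> n \<omega>) + g (\<xi> n \<omega>)))
       = (LINT \<omega>|P n. (\<Prod>i<r. \<xi> n \<omega> i ^ c i) * f (\<xi> n \<omega>)) + (LINT \<omega>|P n. (\<Prod>i<r. \<xi> n \<omega> i ^ c i) * g (\<xi> n \<omega>))" for n
      unfolding distrib_left
      by (rule Bochner_Integration.integral_add; rule i[OF P \<xi> \<xi>01])
    moreover have "(LINT \<omega>|Q. (\<Prod>i<r. \<zeta> \<omega> i ^ c i) * (f (\<zeta> \<omega>) + g (\<zeta> \<omega>)))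
       = (LINT \<omega>|Q. (\<Prod>i<r. \<zeta> \<omega> i ^ c i) * f (\<zeta> \<omega>)) + (LINT \<omega>|Q. (\<Prod>i<r. \<zeta> \<omega> i ^ c i) * g (\<zeta> \<omega>))"
      unfolding distrib_left
      by (rule Bochner_Integration.integral_add; rule i[OF Q \<zeta> \<zeta>01])
    ultimately show ?case by (simp only:) (intro tendsto_add add.IH)
  next
    case (coord f i)
    \<comment> \<open>Coordinate i gains one in its exponent. If i lies beyond r the product becomes
      longer, and the values of c from r on, so far invisible, have to be reset to 0.\<close>
    define c' where "c' j = (if j < r then c j else 0) + (if j = i then 1 else 0)" for j
    have "(\<Prod>j<r. x j ^ c j) * x i = (\<Prod>j<max r (Suc i). x j ^ c' j)" for x :: "nat \<Rightarrow> real"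
    proof -
      have "(\<Prod>j<max r (Suc i). x j ^ c' j) = (\<Prod>j<max r (Suc i). x j ^ (if j < r then c j else 0)) * (\<Prod>j<max r (Suc i). x j ^ (if j = i then 1 else 0))"
        by (simp add: c'_def power_add prod.distrib)
      also have "(\<Prod>j<max r (Suc i). x j ^ (if j < r then c j else 0)) = (\<Prod>j<r. x j ^ c j)"
        by (rule prod.mono_neutral_cong_right) auto
      also have "(\<Prod>j<max r (Suc i). x j ^ (if j = i then 1 else 0)) = (\<Prod>j\<in>{i}. x j)"
        by (rule prod.mono_neutral_cong_right) auto
      finally show ?thesis by simp
    qed
    then show ?case using coord.IH[of c' "max r (Suc i)"] by (simp add: mult.assoc[symmetric])
  qed
  have fr: "function_ring_on coordinate_polynomials ?K"
  proof
    show "compact ?K" by (rule compact_unit_cube)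
  next
    fix x y :: "nat \<Rightarrow> real" assume "x \<noteq> y"
    then obtain i where "x i \<noteq> y i" by blast
    then show "\<exists>f\<in>coordinate_polynomials. f x \<noteq> f y"
      by (intro bexI[OF _ coordinate_polynomials.coord[OF coordinate_polynomials.const[of 1], of i]]) simp
  qed (auto intro: coordinate_polynomials.intros coordinate_polynomials_mult
      continuous_on_subset[OF coordinate_polynomials_continuous])
  show ?thesis
  proof (rule tendstoI)
    fix e :: real assume e: "0 < e"
    obtain p where p: "p \<in> coordinate_polynomials" and pe: "\<And>x. x \<in> ?K \<Longrightarrow> \<bar>\<phi> x - p x\<bar> < e/4"
      using function_ring_on.Stone_Weierstrass_basic[OF fr continuous_on_subset[OF \<phi>], of "e/4"] e by auto
    have le: "\<bar>\<phi> x - p x\<bar> \<le> e/4" if "\<And>i. x i \<in> {0..1}" for x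
      using pe[of x] that by (simp add: less_imp_le)
    have closeP: "\<bar>(LINT \<omega>|P n. \<phi> (\<xi> n \<omega>)) - (LINT \<omega>|P n. p (\<xi> n \<omega>))\<bar> \<le> e/4" for n
      by (rule unit_cube_integral_diff[OF P \<xi> \<xi>01 \<phi> coordinate_polynomials_continuous[OF p] le])
    have closeQ: "\<bar>(LINT \<omega>|Q. \<phi> (\<zeta> \<omega>)) - (LINT \<omega>|Q. p (\<zeta> \<omega>))\<bar> \<le> e/4"
      by (rule unit_cube_integral_diff[OF Q \<zeta> \<zeta>01 \<phi> coordinate_polynomials_continuous[OF p] le])
    have "(\<lambda>n. LINT \<omega>|P n. p (\<xi> n \<omega>)) \<longlonglongrightarrow> (LINT \<omega>|Q. p (\<zeta> \<omega>))"
      using poly[OF p, where r=0] by simp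
    from tendstoD[OF this, of "e/4"] e
    have "\<forall>\<^sub>F n in sequentially. dist (LINT \<omega>|P n. p (\<xi> n \<omega>)) (LINT \<omega>|Q. p (\<zeta> \<omega>)) < e/4" by simp
    then show "\<forall>\<^sub>F n in sequentially. dist (LINT \<omega>|P n. \<phi> (\<xi> n \<omega>)) (LINT \<omega>|Q. \<phi> (\<zeta> \<omega>)) < e"
    proof eventually_elim
      case (elim n)
      then show ?case using closeP[of n] closeQ e unfolding dist_real_def by linarith
    qed
  qed
qed

lemma unit_cube_map_convergence:
  fixes \<xi> :: "nat \<Rightarrow> 'a \<Rightarrow> nat \<Rightarrow> real" and \<zeta> :: "'c \<Rightarrow> nat \<Rightarrow> real"
    and \<Phi> :: "(nat \<Rightarrow> real) \<Rightarrow> nat \<Rightarrow> real"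
  assumes P: "\<And>n. prob_space (P n)" and Q: "prob_space Q"
    and \<xi>: "\<And>n. \<xi> n \<in> borel_measurable (P n)" and \<zeta>: "\<zeta> \<in> borel_measurable Q"
    and \<xi>01: "\<And>n \<omega> i. \<xi> n \<omega> i \<in> {0..1}" and \<zeta>01: "\<And>\<omega> i. \<zeta> \<omega> i \<in> {0..1}"
    and mono: "\<And>(c::nat \<Rightarrow> nat) r. (\<lambda>n. LINT \<omega>|P n. (\<Prod>i<r. \<xi> n \<omega> i ^ c i)) \<longlonglongrightarrow> (LINT \<omega>|Q. (\<Prod>i<r. \<zeta> \<omega> i ^ c i))"
    and \<Phi>: "continuous_on UNIV \<Phi>"
  shows "lipschitz_convergence P (\<lambda>n \<omega>. \<Phi> (\<xi> n \<omega>)) Q (\<lambda>\<omega>. \<Phi> (\<zeta> \<omega>))"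
  unfolding lipschitz_convergence_def
proof (intro allI impI)
  fix g :: "(nat \<Rightarrow> real) \<Rightarrow> real" and B L
  assume "\<forall>x y. \<bar>g x - g y\<bar> \<le> L * dist x y"
  then have "continuous_on UNIV g" by (intro lipschitz_imp_continuous) auto
  then have "continuous_on UNIV (\<lambda>x. g (\<Phi> x))"
    using continuous_on_compose2[OF _ \<Phi>] by auto
  from unit_cube_convergence[OF P Q \<xi> \<zeta> \<xi>01 \<zeta>01 mono this]
  show "(\<lambda>n. LINT \<omega>|P n. g (\<Phi> (\<xi> n \<omega>))) \<longlonglongrightarrow> (LINT \<omega>|Q. g (\<Phi> (\<zeta> \<omega>)))" .
qed

section \<open>Regularly varying tails\<close>

text \<open>Values above b are discarded rather than clipped, so that a sum splits into its
  truncated part and its large terms. Negative values, which have probability 0, are discarded as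
  well, which makes the bounds hold everywhere instead of almost everywhere.\<close>

definition trunc :: "real \<Rightarrow> real \<Rightarrow> real" where
  "trunc b x = (if 0 \<le> x \<and> x \<le> b then x else 0)"

lemma trunc_bounds: "0 \<le> trunc b x" "0 \<le> b \<Longrightarrow> trunc b x \<le> b"
  by (auto simp: trunc_def)

lemma trunc_measurable [measurable]: "trunc b \<in> borel_measurable borel"
  unfolding trunc_def by measurable

definition trunc_moment :: "real measure \<Rightarrow> real \<Rightarrow> real \<Rightarrow> real" where
  "trunc_moment L p b = (LINT x|L. trunc b x powr p)"

section \<open>Tails and quantiles\<close>

locale heavy_tail =
  fixes \<alpha> :: real and \<L> :: "real measure"
  assumes \<alpha>_pos: "0 < \<alpha>" and heavy: "\<L> \<in> heavy_tailed \<alpha>"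
begin

abbreviation "G \<equiv> tail \<L>"
abbreviation "a \<equiv> tail_quantile \<L>"
abbreviation "mom \<equiv> trunc_moment \<L>"

sublocale prob_space \<L>
  using heavy by (simp add: heavy_tailed_def)

lemma sets_L [measurable_cong, simp]: "sets \<L> = sets borel"
  using heavy by (simp add: heavy_tailed_def)

lemma space_L [simp]: "space \<L> = UNIV"
  using sets_eq_imp_space_eq[OF sets_L] by simp

sublocale real_distribution \<L>
  by unfold_locales simp_all

lemma AE_nonneg: "AE x in \<L>. 0 \<le> x"
  using heavy by (simp add: heavy_tailed_def)

lemma G_antimono: "s \<le> t \<Longrightarrow> G t \<le> G s"
  unfolding tail_def by (intro finite_measure_mono) auto

lemma G_nonneg: "0 \<le> G t"
  by (simp add: tail_def)

lemma G_cdf: "G t = 1 - cdf \<L> t"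
proof -
  have "{t<..} = space \<L> - {..t}" by auto
  then show ?thesis unfolding tail_def cdf_def by (subst (asm) eq_commute) (metis prob_compl sets_L atMost_borel)
qed

lemma G_tendsto_0: "(G \<longlongrightarrow> 0) at_top"
  using tendsto_diff[OF tendsto_const[of 1] cdf_lim_at_top_prob] by (simp add: G_cdf[abs_def])

lemma G_right_cont: "(G \<longlongrightarrow> G t) (at_right t)"
  using cdf_is_right_cont[of t] unfolding G_cdf[abs_def] continuous_within
  by (intro tendsto_intros)

lemma regular_variation:
  assumes x: "0 < x"
  shows "((\<lambda>t. G (x * t) / G t) \<longlongrightarrow> x powr - \<alpha>) at_top"
proof -
  obtain S where S: "slowly_varying S" and G: "\<And>t. 0 < t \<Longrightarrow> G t = S t * t powr - \<alpha>"
    using heavy by (auto simp: heavy_tailed_def)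
  have "((\<lambda>t. S (x * t) / S t * x powr - \<alpha>) \<longlongrightarrow> 1 * x powr - \<alpha>) at_top"
    using S x by (intro tendsto_mult tendsto_const) (auto simp: slowly_varying_def)
  moreover have "\<forall>\<^sub>F t in at_top. S (x * t) / S t * x powr - \<alpha> = G (x * t) / G t"
    using eventually_gt_at_top[of 0] by eventually_elim (use x in \<open>simp add: G powr_mult\<close>)
  ultimately show ?thesis by (simp add: tendsto_cong)
qed

text \<open>If the tail vanished from some point on, the ratio of G to itself would eventually be
  0/0 = 0, against the limit 1 from regular variation.\<close>

lemma G_pos: "0 < G t"
proof (rule ccontr)
  assume "\<not> 0 < G t"
  then have "G s = 0" if "t \<le> s" for s
    using G_antimono[OF that] G_nonneg[of s] by linarith
  then have "\<forall>\<^sub>F s in at_top. G (1 * s) / G s = 0"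
    by (auto simp: eventually_at_top_linorder)
  then have "((\<lambda>s. G (1 * s) / G s) \<longlongrightarrow> 0) at_top" by (simp add: tendsto_eventually)
  from tendsto_unique[OF _ this regular_variation[of 1]] show False by simp
qed

lemma quantile_set:
  shows "{x. 0 < x \<and> real m * G x \<le> 1} \<noteq> {}" "bdd_below {x. 0 < x \<and> real m * G x \<le> 1}"
proof -
  have "((\<lambda>t. real m * G t) \<longlongrightarrow> 0) at_top" by (rule tendsto_mult_right_zero[OF G_tendsto_0])
  then have "\<forall>\<^sub>F t in at_top. real m * G t < 1" by (rule order_tendstoD) simp
  then have "\<forall>\<^sub>F t in at_top. 0 < t \<and> real m * G t < 1"
    using eventually_gt_at_top[of 0] by eventually_elim simp
  then obtain t where "0 < t \<and> real m * G t < 1" by (auto dest: eventually_happens)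
  then show "{x. 0 < x \<and> real m * G x \<le> 1} \<noteq> {}" by (auto intro!: exI[of _ t])
  show "bdd_below {x. 0 < x \<and> real m * G x \<le> 1}" by (rule bdd_belowI[of _ 0]) auto
qed

lemma quantile_nonneg: "0 \<le> a m"
  unfolding tail_quantile_def by (rule cInf_greatest[OF quantile_set(1)]) auto

lemma quantile_less: "0 < x \<Longrightarrow> x < a m \<Longrightarrow> 1 < real m * G x"
  unfolding tail_quantile_def using cInf_lower[OF _ quantile_set(2), of x m] by (auto simp: not_less[symmetric])

lemma quantile_greater: "a m < x \<Longrightarrow> real m * G x \<le> 1"
proof -
  assume x: "a m < x"
  obtain y where "0 < y" "real m * G y \<le> 1" "y < x"
    using cInf_lessD[OF quantile_set(1), of m x] x by (auto simp: tail_quantile_def)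
  moreover have "real m * G x \<le> real m * G y" using \<open>y < x\<close> by (intro mult_left_mono G_antimono) auto
  ultimately show ?thesis by linarith
qed

text \<open>Right continuity carries the bound from the points above the infimum to the infimum
  itself, even when that is 0 and hence outside the defining set.\<close>

lemma quantile_le_1: "real m * G (a m) \<le> 1"
proof (rule tendsto_upperbound)
  show "((\<lambda>x. real m * G x) \<longlongrightarrow> real m * G (a m)) (at_right (a m))"
    by (intro tendsto_intros G_right_cont)
  show "\<forall>\<^sub>F x in at_right (a m). real m * G x \<le> 1"
    using quantile_greater by (auto simp: eventually_at_filter)
qed simp

lemma quantile_at_top: "filterlim a at_top sequentially"
  unfolding filterlim_at_top
proof
  fix Z :: real
  define z where "z = max Z 1"
  obtain M :: nat where M: "1 / G z < real M" using reals_Archimedean2 by blast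
  have "z \<le> a m" if "m \<ge> M" for m
  proof (rule ccontr)
    assume "\<not> z \<le> a m"
    then have "real m * G z \<le> 1" using quantile_greater by auto
    moreover have "1 < real M * G z" using M G_pos[of z] by (simp add: field_simps)
    moreover have "real M * G z \<le> real m * G z" using that G_nonneg by (intro mult_right_mono) auto
    ultimately show False by linarith
  qed
  then show "\<forall>\<^sub>F m in sequentially. Z \<le> a m"
    unfolding eventually_sequentially z_def by (intro exI[of _ M]) auto
qed

lemma quantile_pos: "\<forall>\<^sub>F m in sequentially. 0 < a m"
  using quantile_at_top by (simp add: filterlim_at_top_dense)

text \<open>G may jump at its quantile, so equality can fail for each single m. But for x > 1 the
  level a m / x lies below the quantile, where m G exceeds 1; hence m G (a m) is at least G (a m) /
  G (a m / x), whose limit x powr -\<alpha> is as close to 1 as desired.\<close>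

lemma quantile_tail: "(\<lambda>m. real m * G (a m)) \<longlonglongrightarrow> 1"
proof (rule order_tendstoI)
  fix c :: real assume c: "c < 1"
  have "((\<lambda>x. x powr - \<alpha>) \<longlongrightarrow> 1 powr - \<alpha>) (at_right 1)"
    by (intro tendsto_intros) auto
  then have "\<forall>\<^sub>F x in at_right 1. c < x powr - \<alpha>" using c by (intro order_tendstoD) auto
  then have "\<forall>\<^sub>F x in at_right 1. c < x powr - \<alpha> \<and> 1 < x"
    using eventually_at_right_less[of "1::real"] by eventually_elim simp
  then obtain x where x: "c < x powr - \<alpha>" "1 < x"
    by (auto dest!: eventually_happens)
  have "filterlim (\<lambda>m. a m * (1/x)) at_top sequentially"
    using x by (intro filterlim_at_top_mult_tendsto_pos[OF tendsto_const _ quantile_at_top]) auto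
  from filterlim_compose[OF regular_variation[of x] this] x
  have "(\<lambda>m. G (a m) / G (a m / x)) \<longlonglongrightarrow> x powr - \<alpha>" by simp
  then have "\<forall>\<^sub>F m in sequentially. c < G (a m) / G (a m / x)" using x by (intro order_tendstoD)
  then show "\<forall>\<^sub>F m in sequentially. c < real m * G (a m)"
    using quantile_pos
  proof eventually_elim
    case (elim m)
    have "1 < real m * G (a m / x)"
      using elim x by (intro quantile_less) (auto simp: field_simps)
    then have "1 / G (a m / x) < real m" using G_pos[of "a m / x"] by (simp add: field_simps)
    then have "G (a m) * (1 / G (a m / x)) \<le> G (a m) * real m" using G_nonneg by (intro mult_left_mono) auto
    then show ?case using elim by (simp add: mult.commute)
  qed
next
  fix c :: real assume "1 < c"
  then show "\<forall>\<^sub>F m in sequentially. real m * G (a m) < c"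
    using quantile_le_1 by (auto intro!: always_eventually intro: le_less_trans)
qed

text \<open>The left side is the expected number of values above x a m among m samples, so the limit
  is the tail of the limiting intensity measure.\<close>

lemma quantile_tail_scaled:
  assumes x: "0 < x"
  shows "(\<lambda>m. real m * G (x * a m)) \<longlonglongrightarrow> x powr - \<alpha>"
proof -
  have "(\<lambda>m. G (x * a m) / G (a m) * (real m * G (a m))) \<longlonglongrightarrow> x powr - \<alpha> * 1"
    by (intro tendsto_mult quantile_tail filterlim_compose[OF regular_variation[OF x] quantile_at_top])
  moreover have "G (x * a m) / G (a m) * (real m * G (a m)) = real m * G (x * a m)" for m
    using G_pos[of "a m"] by simp
  ultimately show ?thesis by simp
qed

section \<open>Truncated moments\<close>

lemma trunc_powr_integrable: "0 \<le> p \<Longrightarrow> integrable \<L> (\<lambda>x. trunc b x powr p)"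
proof (cases "0 \<le> b")
  case True
  assume "0 \<le> p"
  then show ?thesis
    using True by (intro integrable_const_bound[of _ "b powr p"]) (auto intro!: powr_mono2 trunc_bounds)
next
  case False
  then have "trunc b = (\<lambda>_. 0)" by (auto simp: trunc_def fun_eq_iff)
  then show ?thesis by simp
qed

lemma trunc_integrable [simp]: "integrable \<L> (trunc b)"
  using trunc_powr_integrable[of 1 b] by (simp add: trunc_bounds)

lemma mom_nonneg: "0 \<le> mom p b"
  unfolding trunc_moment_def by (intro Bochner_Integration.integral_nonneg) auto

lemma mom_le: "0 \<le> p \<Longrightarrow> 0 \<le> b \<Longrightarrow> mom p b \<le> b powr p"
proof -
  assume p: "0 \<le> p" "0 \<le> b"
  have "mom p b \<le> (LINT x|\<L>. b powr p)" unfolding trunc_moment_def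
    by (intro integral_mono trunc_powr_integrable) (use p in \<open>auto intro!: powr_mono2 trunc_bounds\<close>)
  then show ?thesis using prob_space by simp
qed

text \<open>Each value in (b, c] contributes at most c powr p. With c = 2 b this is the dyadic step
  of Karamata's bound; with b the quantile it controls a change of truncation level in the weak
  law.\<close>

lemma mom_diff_le:
  assumes p: "0 < p" and b: "0 \<le> b" "b \<le> c"
  shows "mom p c \<le> mom p b + c powr p * G b"
proof -
  have "mom p c \<le> (LINT x|\<L>. trunc b x powr p + c powr p * indicator {b<..} x)"
    unfolding trunc_moment_def
  proof (rule integral_mono)
    show "integrable \<L> (\<lambda>x. trunc b x powr p + c powr p * indicator {b<..} x)"
      using p by (intro Bochner_Integration.integrable_add trunc_powr_integrable integrable_mult_right integrable_real_indicator)
        (auto simp: less_top[symmetric])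
    show "trunc c x powr p \<le> trunc b x powr p + c powr p * indicator {b<..} x" for x
      using p b by (auto simp: trunc_def indicator_def not_le intro: powr_mono2)
  qed (use p in \<open>simp add: trunc_powr_integrable\<close>)
  also have "\<dots> = mom p b + c powr p * G b"
    unfolding trunc_moment_def tail_def using p
    by (subst Bochner_Integration.integral_add) (auto simp: trunc_powr_integrable trunc_bounds less_top[symmetric])
  finally show ?thesis .
qed

lemma mom_mono: "0 \<le> p \<Longrightarrow> b \<le> c \<Longrightarrow> mom p b \<le> mom p c"
  unfolding trunc_moment_def
  by (intro integral_mono trunc_powr_integrable powr_mono2) (auto simp: trunc_def)

text \<open>The matching lower estimate for first moments: each value in (b, c] contributes at least
  b. It feeds the dyadic sum at \<alpha> = 1 and the positivity of truncated means.\<close>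

lemma mom_diff_ge:
  assumes b: "0 \<le> b" "b \<le> c"
  shows "mom 1 b + b * (G b - G c) \<le> mom 1 c"
proof -
  have m: "measure \<L> {b<..c} = G b - G c"
  proof -
    have "{b<..c} = {b<..} - {c<..}" by auto
    then show ?thesis using b unfolding tail_def by (simp add: finite_measure_Diff)
  qed
  have "mom 1 b + b * measure \<L> {b<..c} = (LINT x|\<L>. trunc b x powr 1 + b * indicator {b<..c} x)"
    unfolding trunc_moment_def
    by (subst Bochner_Integration.integral_add) (auto simp: trunc_powr_integrable trunc_bounds less_top[symmetric])
  also have "\<dots> \<le> mom 1 c"
    unfolding trunc_moment_def
  proof (rule integral_mono)
    show "integrable \<L> (\<lambda>x. trunc b x powr 1 + b * indicator {b<..c} x)"
      by (intro Bochner_Integration.integrable_add trunc_powr_integrable integrable_mult_right integrable_real_indicator)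
        (auto simp: less_top[symmetric])
    show "trunc b x powr 1 + b * indicator {b<..c} x \<le> trunc c x powr 1" for x
      using b by (auto simp: trunc_def indicator_def)
  qed (simp add: trunc_powr_integrable trunc_bounds)
  finally show ?thesis by (simp add: m)
qed

text \<open>Karamata's bound, by dyadic induction: \<open>h b = b powr p * G b\<close> satisfies
  \<open>h (2 b) \<ge> q * h b\<close> with \<open>q > 1\<close> for large \<open>b\<close>.\<close>

lemma karamata:
  assumes p: "\<alpha> < p"
  shows "\<exists>C>0. \<exists>t\<^sub>0>0. \<forall>b\<ge>t\<^sub>0. mom p b \<le> C * (b powr p * G b)"
proof -
  have p0: "0 < p" using p \<alpha>_pos by simp
  define h where "h b = b powr p * G b" for b
  \<comment> \<open>The midpoint between 1 and the limit 2 powr (p - \<alpha>) of h (2 b) / h b: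
    still a growth factor above 1, yet eventually exceeded by the ratio.\<close>
  define q where "q = (1 + 2 powr (p - \<alpha>)) / 2"
  have q: "1 < q" "q < 2 powr (p - \<alpha>)" using p by (auto simp: q_def)
  have "((\<lambda>t. 2 powr p * (G (2 * t) / G t)) \<longlongrightarrow> 2 powr p * 2 powr - \<alpha>) at_top"
    by (intro tendsto_intros regular_variation) auto
  also have "2 powr p * 2 powr - \<alpha> = 2 powr (p - \<alpha>)" by (simp flip: powr_add)
  finally have "\<forall>\<^sub>F t in at_top. q < 2 powr p * (G (2 * t) / G t)" using q by (intro order_tendstoD)
  then obtain t where t: "\<And>b. t \<le> b \<Longrightarrow> q < 2 powr p * (G (2 * b) / G b)"
    by (auto simp: eventually_at_top_linorder)
  define t\<^sub>0 where "t\<^sub>0 = max t 1"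
  have t0: "0 < t\<^sub>0" by (simp add: t\<^sub>0_def)
  have hpos: "0 < h b" if "0 < b" for b using that G_pos[of b] by (simp add: h_def)
  have h2: "q * h b \<le> h (2 * b)" if "t\<^sub>0 \<le> b" for b
  proof -
    have "q * G b < 2 powr p * G (2 * b)" using t[of b] that G_pos[of b] by (simp add: t\<^sub>0_def field_simps)
    then have "b powr p * (q * G b) \<le> b powr p * (2 powr p * G (2 * b))" by (intro mult_left_mono) auto
    then show ?thesis using that t0 by (simp add: h_def powr_mult algebra_simps)
  qed
  \<comment> \<open>The first entry settles the base range up to \<open>2 * t\<^sub>0\<close>; the
    second gives (C + 2 powr p) / q \<le> C, which lets the induction reproduce its own
    constant.\<close>
  define C where "C = max ((2 * t\<^sub>0) powr p / (t\<^sub>0 powr p * G (2 * t\<^sub>0))) (2 powr p / (q - 1))"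
  have C: "0 < C" using q by (auto simp: C_def less_max_iff_disj)
  have step: "(C + 2 powr p) / q \<le> C"
  proof -
    have "2 powr p \<le> C * (q - 1)" using q by (simp add: C_def flip: pos_divide_le_eq)
    then show ?thesis using q by (simp add: field_simps)
  qed
  have main: "mom p b \<le> C * h b" if "t\<^sub>0 \<le> b" "b \<le> 2 ^ Suc n * t\<^sub>0" for b n
    using that
  proof (induction n arbitrary: b)
    case 0
    have "mom p b \<le> b powr p" using 0 t0 p0 by (intro mom_le) auto
    also have "\<dots> \<le> (2 * t\<^sub>0) powr p" using 0 t0 p0 by (intro powr_mono2) auto
    also have "\<dots> \<le> C * (t\<^sub>0 powr p * G (2 * t\<^sub>0))"
    proof -
      have "(2 * t\<^sub>0) powr p / (t\<^sub>0 powr p * G (2 * t\<^sub>0)) \<le> C" by (simp add: C_def)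
      then show ?thesis using t0 G_pos[of "2 * t\<^sub>0"] by (simp add: pos_divide_le_eq)
    qed
    also have "\<dots> \<le> C * h b" unfolding h_def
      using 0 t0 p0 C by (intro mult_left_mono mult_mono powr_mono2 G_antimono G_nonneg) auto
    finally show ?case .
  next
    case (Suc n)
    show ?case
    proof (cases "b \<le> 2 * t\<^sub>0")
      case True
      have "2 * t\<^sub>0 \<le> 2 ^ Suc n * t\<^sub>0" using t0 by (intro mult_right_mono) auto
      then show ?thesis using Suc True by simp
    next
      case False
      let ?d = "b / 2"
      have d: "t\<^sub>0 \<le> ?d" "?d \<le> 2 ^ Suc n * t\<^sub>0" using False Suc.prems by auto
      have "mom p b \<le> mom p ?d + b powr p * G ?d" using d t0 p0 by (intro mom_diff_le) auto
      also have "b powr p * G ?d = 2 powr p * h ?d" using d t0 by (simp add: h_def powr_divide)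
      also have "mom p ?d + 2 powr p * h ?d \<le> (C + 2 powr p) * h ?d" using Suc.IH[OF d] by (simp add: algebra_simps)
      also have "\<dots> = (C + 2 powr p) / q * (q * h ?d)" using q by simp
      also have "\<dots> \<le> C * h (2 * ?d)" using step h2[OF d(1)] hpos[of ?d] C q d t0
        by (intro mult_mono) auto
      finally show ?thesis by simp
    qed
  qed
  have "mom p b \<le> C * (b powr p * G b)" if b: "t\<^sub>0 \<le> b" for b
  proof -
    obtain n :: nat where "b / t\<^sub>0 < 2 ^ n" using real_arch_pow[of 2 "b / t\<^sub>0"] by auto
    then have "b \<le> 2 ^ n * t\<^sub>0" using t0 by (simp add: field_simps)
    also have "\<dots> \<le> 2 ^ Suc n * t\<^sub>0" using t0 by simp
    finally show ?thesis using main[OF b] by (simp add: h_def)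
  qed
  with C t0 show ?thesis by blast
qed

lemma scaled_quantile_at_top: "0 < x \<Longrightarrow> filterlim (\<lambda>m. x * a m) at_top sequentially"
  by (rule filterlim_tendsto_pos_mult_at_top[OF tendsto_const _ quantile_at_top])

text \<open>The constant does not depend on x; only the index from which the bound holds does. So x
  can be chosen afterwards to make x powr (p - \<alpha>) small.\<close>

lemma trunc_moment_quantile:
  assumes p: "\<alpha> < p"
  shows "\<exists>C>0. \<forall>x>0. \<forall>\<^sub>F m in sequentially. real m * mom p (x * a m) \<le> C * x powr (p - \<alpha>) * a m powr p"
proof -
  obtain C t\<^sub>0 where C: "0 < C" "0 < t\<^sub>0" "\<And>b. t\<^sub>0 \<le> b \<Longrightarrow> mom p b \<le> C * (b powr p * G b)"
    using karamata[OF p] by blast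
  have "\<forall>\<^sub>F m in sequentially. real m * mom p (x * a m) \<le> (2 * C) * x powr (p - \<alpha>) * a m powr p"
    if x: "0 < x" for x
  proof -
    have "\<forall>\<^sub>F m in sequentially. real m * G (x * a m) < 2 * x powr - \<alpha>"
      using x by (intro order_tendstoD(2)[OF quantile_tail_scaled]) auto
    moreover have "\<forall>\<^sub>F m in sequentially. t\<^sub>0 \<le> x * a m"
      using scaled_quantile_at_top[OF x] by (auto simp: filterlim_at_top)
    ultimately show ?thesis
    proof eventually_elim
      case (elim m)
      have "real m * mom p (x * a m) \<le> real m * (C * ((x * a m) powr p * G (x * a m)))"
        using C(3)[OF elim(2)] by (intro mult_left_mono) auto
      also have "\<dots> = C * (x * a m) powr p * (real m * G (x * a m))" by (simp add: algebra_simps)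
      also have "\<dots> \<le> C * (x * a m) powr p * (2 * x powr - \<alpha>)"
        using elim C by (intro mult_left_mono) auto
      also have "\<dots> = (2 * C) * (x powr p * x powr - \<alpha>) * a m powr p"
        using x quantile_nonneg[of m] by (simp add: powr_mult)
      also have "x powr p * x powr - \<alpha> = x powr (p - \<alpha>)" by (simp flip: powr_add)
      finally show ?case .
    qed
  qed
  then show ?thesis using C(1) by (intro exI[of _ "2 * C"]) auto
qed

text \<open>Integrates the pointwise bound y \<le> s + s powr (1 - p) * y powr p: either y is at
  most s, or y powr (p - 1) is at least s powr (p - 1). The level s is left free for
  balancing.\<close>

lemma mom_1_le:
  assumes p: "1 \<le> p" and s: "0 < s"
  shows "mom 1 b \<le> s + s powr (1 - p) * mom p b"
proof -
  have "mom 1 b \<le> (LINT x|\<L>. s + s powr (1 - p) * trunc b x powr p)"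
    unfolding trunc_moment_def
  proof (rule integral_mono)
    show "integrable \<L> (\<lambda>x. s + s powr (1 - p) * trunc b x powr p)"
      using p by (intro Bochner_Integration.integrable_add integrable_mult_right trunc_powr_integrable) auto
    show "trunc b x powr 1 \<le> s + s powr (1 - p) * trunc b x powr p" for x
    proof (cases "trunc b x \<le> s")
      case True
      then show ?thesis using trunc_bounds(1)[of b x] by (simp add: add_increasing2)
    next
      case False
      let ?y = "trunc b x"
      have "?y = s powr (1 - p) * s powr (p - 1) * ?y" using s False by (simp flip: powr_add)
      also have "\<dots> \<le> s powr (1 - p) * ?y powr (p - 1) * ?y"
        using False s p by (intro mult_right_mono mult_left_mono powr_mono2) auto
      also have "\<dots> = s powr (1 - p) * ?y powr p" using False s by (simp add: powr_diff)
      finally show ?thesis using s False by simp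
    qed
  qed (simp add: trunc_powr_integrable trunc_bounds)
  also have "\<dots> = s + s powr (1 - p) * mom p b"
    unfolding trunc_moment_def using p
    by (subst Bochner_Integration.integral_add) (use prob_space in \<open>auto simp: trunc_powr_integrable trunc_bounds\<close>)
  finally show ?thesis .
qed

text \<open>A vertex has about sqrt (2 m) edges, so this makes the mean light weight at a vertex
  negligible against a m. Interpolating with a moment of order p < 2 leaves a factor m powr ((p - 2)
  / 2).\<close>

lemma sqrt_mom_1:
  assumes "\<alpha> < 2" and x: "0 < x"
  shows "(\<lambda>m. sqrt (real m) * mom 1 (x * a m) / a m) \<longlonglongrightarrow> 0"
proof (rule order_tendstoI)
  fix e :: real assume e: "0 < e"
  \<comment> \<open>Karamata's bound needs p > \<alpha>, the interpolation p \<ge> 1, and the decay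
    p < 2.\<close>
  define p where "p = (max \<alpha> 1 + 2) / 2"
  have p: "\<alpha> < p" "1 \<le> p" "p < 2" using assms by (auto simp: p_def max_def)
  define \<eta> where "\<eta> = e / 2"
  have \<eta>: "0 < \<eta>" using e by (simp add: \<eta>_def)
  obtain C where C: "0 < C"
    "\<And>x. 0 < x \<Longrightarrow> \<forall>\<^sub>F m in sequentially. real m * mom p (x * a m) \<le> C * x powr (p - \<alpha>) * a m powr p"
    using trunc_moment_quantile[OF p(1)] by blast
  define D where "D = \<eta> powr (1 - p) * (C * x powr (p - \<alpha>))"
  have "(\<lambda>m. real m powr ((p - 2) / 2)) \<longlonglongrightarrow> 0"
    using p by (intro tendsto_neg_powr filterlim_real_sequentially) auto
  then have "(\<lambda>m. D * real m powr ((p - 2) / 2)) \<longlonglongrightarrow> 0" by (rule tendsto_mult_right_zero)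
  then have "\<forall>\<^sub>F m in sequentially. D * real m powr ((p - 2) / 2) < e / 2" using e by (intro order_tendstoD) auto
  then show "\<forall>\<^sub>F m in sequentially. sqrt (real m) * mom 1 (x * a m) / a m < e"
    using C(2)[OF x] quantile_pos eventually_gt_at_top[of 0]
  proof eventually_elim
    case (elim m)
    define r where "r = sqrt (real m)"
    have r: "0 < r" "r * r = real m" using elim by (auto simp: r_def)
    have am: "0 < a m" by fact
    \<comment> \<open>Chosen so that the first term of the interpolation becomes exactly \<eta> = e
      / 2 after multiplication by r / a m.\<close>
    define s where "s = \<eta> * a m / r"
    have s: "0 < s" using \<eta> am r by (simp add: s_def)
    have "mom 1 (x * a m) \<le> s + s powr (1 - p) * mom p (x * a m)" by (rule mom_1_le[OF p(2) s])
    also have "mom p (x * a m) \<le> C * x powr (p - \<alpha>) * a m powr p / (r * r)"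
      using elim r(2) by (simp add: pos_le_divide_eq mult.commute)
    finally have "mom 1 (x * a m) \<le> s + s powr (1 - p) * (C * x powr (p - \<alpha>) * a m powr p / (r * r))"
      by (simp add: mult_left_mono)
    then have "r * mom 1 (x * a m) / a m \<le> r * (s + s powr (1 - p) * (C * x powr (p - \<alpha>) * a m powr p / (r * r))) / a m"
      using r am by (intro divide_right_mono mult_left_mono) auto
    also have "\<dots> = r * s / a m + D * (a m powr (1 - p) * a m powr p / a m) * (r powr (p - 1) / r)"
      using r am \<eta> by (simp add: s_def D_def powr_mult powr_divide field_simps powr_diff)
    also have "r * s / a m = e / 2" using r am by (simp add: s_def \<eta>_def)
    also have "a m powr (1 - p) * a m powr p / a m = 1" using am by (simp flip: powr_add)
    also have "r powr (p - 1) / r = real m powr ((p - 2) / 2)"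
    proof -
      have "r powr (p - 1) / r = r powr (p - 2)" using r by (simp add: powr_diff power2_eq_square)
      also have "\<dots> = real m powr ((p - 2) / 2)" unfolding r_def by (simp add: powr_half_sqrt[symmetric] powr_powr)
      finally show ?thesis .
    qed
    finally show ?case using elim by (simp add: r_def)
  qed
next
  fix e :: real assume e: "e < 0"
  have "0 \<le> sqrt (real m) * mom 1 (x * a m) / a m" for m
    by (intro divide_nonneg_nonneg mult_nonneg_nonneg mom_nonneg quantile_nonneg) auto
  then show "\<forall>\<^sub>F m in sequentially. e < sqrt (real m) * mom 1 (x * a m) / a m"
    using e by (intro always_eventually allI) (rule less_le_trans)
qed

lemma truncated_mean_eq: "truncated_mean \<L> m = mom 1 (a m)"
  unfolding truncated_mean_def set_lebesgue_integral_def trunc_moment_def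
  by (intro Bochner_Integration.integral_cong) (auto simp: trunc_def indicator_def)

lemma mom_1_tendsto_mean:
  assumes "has_bochner_integral \<L> (\<lambda>x. x) \<mu>"
  shows "(\<lambda>m. mom 1 (a m)) \<longlonglongrightarrow> \<mu>"
proof -
  have "(\<lambda>m. LINT x|\<L>. trunc (a m) x powr 1) \<longlonglongrightarrow> (LINT x|\<L>. x)"
  proof (rule integral_dominated_convergence[where w="\<lambda>x. \<bar>x\<bar>"])
    show "AE x in \<L>. (\<lambda>m. trunc (a m) x powr 1) \<longlonglongrightarrow> x"
      using AE_nonneg
    proof eventually_elim
      case (elim x)
      have "\<forall>\<^sub>F m in sequentially. x \<le> a m" using quantile_at_top by (auto simp: filterlim_at_top)
      then have "\<forall>\<^sub>F m in sequentially. trunc (a m) x powr 1 = x"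
        by eventually_elim (use elim in \<open>simp add: trunc_def\<close>)
      then show ?case by (rule tendsto_eventually)
    qed
  qed (use assms in \<open>auto simp: trunc_def has_bochner_integral_iff\<close>)
  then show ?thesis using assms by (simp add: trunc_moment_def has_bochner_integral_iff)
qed

text \<open>By integrability a m * G (a m), which is at most the mean of the values above a m, tends
  to 0. Since m G (a m) tends to 1, this says that a m / m tends to 0.\<close>

lemma quantile_negligible_of_mean:
  assumes "has_bochner_integral \<L> (\<lambda>x. x) \<mu>" "0 < \<mu>"
  shows "(\<lambda>m. a m / (real m * mom 1 (a m))) \<longlonglongrightarrow> 0"
proof -
  have int: "integrable \<L> (\<lambda>x. x)" using assms by (simp add: has_bochner_integral_iff)
  have lim: "(\<lambda>m. LINT x|\<L>. x * indicator {a m<..} x) \<longlonglongrightarrow> (LINT x|\<L>. 0)"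
  proof (rule integral_dominated_convergence[where w="\<lambda>x. \<bar>x\<bar>"])
    show "AE x in \<L>. (\<lambda>m. x * indicator {a m<..} x) \<longlonglongrightarrow> 0"
    proof (rule AE_I2)
      fix x
      have "\<forall>\<^sub>F m in sequentially. x \<le> a m" using quantile_at_top by (auto simp: filterlim_at_top)
      then have "\<forall>\<^sub>F m in sequentially. x * indicator {a m<..} x = 0"
        by eventually_elim (simp add: indicator_def)
      then show "(\<lambda>m. x * indicator {a m<..} x) \<longlonglongrightarrow> 0" by (rule tendsto_eventually)
    qed
    show "(\<lambda>x. x * indicator {a m<..} x) \<in> borel_measurable \<L>" for m by measurable
    show "integrable \<L> (\<lambda>x. \<bar>x\<bar>)" using int by simp
    show "AE x in \<L>. norm (x * indicator {a m<..} x) \<le> \<bar>x\<bar>" for m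
      by (rule AE_I2) (simp split: split_indicator)
  qed simp
  have le: "a m * G (a m) \<le> (LINT x|\<L>. x * indicator {a m<..} x)" for m
  proof -
    have "a m * G (a m) = (LINT x|\<L>. a m * indicator {a m<..} x)" by (simp add: tail_def)
    also have "\<dots> \<le> (LINT x|\<L>. x * indicator {a m<..} x)"
    proof (rule integral_mono)
      show "integrable \<L> (\<lambda>x. a m * indicator {a m<..} x)"
        by (intro integrable_mult_right integrable_real_indicator) (auto simp: less_top[symmetric])
      show "integrable \<L> (\<lambda>x. x * indicator {a m<..} x)"
        using integrable_mult_indicator[OF _ int, of "{a m<..}"] by (simp add: mult.commute)
    qed (simp split: split_indicator)
    finally show ?thesis .
  qed
  have aG: "(\<lambda>m. a m * G (a m)) \<longlonglongrightarrow> 0"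
    by (rule tendsto_sandwich[OF _ _ tendsto_const])
      (use lim le in \<open>auto intro!: always_eventually mult_nonneg_nonneg quantile_nonneg G_nonneg\<close>)
  have "(\<lambda>m. a m * G (a m) / (real m * G (a m)) / mom 1 (a m)) \<longlonglongrightarrow> 0 / 1 / \<mu>"
    using assms by (intro tendsto_divide aG quantile_tail mom_1_tendsto_mean) auto
  moreover have "a m * G (a m) / (real m * G (a m)) / mom 1 (a m) = a m / (real m * mom 1 (a m))" for m
    using G_pos[of "a m"] by simp
  ultimately show ?thesis by simp
qed

text \<open>At \<open>\<alpha> = 1\<close> every dyadic block below the quantile contributes about \<open>a m / (2 m)\<close> to the
  truncated mean, so the truncated mean is of larger order than \<open>a m / m\<close>.\<close>

lemma quantile_negligible_of_one:
  assumes \<alpha>: "\<alpha> = 1"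
  shows "(\<lambda>m. a m / (real m * mom 1 (a m))) \<longlonglongrightarrow> 0"
proof (rule order_tendstoI)
  fix e :: real assume e: "0 < e"
  \<comment> \<open>J blocks, each with limit 1/2, eventually add up to more than J / 4, so J > 4 /
    e is enough.\<close>
  obtain J :: nat where J: "4 / e < real J" using reals_Archimedean2 by blast
  have J0: "0 < real J" using J e by (smt (verit) divide_pos_pos)
  define c where "c j = (1/2::real) ^ j" for j
  have block: "(\<lambda>m. c (Suc j) * (real m * G (c (Suc j) * a m) - real m * G (c j * a m))) \<longlonglongrightarrow> 1 / 2" for j
  proof -
    have "(\<lambda>m. c (Suc j) * (real m * G (c (Suc j) * a m) - real m * G (c j * a m))) \<longlonglongrightarrow>
      c (Suc j) * (c (Suc j) powr - \<alpha> - c j powr - \<alpha>)"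
      by (intro tendsto_intros quantile_tail_scaled) (auto simp: c_def)
    also have "c (Suc j) * (c (Suc j) powr - \<alpha> - c j powr - \<alpha>) = 1 / 2"
      by (simp add: \<alpha> c_def powr_minus field_simps)
    finally show ?thesis .
  qed
  have "(\<lambda>m. \<Sum>j<J. c (Suc j) * (real m * G (c (Suc j) * a m) - real m * G (c j * a m))) \<longlonglongrightarrow> (\<Sum>j<J. 1 / 2)"
    by (intro tendsto_sum block)
  then have "\<forall>\<^sub>F m in sequentially. real J / 4 < (\<Sum>j<J. c (Suc j) * (real m * G (c (Suc j) * a m) - real m * G (c j * a m)))"
    using J0 by (intro order_tendstoD) auto
  then show "\<forall>\<^sub>F m in sequentially. a m / (real m * mom 1 (a m)) < e"
    using quantile_pos eventually_gt_at_top[of 0]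
  proof eventually_elim
    case (elim m)
    have tel: "mom 1 (c i * a m) + (\<Sum>j<i. c (Suc j) * a m * (G (c (Suc j) * a m) - G (c j * a m))) \<le> mom 1 (a m)" for i
    proof (induction i)
      case 0
      show ?case by (simp add: c_def)
    next
      case (Suc i)
      have "mom 1 (c (Suc i) * a m) + c (Suc i) * a m * (G (c (Suc i) * a m) - G (c i * a m)) \<le> mom 1 (c i * a m)"
        using elim by (intro mom_diff_ge) (auto simp: c_def)
      then show ?case using Suc by simp
    qed
    have "(real J / 4) * a m < (\<Sum>j<J. c (Suc j) * (real m * G (c (Suc j) * a m) - real m * G (c j * a m))) * a m"
      using elim by (intro mult_strict_right_mono) auto
    also have "\<dots> = real m * (\<Sum>j<J. c (Suc j) * a m * (G (c (Suc j) * a m) - G (c j * a m)))"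
      unfolding sum_distrib_left sum_distrib_right by (intro sum.cong) (auto simp: algebra_simps)
    also have "\<dots> \<le> real m * mom 1 (a m)"
      using tel[of J] mom_nonneg[of 1 "c J * a m"] by (intro mult_left_mono) auto
    finally have lt: "(real J / 4) * a m < real m * mom 1 (a m)" .
    have "0 < real J / 4 * a m" using J0 elim by simp
    then have pos: "0 < real m * mom 1 (a m)" using lt by linarith
    have "a m < e * (real J / 4 * a m)" using J e elim by (simp add: field_simps)
    also have "\<dots> < e * (real m * mom 1 (a m))" using lt e by simp
    finally show ?case using pos by (simp add: pos_divide_less_eq)
  qed
next
  fix e :: real assume e: "e < 0"
  have "0 \<le> a m / (real m * mom 1 (a m))" for m
    by (intro divide_nonneg_nonneg mult_nonneg_nonneg mom_nonneg quantile_nonneg) auto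
  then show "\<forall>\<^sub>F m in sequentially. e < a m / (real m * mom 1 (a m))"
    using e by (intro always_eventually allI) (rule less_le_trans)
qed

end

section \<open>Independent samples with heavy tails\<close>

locale iid_sample = heavy_tail \<alpha> \<L> + M: prob_space M
  for \<alpha> \<L> and M :: "'a measure" +
  fixes X :: "'e \<Rightarrow> 'a \<Rightarrow> real" and I :: "'e set"
  assumes finite_I: "finite I"
    and indep: "M.indep_vars (\<lambda>_. borel) X I"
    and distr_X: "\<And>e. e \<in> I \<Longrightarrow> distr M borel (X e) = \<L>"
begin

lemma X_measurable: "e \<in> I \<Longrightarrow> X e \<in> borel_measurable M"
  using indep by (auto simp: M.indep_vars_def)

lemma integral_X:
  fixes f :: "real \<Rightarrow> real"
  assumes "e \<in> I" "f \<in> borel_measurable borel"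
  shows "(LINT \<omega>|M. f (X e \<omega>)) = (LINT x|\<L>. f x)"
  using integral_distr[OF X_measurable[OF assms(1)] assms(2)] distr_X[OF assms(1)] by simp

lemma integrable_X:
  fixes f :: "real \<Rightarrow> real"
  assumes "e \<in> I" "f \<in> borel_measurable borel" "integrable \<L> f"
  shows "integrable M (\<lambda>\<omega>. f (X e \<omega>))"
  using integrable_distr_eq[OF X_measurable[OF assms(1)] assms(2)] distr_X[OF assms(1)] assms(3) by simp

lemma AE_X_nonneg: "AE \<omega> in M. \<forall>e\<in>I. 0 \<le> X e \<omega>"
proof (rule AE_finite_allI[OF finite_I])
  fix e assume e: "e \<in> I"
  have "AE x in distr M borel (X e). 0 \<le> x" by (subst distr_X[OF e]) (rule AE_nonneg)
  then show "AE \<omega> in M. 0 \<le> X e \<omega>" by (subst (asm) AE_distr_iff) (auto simp: X_measurable e)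
qed

lemma prob_exceed: "e \<in> I \<Longrightarrow> measure M {\<omega> \<in> space M. b < X e \<omega>} = G b"
  using measure_distr[OF X_measurable, of e "{b<..}"] distr_X[of e]
  by (simp add: tail_def vimage_def Int_def conj_commute)

lemma exceed_sets: "e \<in> I \<Longrightarrow> {\<omega> \<in> space M. b < X e \<omega>} \<in> sets M"
  using X_measurable[of e] by measurable

lemma prob_exists_exceed:
  assumes "J \<subseteq> I"
  shows "measure M {\<omega> \<in> space M. \<exists>e\<in>J. b < X e \<omega>} \<le> real (card J) * G b"
proof -
  have "{\<omega> \<in> space M. \<exists>e\<in>J. b < X e \<omega>} = (\<Union>e\<in>J. {\<omega> \<in> space M. b < X e \<omega>})" by auto
  also have "measure M \<dots> \<le> (\<Sum>e\<in>J. measure M {\<omega> \<in> space M. b < X e \<omega>})"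
    using assms finite_subset[OF assms finite_I] by (intro M.finite_measure_subadditive_finite) (auto intro: exceed_sets)
  also have "\<dots> = (\<Sum>e\<in>J. G b)" using assms by (intro sum.cong prob_exceed) auto
  finally show ?thesis by simp
qed

lemma prob_both_exceed:
  assumes "e \<in> I" "f \<in> I" "e \<noteq> f"
  shows "measure M {\<omega> \<in> space M. b < X e \<omega> \<and> b < X f \<omega>} = G b ^ 2"
proof -
  have "{\<omega> \<in> space M. b < X e \<omega> \<and> b < X f \<omega>} = (\<Inter>g\<in>{e, f}. X g -` {b<..} \<inter> space M)" by auto
  also have "measure M \<dots> = (\<Prod>g\<in>{e, f}. measure M (X g -` {b<..} \<inter> space M))"
    by (rule M.indep_varsD[OF indep]) (use assms in auto)
  also have "\<dots> = G b ^ 2"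
    using assms prob_exceed[of e b] prob_exceed[of f b]
    by (simp add: vimage_def Int_def conj_commute power2_eq_square)
  finally show ?thesis .
qed

lemma generating_function:
  fixes w :: "real \<Rightarrow> real"
  assumes w: "w \<in> borel_measurable borel" "\<And>x. 0 \<le> w x \<and> w x \<le> 1"
  shows "(LINT \<omega>|M. (\<Prod>e\<in>I. w (X e \<omega>))) = (LINT x|\<L>. w x) ^ card I"
proof -
  have ind: "M.indep_vars (\<lambda>_. borel) (\<lambda>e \<omega>. w (X e \<omega>)) I"
    by (rule M.indep_vars_compose2[OF indep]) (use w in auto)
  have intw: "integrable \<L> w"
    by (rule integrable_const_bound[of _ 1]) (use w in auto)
  have "(LINT \<omega>|M. (\<Prod>e\<in>I. w (X e \<omega>))) = (\<Prod>e\<in>I. (LINT \<omega>|M. w (X e \<omega>)))"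
    by (rule M.indep_vars_lebesgue_integral[OF finite_I ind]) (use w intw integrable_X in auto)
  also have "\<dots> = (\<Prod>e\<in>I. (LINT x|\<L>. w x))" using w by (intro prod.cong integral_X) auto
  finally show ?thesis by simp
qed

lemma truncated_sum_expectation:
  assumes J: "J \<subseteq> I"
  shows "integrable M (\<lambda>\<omega>. \<Sum>e\<in>J. trunc b (X e \<omega>))"
    and "(LINT \<omega>|M. (\<Sum>e\<in>J. trunc b (X e \<omega>))) = real (card J) * mom 1 b"
proof -
  have i: "integrable M (\<lambda>\<omega>. trunc b (X e \<omega>))" if "e \<in> J" for e
    using J that by (intro integrable_X) auto
  then show "integrable M (\<lambda>\<omega>. \<Sum>e\<in>J. trunc b (X e \<omega>))" by auto
  have "(LINT \<omega>|M. (\<Sum>e\<in>J. trunc b (X e \<omega>))) = (\<Sum>e\<in>J. LINT \<omega>|M. trunc b (X e \<omega>))"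
    using i by (intro Bochner_Integration.integral_sum) auto
  also have "\<dots> = (\<Sum>e\<in>J. LINT x|\<L>. trunc b x)" using J by (intro sum.cong integral_X) auto
  finally show "(LINT \<omega>|M. (\<Sum>e\<in>J. trunc b (X e \<omega>))) = real (card J) * mom 1 b"
    by (simp add: trunc_moment_def trunc_bounds)
qed

lemma truncated_sum_markov:
  assumes J: "J \<subseteq> I" and s: "0 < s"
  shows "measure M {\<omega> \<in> space M. s \<le> (\<Sum>e\<in>J. trunc b (X e \<omega>))} \<le> real (card J) * mom 1 b / s"
  using integral_Markov_inequality_measure[OF truncated_sum_expectation(1)[OF J], of "{}" b s] s
  by (simp add: truncated_sum_expectation(2)[OF J] sum_nonneg trunc_bounds)

text \<open>Independence makes the products of distinct centred terms integrate to 0, so the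
  variance is at most the sum of the second moments.\<close>

lemma truncated_sum_chebyshev:
  assumes J: "J \<subseteq> I" and b: "0 \<le> b" and s: "0 < s"
  shows "measure M {\<omega> \<in> space M. s \<le> \<bar>(\<Sum>e\<in>J. trunc b (X e \<omega>)) - real (card J) * mom 1 b\<bar>}
           \<le> real (card J) * mom 2 b / s\<^sup>2"
proof -
  define \<mu> where "\<mu> = mom 1 b"
  define Y where "Y e \<omega> = trunc b (X e \<omega>) - \<mu>" for e \<omega>
  have finJ: "finite J" using J finite_I by (rule finite_subset)
  have \<mu>: "\<mu> = (LINT x|\<L>. trunc b x)" by (simp add: \<mu>_def trunc_moment_def trunc_bounds)
  have \<mu>b: "0 \<le> \<mu>" "\<mu> \<le> b" using mom_nonneg[of 1 b] mom_le[of 1 b] b by (auto simp: \<mu>_def)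
  have Yb: "\<bar>Y e \<omega>\<bar> \<le> b" for e \<omega>
    using trunc_bounds(1)[of b "X e \<omega>"] trunc_bounds(2)[OF b, of "X e \<omega>"] \<mu>b by (simp add: Y_def abs_le_iff)
  have Ym: "Y e \<in> borel_measurable M" if "e \<in> J" for e
    using X_measurable[of e] J that by (auto simp: Y_def[abs_def])
  have YYb: "\<bar>Y e \<omega> * Y f \<omega>\<bar> \<le> b * b" for e f \<omega>
    unfolding abs_mult using Yb b by (intro mult_mono) auto
  have YYi: "integrable M (\<lambda>\<omega>. Y e \<omega> * Y f \<omega>)" if "e \<in> J" "f \<in> J" for e f
    by (rule M.integrable_const_bound[of _ "b * b"]) (use YYb Ym that in auto)
  have Yi: "integrable M (Y e)" if "e \<in> J" for e
    by (rule M.integrable_const_bound[of _ b]) (use Yb Ym that in auto)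
  have E0: "(LINT \<omega>|M. Y e \<omega>) = 0" if "e \<in> J" for e
    using that J integrable_X[of e "trunc b"] integral_X[of e "trunc b"]
    by (simp add: Y_def \<mu> subset_eq M.prob_space)
  have Y2: "(LINT \<omega>|M. Y e \<omega> * Y e \<omega>) \<le> mom 2 b" if "e \<in> J" for e
  proof -
    have e: "e \<in> I" using that J by auto
    have ti: "integrable \<L> (\<lambda>x. trunc b x powr 2)" by (rule trunc_powr_integrable) simp
    have "(LINT \<omega>|M. Y e \<omega> * Y e \<omega>) = (LINT x|\<L>. (trunc b x - \<mu>) * (trunc b x - \<mu>))"
      unfolding Y_def by (rule integral_X[OF e]) simp
    also have "\<dots> = (LINT x|\<L>. trunc b x powr 2 - 2 * \<mu> * trunc b x + \<mu> * \<mu>)"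
      by (intro Bochner_Integration.integral_cong) (auto simp: trunc_bounds power2_eq_square algebra_simps)
    also have "\<dots> = mom 2 b - 2 * \<mu> * \<mu> + \<mu> * \<mu>"
      using ti prob_space by (simp add: trunc_moment_def \<mu>)
    also have "\<dots> \<le> mom 2 b" by simp
    finally show ?thesis .
  qed
  have cross: "(LINT \<omega>|M. Y e \<omega> * Y f \<omega>) = 0" if ef: "e \<in> J" "f \<in> J" "e \<noteq> f" for e f
  proof -
    have "M.indep_vars (\<lambda>_. borel) X {e, f}" by (rule M.indep_vars_subset[OF indep]) (use J ef in auto)
    then have "M.indep_vars (\<lambda>_. borel) Y {e, f}"
      unfolding Y_def by (rule M.indep_vars_compose2) simp
    from M.indep_vars_lebesgue_integral[OF _ this] Yi ef E0 show ?thesis by auto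
  qed
  have sumY: "(\<Sum>e\<in>J. trunc b (X e \<omega>)) - real (card J) * \<mu> = (\<Sum>e\<in>J. Y e \<omega>)" for \<omega>
    by (simp add: Y_def sum_subtractf)
  have sq: "(\<Sum>e\<in>J. Y e \<omega>)\<^sup>2 = (\<Sum>e\<in>J. \<Sum>f\<in>J. Y e \<omega> * Y f \<omega>)" for \<omega>
    by (simp add: power2_eq_square sum_product)
  have var: "(LINT \<omega>|M. (\<Sum>e\<in>J. Y e \<omega>)\<^sup>2) \<le> real (card J) * mom 2 b"
  proof -
    have "(LINT \<omega>|M. (\<Sum>e\<in>J. Y e \<omega>)\<^sup>2) = (\<Sum>e\<in>J. \<Sum>f\<in>J. LINT \<omega>|M. Y e \<omega> * Y f \<omega>)"
      unfolding sq using YYi by (simp add: Bochner_Integration.integral_sum)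
    also have "\<dots> = (\<Sum>e\<in>J. LINT \<omega>|M. Y e \<omega> * Y e \<omega>)"
    proof (rule sum.cong[OF refl])
      fix e assume e: "e \<in> J"
      have "(\<Sum>f\<in>J. LINT \<omega>|M. Y e \<omega> * Y f \<omega>) = (\<Sum>f\<in>{e}. LINT \<omega>|M. Y e \<omega> * Y f \<omega>)"
        by (rule sum.mono_neutral_right) (use e finJ cross in auto)
      then show "(\<Sum>f\<in>J. LINT \<omega>|M. Y e \<omega> * Y f \<omega>) = (LINT \<omega>|M. Y e \<omega> * Y e \<omega>)" by simp
    qed
    also have "\<dots> \<le> (\<Sum>e\<in>J. mom 2 b)" by (intro sum_mono Y2)
    finally show ?thesis by simp
  qed
  have sqi: "integrable M (\<lambda>\<omega>. (\<Sum>e\<in>J. Y e \<omega>)\<^sup>2)" unfolding sq using YYi by auto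
  have set_eq: "{\<omega> \<in> space M. s \<le> \<bar>(\<Sum>e\<in>J. trunc b (X e \<omega>)) - real (card J) * mom 1 b\<bar>}
      = {\<omega> \<in> space M. s\<^sup>2 \<le> (\<Sum>e\<in>J. Y e \<omega>)\<^sup>2}"
    using s by (auto simp: sumY[unfolded \<mu>_def] abs_le_square_iff[symmetric])
  have "measure M {\<omega> \<in> space M. s\<^sup>2 \<le> (\<Sum>e\<in>J. Y e \<omega>)\<^sup>2} \<le> (LINT \<omega>|M. (\<Sum>e\<in>J. Y e \<omega>)\<^sup>2) / s\<^sup>2"
    using integral_Markov_inequality_measure[OF sqi, of "{}" "s\<^sup>2"] s by simp
  also have "\<dots> \<le> real (card J) * mom 2 b / s\<^sup>2" by (intro divide_right_mono var) auto
  finally show ?thesis unfolding set_eq .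
qed

end

section \<open>Ranked vertex sums of a heavy matching\<close>

text \<open>In a decreasing list the entries above t form a prefix.\<close>

lemma nth_greater_iff_filter:
  fixes xs :: "'a::linorder list"
  assumes "sorted_wrt (\<ge>) xs" "k < length xs"
  shows "t < xs ! k \<longleftrightarrow> k < length (filter (\<lambda>x. t < x) xs)"
  using assms
proof (induction xs arbitrary: k)
  case (Cons x xs)
  show ?case
  proof (cases "t < x")
    case True
    then show ?thesis using Cons by (cases k) auto
  next
    case False
    then have "filter (\<lambda>x. t < x) xs = []" using Cons.prems by (auto simp: filter_empty_conv)
    moreover have "(x # xs) ! k \<le> x" using Cons.prems by (cases k) auto
    ultimately show ?thesis using False by auto
  qed
qed simp

text \<open>All later statements about ranked values pass through counts above a level by this
  equivalence. From index n on the vector is padded with zeros, so there the level must be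
  nonnegative.\<close>

lemma ranked_vector_greater_iff:
  assumes "k < n \<or> 0 \<le> t"
  shows "t < ranked_vector n r k \<longleftrightarrow> k < card {i \<in> {1..n}. t < r i}"
proof -
  have c: "card {i \<in> {1..n}. t < r i} = length (filter (\<lambda>x. t < x) (map r [1..<Suc n]))"
  proof -
    have "{i \<in> {1..n}. t < r i} = set (filter (\<lambda>i. t < r i) [1..<Suc n])" by auto
    also have "card \<dots> = length (filter (\<lambda>i. t < r i) [1..<Suc n])" by (rule distinct_card) simp
    finally show ?thesis by (simp add: filter_map comp_def del: upt_Suc)
  qed
  show ?thesis
  proof (cases "k < n")
    case True
    let ?xs = "rev (sort (map r [1..<Suc n]))"
    have "sorted_wrt (\<ge>) ?xs" by (simp add: sorted_wrt_rev del: upt_Suc)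
    then have "t < ?xs ! k \<longleftrightarrow> k < length (filter (\<lambda>x. t < x) ?xs)"
      using True by (intro nth_greater_iff_filter) (auto simp del: upt_Suc)
    also have "length (filter (\<lambda>x. t < x) ?xs) = length (filter (\<lambda>x. t < x) (map r [1..<Suc n]))"
      by (metis mset_filter mset_sort rev_filter length_rev size_mset)
    finally show ?thesis by (simp only: ranked_vector_def c True if_True)
  next
    case False
    have "card {i \<in> {1..n}. t < r i} \<le> card {1..n}" by (rule card_mono) auto
    then show ?thesis using False assms by (auto simp: ranked_vector_def)
  qed
qed

lemma ranked_vector_nonneg:
  assumes "\<And>i. i \<in> {1..n} \<Longrightarrow> 0 \<le> r i"
  shows "0 \<le> ranked_vector n r k"
proof (cases "k < n")
  case True
  let ?xs = "rev (sort (map r [1..<Suc n]))"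
  have "?xs ! k \<in> set ?xs" using True by (intro nth_mem) (simp del: upt_Suc)
  then have "?xs ! k \<in> r ` {1..n}" by (auto simp del: upt_Suc)
  then show ?thesis using True assms by (auto simp: ranked_vector_def simp del: upt_Suc)
qed (simp add: ranked_vector_def)

lemma ranked_vector_in_ranked_seqs:
  assumes "\<And>i. i \<in> {1..n} \<Longrightarrow> 0 \<le> r i"
  shows "ranked_vector n r \<in> ranked_seqs"
proof -
  note nn = ranked_vector_nonneg[of n r, OF assms]
  have "ranked_vector n r (Suc k) \<le> ranked_vector n r k" for k
  proof (rule ccontr)
    assume "\<not> ?thesis"
    then have "Suc k < card {i \<in> {1..n}. ranked_vector n r k < r i}"
      using ranked_vector_greater_iff[of "Suc k" n "ranked_vector n r k" r] nn by auto
    then have "ranked_vector n r k < ranked_vector n r k"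
      using ranked_vector_greater_iff[of k n "ranked_vector n r k" r] nn by auto
    then show False by simp
  qed
  then have "antimono (ranked_vector n r)" by (rule decseq_SucI)
  moreover have "ranked_vector n r \<longlonglongrightarrow> 0"
    by (rule tendsto_eventually) (auto simp: ranked_vector_def eventually_sequentially intro!: exI[of _ n])
  ultimately show ?thesis using nn by (simp add: ranked_seqs_def)
qed

text \<open>Two nonnegative reals that exceed the same nonnegative levels coincide, and counts above
  levels transform in the obvious way under scaling.\<close>

lemma ranked_vector_scale:
  assumes nn: "\<And>i. i \<in> {1..n} \<Longrightarrow> 0 \<le> r i" and c: "0 < c"
    and r': "\<And>i. i \<in> {1..n} \<Longrightarrow> r' i = c * r i"
  shows "ranked_vector n r' k = c * ranked_vector n r k"
proof -
  have iff: "t < ranked_vector n r' k \<longleftrightarrow> t < c * ranked_vector n r k" if t: "0 \<le> t" for t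
  proof -
    have "t < ranked_vector n r' k \<longleftrightarrow> k < card {i \<in> {1..n}. t < r' i}"
      using t by (intro ranked_vector_greater_iff) auto
    also have "{i \<in> {1..n}. t < r' i} = {i \<in> {1..n}. t / c < r i}"
      using c r' by (auto simp: pos_divide_less_eq mult.commute)
    also have "k < card \<dots> \<longleftrightarrow> t / c < ranked_vector n r k"
      using t c by (intro ranked_vector_greater_iff[symmetric]) auto
    finally show ?thesis using c by (simp add: pos_divide_less_eq mult.commute)
  qed
  have "0 \<le> ranked_vector n r' k" using nn c r' by (intro ranked_vector_nonneg) auto
  moreover have "0 \<le> c * ranked_vector n r k" using ranked_vector_nonneg[of n r, OF nn] c by simp
  ultimately show ?thesis
    using iff[of "ranked_vector n r' k"] iff[of "c * ranked_vector n r k"] by (auto simp: not_less antisym)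
qed

lemma ranked_vector_measurable:
  assumes "\<And>i. i \<in> {1..n} \<Longrightarrow> (\<lambda>\<omega>. r \<omega> i) \<in> borel_measurable M"
  shows "(\<lambda>\<omega>. ranked_vector n (r \<omega>)) \<in> borel_measurable M"
proof (rule measurable_coordinatewise_then_product)
  fix k
  show "(\<lambda>\<omega>. ranked_vector n (r \<omega>) k) \<in> borel_measurable M"
  proof (cases "k < n")
    case True
    have "{\<omega> \<in> space M. t < ranked_vector n (r \<omega>) k} \<in> sets M" for t
    proof -
      have "(\<lambda>\<omega>. \<Sum>i\<in>{1..n}. indicator {t<..} (r \<omega> i) :: real) \<in> borel_measurable M"
        using assms by (intro borel_measurable_sum measurable_compose[OF _ borel_measurable_indicator]) auto
      moreover have "{\<omega> \<in> space M. t < ranked_vector n (r \<omega>) k} =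
        {\<omega> \<in> space M. real k < (\<Sum>i\<in>{1..n}. indicator {t<..} (r \<omega> i))}"
        using True by (simp add: ranked_vector_greater_iff indicator_def sum.If_cases Int_def)
      ultimately show ?thesis by simp
    qed
    then show ?thesis by (simp add: borel_measurable_iff_greater)
  qed (simp add: ranked_vector_def)
qed

section \<open>Edges and vertex sums of the complete graph\<close>

definition edges :: "nat \<Rightarrow> (nat \<times> nat) set" where
  "edges n = {(i, j). 1 \<le> i \<and> i \<le> j \<and> j \<le> n}"

lemma finite_edges [simp]: "finite (edges n)"
  by (rule finite_subset[of _ "{1..n} \<times> {1..n}"]) (auto simp: edges_def)

lemma card_edges: "card (edges n) = n * (n + 1) div 2"
proof -
  have "edges n = Sigma {1..n} (\<lambda>i. {i..n})" by (auto simp: edges_def)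
  then have "card (edges n) = (\<Sum>i=1..n. n + 1 - i)" by simp
  also have "\<dots> = (\<Sum>i=1..n. i)"
    by (rule sum.reindex_bij_witness[of _ "\<lambda>i. n + 1 - i" "\<lambda>i. n + 1 - i"]) auto
  also have "\<dots> = n * (n + 1) div 2" using gauss_sum_from_Suc_0[of n, where ?'a=nat] by simp
  finally show ?thesis .
qed

text \<open>An edge is counted at both of its ends, a loop only once.\<close>

lemma sum_row_sums:
  fixes u :: "nat \<Rightarrow> nat \<Rightarrow> real"
  assumes sym: "\<And>i j. i \<in> {1..n} \<Longrightarrow> j \<in> {1..n} \<Longrightarrow> u i j = u j i"
  shows "(\<Sum>i=1..n. row_sum n u i) = 2 * (\<Sum>(i, j)\<in>edges n. u i j) - (\<Sum>i=1..n. u i i)"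
proof -
  let ?V = "{1..n}"
  let ?D = "(\<lambda>i. (i, i)) ` ?V" and ?L = "{(i, j) \<in> ?V \<times> ?V. i < j}" and ?H = "{(i, j) \<in> ?V \<times> ?V. j < i}"
  let ?f = "\<lambda>(i, j). u i j"
  have fin: "finite ?D" "finite ?L" "finite ?H"
    by (auto intro: finite_subset[of _ "?V \<times> ?V"])
  have VV: "?V \<times> ?V = (?D \<union> ?L) \<union> ?H"
  proof (intro set_eqI iffI)
    fix p assume p: "p \<in> ?V \<times> ?V"
    obtain i j where ij: "p = (i, j)" by (cases p)
    consider "i = j" | "i < j" | "j < i" by linarith
    then show "p \<in> (?D \<union> ?L) \<union> ?H" using p unfolding ij by cases auto
  qed auto
  have E: "edges n = ?D \<union> ?L" by (auto simp: edges_def)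
  have d1: "?D \<inter> ?L = {}" "(?D \<union> ?L) \<inter> ?H = {}" by auto
  have H: "sum ?f ?H = sum ?f ?L"
    by (rule sum.reindex_bij_witness[of _ prod.swap prod.swap]) (auto intro: sym)
  have D: "sum ?f ?D = (\<Sum>i=1..n. u i i)" by (subst sum.reindex) (auto simp: inj_on_def)
  have "(\<Sum>i=1..n. row_sum n u i) = sum ?f (?V \<times> ?V)"
    by (simp add: row_sum_def sum.cartesian_product)
  also have "\<dots> = sum ?f (?D \<union> ?L) + sum ?f ?H" 
    by (rule trans[OF arg_cong[OF VV, of "sum ?f"] sum.union_disjoint[OF finite_UnI[OF fin(1,2)] fin(3) d1(2)]])
  also have "sum ?f (?D \<union> ?L) = sum ?f ?D + sum ?f ?L" by (rule sum.union_disjoint[OF fin(1,2) d1(1)])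
  also have "sum ?f ?D + sum ?f ?L + sum ?f ?H = 2 * (sum ?f ?D + sum ?f ?L) - sum ?f ?D" using H by simp
  also have "sum ?f ?D + sum ?f ?L = sum ?f (edges n)" unfolding E by (rule sum.union_disjoint[OF fin(1,2) d1(1), symmetric])
  finally show ?thesis by (simp only: D)
qed

text \<open>The deterministic core: under these assumptions the ranked vertex sums repeat each
  edge weight above \<open>\<beta>\<close> twice, up to an error \<open>D\<close>.\<close>

locale heavy_matching =
  fixes n :: nat and u :: "nat \<Rightarrow> nat \<Rightarrow> real" and \<beta> D :: real
  assumes sym: "\<And>i j. i \<in> {1..n} \<Longrightarrow> j \<in> {1..n} \<Longrightarrow> u i j = u j i"
    and nonneg: "\<And>i j. i \<in> {1..n} \<Longrightarrow> j \<in> {1..n} \<Longrightarrow> 0 \<le> u i j"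
    and \<beta>_nonneg: "0 \<le> \<beta>"
    and no_loops: "\<And>i. i \<in> {1..n} \<Longrightarrow> u i i \<le> \<beta>"
    and matching: "\<And>i j j'. i \<in> {1..n} \<Longrightarrow> j \<in> {1..n} \<Longrightarrow> j' \<in> {1..n} \<Longrightarrow> j \<noteq> j' \<Longrightarrow>
      \<not> (\<beta> < u i j \<and> \<beta> < u i j')"
    and light: "\<And>i. i \<in> {1..n} \<Longrightarrow> (\<Sum>j=1..n. if u i j \<le> \<beta> then u i j else 0) \<le> D"
begin

definition heavy :: "real \<Rightarrow> (nat \<times> nat) set" where
  "heavy t = {(i, j) \<in> edges n. t < u i j}"

text \<open>Every heavy edge in both orientations. Projection to the first component then lists the
  ends of heavy edges, without repetition because they form a matching; this is the source of the
  doubling.\<close>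

definition heavy_ordered :: "real \<Rightarrow> (nat \<times> nat) set" where
  "heavy_ordered t = {(i, j) \<in> {1..n} \<times> {1..n}. t < u i j}"

lemma card_heavy_ordered:
  assumes t: "\<beta> \<le> t"
  shows "card (heavy_ordered t) = 2 * card (heavy t)"
proof -
  have ne: "i \<noteq> j" if "(i, j) \<in> heavy_ordered t" for i j
    using that no_loops t by (force simp: heavy_ordered_def)
  have fin: "finite (heavy t)" by (rule finite_subset[OF _ finite_edges[of n]]) (auto simp: heavy_def)
  have "heavy_ordered t = heavy t \<union> prod.swap ` heavy t"
  proof (intro equalityI subsetI)
    fix p assume p: "p \<in> heavy_ordered t"
    obtain i j where ij: "p = (i, j)" by (cases p)
    show "p \<in> heavy t \<union> prod.swap ` heavy t"
    proof (cases "i \<le> j")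
      case True
      then show ?thesis using p ij by (auto simp: heavy_ordered_def heavy_def edges_def)
    next
      case False
      then have "(j, i) \<in> heavy t" using p ij sym by (auto simp: heavy_ordered_def heavy_def edges_def)
      then show ?thesis unfolding ij by (metis UnI2 image_eqI swap_simp)
    qed
  next
    fix p assume "p \<in> heavy t \<union> prod.swap ` heavy t"
    then show "p \<in> heavy_ordered t"
      using sym by (auto simp: heavy_ordered_def heavy_def edges_def)
  qed
  moreover have "heavy t \<inter> prod.swap ` heavy t = {}"
  proof (rule ccontr)
    assume "heavy t \<inter> prod.swap ` heavy t \<noteq> {}"
    then obtain i j where "(i, j) \<in> heavy t" "(j, i) \<in> heavy t" by auto
    then have "(i, i) \<in> heavy_ordered t" by (auto simp: heavy_ordered_def heavy_def edges_def)
    then show False using ne by blast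
  qed
  ultimately have "card (heavy_ordered t) = card (heavy t) + card (prod.swap ` heavy t)"
    using fin by (simp add: card_Un_disjoint)
  also have "card (prod.swap ` heavy t) = card (heavy t)" by (rule card_image) simp
  finally show ?thesis by simp
qed

lemma inj_fst_heavy_ordered: "\<beta> \<le> t \<Longrightarrow> inj_on fst (heavy_ordered t)"
  using matching by (force simp: inj_on_def heavy_ordered_def)

lemma finite_heavy_ordered: "finite (heavy_ordered t)"
  by (rule finite_subset[of _ "{1..n} \<times> {1..n}"]) (auto simp: heavy_ordered_def)

lemma row_sum_ge: "i \<in> {1..n} \<Longrightarrow> j \<in> {1..n} \<Longrightarrow> u i j \<le> row_sum n u i"
  unfolding row_sum_def using nonneg by (intro member_le_sum) auto

lemma card_rows_ge:
  assumes t: "\<beta> \<le> t"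
  shows "2 * card (heavy t) \<le> card {i \<in> {1..n}. t < row_sum n u i}"
proof -
  have "fst ` heavy_ordered t \<subseteq> {i \<in> {1..n}. t < row_sum n u i}"
    using row_sum_ge by (force simp: heavy_ordered_def intro: less_le_trans)
  then have "card (fst ` heavy_ordered t) \<le> card {i \<in> {1..n}. t < row_sum n u i}" by (intro card_mono) auto
  then show ?thesis by (simp add: card_image inj_fst_heavy_ordered t card_heavy_ordered)
qed

text \<open>At most one weight at the vertex exceeds \<beta>, and that one is at most t; the others
  add up to at most D.\<close>

lemma row_sum_le:
  assumes i: "i \<in> {1..n}" and t: "\<beta> \<le> t" and le: "\<And>j. j \<in> {1..n} \<Longrightarrow> u i j \<le> t"
  shows "row_sum n u i \<le> t + D"
proof -
  have "(\<Sum>j=1..n. if u i j \<le> \<beta> then 0 else u i j) \<le> t"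
  proof (cases "\<exists>j0\<in>{1..n}. \<beta> < u i j0")
    case True
    then obtain j0 where j0: "j0 \<in> {1..n}" "\<beta> < u i j0" by blast
    have "(\<Sum>j=1..n. if u i j \<le> \<beta> then 0 else u i j) = (\<Sum>j\<in>{j0}. if u i j \<le> \<beta> then 0 else u i j)"
      by (rule sum.mono_neutral_right) (use j0 matching[OF i _ j0(1)] in \<open>auto simp: not_le\<close>)
    also have "\<dots> \<le> t" using j0 le by simp
    finally show ?thesis .
  next
    case False
    then have "(\<Sum>j=1..n. if u i j \<le> \<beta> then 0 else u i j) = 0" by (intro sum.neutral) (auto simp: not_less)
    then show ?thesis using t \<beta>_nonneg by simp
  qed
  moreover have "row_sum n u i = (\<Sum>j=1..n. if u i j \<le> \<beta> then 0 else u i j) + (\<Sum>j=1..n. if u i j \<le> \<beta> then u i j else 0)"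
    unfolding row_sum_def sum.distrib[symmetric] by (intro sum.cong) auto
  ultimately show ?thesis using light[OF i] by simp
qed

lemma card_rows_le:
  assumes t: "\<beta> \<le> t"
  shows "card {i \<in> {1..n}. t + D < row_sum n u i} \<le> 2 * card (heavy t)"
proof -
  have "{i \<in> {1..n}. t + D < row_sum n u i} \<subseteq> fst ` heavy_ordered t"
  proof
    fix i assume i: "i \<in> {i \<in> {1..n}. t + D < row_sum n u i}"
    then obtain j where "j \<in> {1..n}" "t < u i j" using row_sum_le[of i t] t by (auto simp: not_le[symmetric])
    then have "(i, j) \<in> heavy_ordered t" using i by (auto simp: heavy_ordered_def)
    then show "i \<in> fst ` heavy_ordered t" by force
  qed
  then have "card {i \<in> {1..n}. t + D < row_sum n u i} \<le> card (fst ` heavy_ordered t)"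
    using finite_heavy_ordered by (intro card_mono) auto
  then show ?thesis by (simp add: card_image inj_fst_heavy_ordered t card_heavy_ordered)
qed

text \<open>The vertices with sum above a level are twice as many as the edges above it, up to the
  shift D of the level. Hence rank k among vertices corresponds to rank k div 2 among edges.\<close>

lemma ranked_row_sums:
  assumes t: "\<beta> \<le> t" and D: "0 \<le> D"
  shows "Suc (k div 2) \<le> card (heavy t) \<Longrightarrow> t < ranked_vector n (row_sum n u) k"
    and "t + D < ranked_vector n (row_sum n u) k \<Longrightarrow> Suc (k div 2) \<le> card (heavy t)"
proof -
  have t0: "0 \<le> t" using t \<beta>_nonneg by simp
  show "t < ranked_vector n (row_sum n u) k" if "Suc (k div 2) \<le> card (heavy t)"
    using that card_rows_ge[OF t] t0 by (subst ranked_vector_greater_iff) auto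
  show "Suc (k div 2) \<le> card (heavy t)" if "t + D < ranked_vector n (row_sum n u) k"
  proof -
    have "k < card {i \<in> {1..n}. t + D < row_sum n u i}"
      using that t0 D by (subst (asm) ranked_vector_greater_iff) auto
    then show ?thesis using card_rows_le[OF t] by linarith
  qed
qed

end

text \<open>\<open>at_least k (exp (- N))\<close> is the indicator of \<open>N > k\<close>, and
  \<open>level \<eta> r\<close> recovers a decreasing sequence from its counts above \<open>\<eta>, 2\<eta>, \<dots>, r\<eta>\<close> up to an error \<open>\<eta>\<close>.\<close>

definition at_least :: "nat \<Rightarrow> real \<Rightarrow> real" where
  "at_least k y = max 0 (min 1 ((exp (- real k) - y) / (exp (- real k) - exp (- real (Suc k)))))"

lemma at_least_exp: "at_least k (exp (- real N)) = (if k < N then 1 else 0)"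
proof (cases "k < N")
  case True
  then have "exp (- real N) \<le> exp (- real (Suc k))" by simp
  moreover have "exp (- real (Suc k)) < exp (- real k)" by simp
  ultimately show ?thesis using True by (simp add: at_least_def pos_le_divide_eq)
next
  case False
  then have "exp (- real k) - exp (- real N) \<le> 0" by simp
  moreover have "exp (- real (Suc k)) < exp (- real k)" by simp
  ultimately have "(exp (- real k) - exp (- real N)) / (exp (- real k) - exp (- real (Suc k))) \<le> 0"
    by (intro divide_nonpos_pos) auto
  then show ?thesis using False by (simp add: at_least_def)
qed

lemma at_least_continuous: "continuous_on A (at_least k)"
  unfolding at_least_def[abs_def] by (intro continuous_intros) simp

definition level :: "real \<Rightarrow> nat \<Rightarrow> (nat \<Rightarrow> real) \<Rightarrow> nat \<Rightarrow> real" where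
  "level \<eta> r \<xi> k = \<eta> * (\<Sum>i<r. at_least k (\<xi> i))"

text \<open>A layer-cake formula for the sum of the points above \<eta> i0, each rounded down to the
  grid: such a point exceeds the first i0 levels and adds \<eta> for each further level. Coordinate
  i stands for level \<eta> (i + 1), whence the index i0 - 1. On \<open>exp (- N)\<close> the inner
  sums equal min N K; the cutoff K keeps the formula continuous.\<close>

definition total_level :: "real \<Rightarrow> nat \<Rightarrow> nat \<Rightarrow> nat \<Rightarrow> (nat \<Rightarrow> real) \<Rightarrow> real" where
  "total_level \<eta> r i0 K \<xi> =
     \<eta> * (real i0 * (\<Sum>k<K. at_least k (\<xi> (i0 - 1))) + (\<Sum>i=i0..<r. \<Sum>k<K. at_least k (\<xi> i)))"

lemma at_least_coordinate_continuous: "continuous_on A (\<lambda>\<xi>::nat \<Rightarrow> real. at_least k (\<xi> i))"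
  by (rule continuous_on_compose2[OF at_least_continuous[of UNIV]
        continuous_on_subset[OF continuous_on_product_coordinates]]) auto

lemma level_continuous: "continuous_on A (\<lambda>\<xi>. level \<eta> r \<xi> k)"
  unfolding level_def by (intro continuous_intros at_least_coordinate_continuous)

lemma total_level_continuous: "continuous_on A (total_level \<eta> r i0 K)"
  unfolding total_level_def[abs_def] by (intro continuous_intros at_least_coordinate_continuous)

section \<open>Accuracy of the reconstruction from counts on a grid\<close>

lemma initial_segment:
  fixes r :: nat
  assumes "\<And>i j. i \<le> j \<Longrightarrow> p j \<Longrightarrow> p i"
  shows "{i. i < r \<and> p i} = {..<card {i. i < r \<and> p i}}"
proof -
  have "\<exists>c. {i. i < r \<and> p i} = {..<c}"
  proof (cases "\<exists>i. i < r \<and> \<not> p i")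
    case True
    define c where "c = (LEAST i. i < r \<and> \<not> p i)"
    have c: "c < r \<and> \<not> p c" unfolding c_def using True by (rule LeastI_ex)
    have "i < c \<longleftrightarrow> i < r \<and> p i" for i
      using not_less_Least[of i "\<lambda>i. i < r \<and> \<not> p i"] c assms[of c i] unfolding c_def[symmetric]
      by (meson less_trans not_le)
    then show ?thesis by (intro exI[of _ c]) auto
  next
    case False
    then show ?thesis by (intro exI[of _ r]) auto
  qed
  then obtain c where c: "{i. i < r \<and> p i} = {..<c}" ..
  show ?thesis unfolding c by simp
qed

text \<open>If c grid levels are exceeded, v lies between \<eta> c and \<eta> (c + 1) + D. The slack
  D accommodates the light weights of a vertex sum; it is 0 for the limit sequence.\<close>

lemma level_close:
  fixes N :: "nat \<Rightarrow> nat"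
  assumes anti: "\<And>i j. i \<le> j \<Longrightarrow> N j \<le> N i" and r: "0 < r" and top: "N (r - 1) \<le> k"
    and v: "0 \<le> v" and \<eta>: "0 < \<eta>" and D: "0 \<le> D"
    and lower: "\<And>i. i < r \<Longrightarrow> k < N i \<Longrightarrow> \<eta> * real (Suc i) \<le> v"
    and upper: "\<And>i. i < r \<Longrightarrow> \<eta> * real (Suc i) + D < v \<Longrightarrow> k < N i"
  shows "\<bar>v - level \<eta> r (\<lambda>i. exp (- real (N i))) k\<bar> \<le> \<eta> + D"
proof -
  define c where "c = card {i. i < r \<and> k < N i}"
  have seg: "{i. i < r \<and> k < N i} = {..<c}" unfolding c_def
    by (rule initial_segment) (use anti in \<open>auto intro: less_le_trans\<close>)
  have w: "level \<eta> r (\<lambda>i. exp (- real (N i))) k = \<eta> * real c"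
    unfolding level_def at_least_exp by (simp add: sum.If_cases c_def Int_def lessThan_def)
  \<comment> \<open>The top level is not exceeded, so the first level that is not exceeded lies on
    the grid and \<open>upper\<close> can be applied to it.\<close>
  have "r - 1 \<notin> {i. i < r \<and> k < N i}" using top by auto
  then have cr: "c < r" unfolding seg using r by simp
  have "\<eta> * real c \<le> v"
  proof (cases c)
    case (Suc c')
    then have "c' \<in> {i. i < r \<and> k < N i}" unfolding seg by simp
    then show ?thesis using lower[of c'] Suc by simp
  qed (use v in simp)
  moreover have "v \<le> \<eta> * real (Suc c) + D"
  proof (rule ccontr)
    assume "\<not> ?thesis"
    then have "c \<in> {i. i < r \<and> k < N i}" using upper[OF cr] cr by auto
    then show False unfolding seg by simp
  qed
  ultimately show ?thesis unfolding w using \<eta> D by (simp add: abs_le_iff algebra_simps)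
qed

lemma sum_at_least_exp: "N \<le> K \<Longrightarrow> (\<Sum>k<K. at_least k (exp (- real N))) = real N"
proof -
  assume "N \<le> K"
  then have "{k. k < K \<and> k < N} = {..<N}" by auto
  then show ?thesis by (simp add: at_least_exp sum.If_cases Int_def lessThan_def)
qed

text \<open>Adding counts over levels is the same as adding, over points, the number of levels below
  them. So each of the at most K points contributes a rounding error of at most one mesh
  width.\<close>

lemma total_level_close:
  fixes x :: "'e \<Rightarrow> real"
  assumes \<eta>: "0 < \<eta>" and i0: "0 < i0" "i0 \<le> r"
    and fin: "finite {e \<in> I. \<eta> * real i0 < x e}" and K: "card {e \<in> I. \<eta> * real i0 < x e} \<le> K"
    and top: "\<And>e. e \<in> I \<Longrightarrow> x e \<le> \<eta> * real r"
  shows "\<bar>(\<Sum>e\<in>{e \<in> I. \<eta> * real i0 < x e}. x e) -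
     total_level \<eta> r i0 K (\<lambda>i. exp (- real (card {e \<in> I. \<eta> * real (Suc i) < x e})))\<bar> \<le> \<eta> * real K"
proof -
  define B where "B = {e \<in> I. \<eta> * real i0 < x e}"
  define N where "N i = card {e \<in> I. \<eta> * real (Suc i) < x e}" for i
  define c where "c e = card {i. i < r \<and> \<eta> * real (Suc i) < x e}" for e
  have finB: "finite B" using fin by (simp add: B_def)
  have sub: "{e \<in> I. \<eta> * real (Suc i) < x e} \<subseteq> B" if "i0 \<le> Suc i" for i
  proof -
    have "\<eta> * real i0 \<le> \<eta> * real (Suc i)" using that \<eta> by (intro mult_left_mono) auto
    then show ?thesis by (auto simp: B_def)
  qed
  have NK: "N i \<le> K" if "i0 \<le> Suc i" for i
    using card_mono[OF finB sub[OF that]] K by (simp add: N_def B_def)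
  have KB: "card B \<le> K" using K by (simp add: B_def)
  have N0: "N (i0 - 1) = card B" using i0 by (simp add: N_def B_def)
  have Nsum: "real (N i) = (\<Sum>e\<in>B. if \<eta> * real (Suc i) < x e then 1 else 0)" if "i0 \<le> i" for i
  proof -
    have "{e \<in> B. \<eta> * real (Suc i) < x e} = {e \<in> I. \<eta> * real (Suc i) < x e}"
      using sub[of i] that by (auto simp: B_def)
    then show ?thesis using finB by (simp add: N_def sum.If_cases Int_def)
  qed
  have seg: "{i. i < r \<and> \<eta> * real (Suc i) < x e} = {..<c e}" for e unfolding c_def
  proof (rule initial_segment)
    fix i j :: nat assume "i \<le> j" "\<eta> * real (Suc j) < x e"
    moreover have "\<eta> * real (Suc i) \<le> \<eta> * real (Suc j)" using \<open>i \<le> j\<close> \<eta> by (intro mult_left_mono) auto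
    ultimately show "\<eta> * real (Suc i) < x e" by linarith
  qed
  have ce: "i0 \<le> c e" if e: "e \<in> B" for e
  proof -
    have "i0 - 1 \<in> {i. i < r \<and> \<eta> * real (Suc i) < x e}" using e i0 by (simp add: B_def)
    then show ?thesis unfolding seg by simp
  qed
  have ccount: "real (c e) = real i0 + (\<Sum>i=i0..<r. if \<eta> * real (Suc i) < x e then 1 else 0)" if e: "e \<in> B" for e
  proof -
    have "{i \<in> {i0..<r}. \<eta> * real (Suc i) < x e} = {i0..<c e}"
      using seg[of e] by (auto simp: set_eq_iff)
    then show ?thesis using ce[OF e] by (simp add: sum.If_cases Int_def)
  qed
  have T: "total_level \<eta> r i0 K (\<lambda>i. exp (- real (N i))) = (\<Sum>e\<in>B. \<eta> * real (c e))"
  proof -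
    have "total_level \<eta> r i0 K (\<lambda>i. exp (- real (N i))) = \<eta> * (real i0 * real (card B) + (\<Sum>i=i0..<r. real (N i)))"
      unfolding total_level_def using NK i0 N0 KB by (simp add: sum_at_least_exp)
    also have "(\<Sum>i=i0..<r. real (N i)) = (\<Sum>i=i0..<r. \<Sum>e\<in>B. if \<eta> * real (Suc i) < x e then 1 else 0)"
      by (intro sum.cong) (auto simp: Nsum)
    also have "\<dots> = (\<Sum>e\<in>B. \<Sum>i=i0..<r. if \<eta> * real (Suc i) < x e then 1 else 0)" by (rule sum.swap)
    also have "real i0 * real (card B) + \<dots> = (\<Sum>e\<in>B. real (c e))"
      by (simp add: ccount sum.distrib)
    finally show ?thesis by (simp add: sum_distrib_left)
  qed
  have each: "\<bar>x e - \<eta> * real (c e)\<bar> \<le> \<eta>" if e: "e \<in> B" for e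
  proof -
    have "\<eta> * real (c e) \<le> x e"
    proof -
      have "c e - 1 \<in> {i. i < r \<and> \<eta> * real (Suc i) < x e}" unfolding seg using ce[OF e] i0 by simp
      then show ?thesis using ce[OF e] i0 by simp
    qed
    moreover have "x e \<le> \<eta> * real (Suc (c e))"
    proof (cases "c e < r")
      case True
      have "c e \<notin> {i. i < r \<and> \<eta> * real (Suc i) < x e}" unfolding seg by simp
      then show ?thesis using True by simp
    next
      case False
      have "x e \<le> \<eta> * real r" using top e by (simp add: B_def)
      also have "\<dots> \<le> \<eta> * real (Suc (c e))" using False \<eta> by (intro mult_left_mono) auto
      finally show ?thesis .
    qed
    ultimately show ?thesis by (simp add: abs_le_iff algebra_simps)
  qed
  have "\<bar>(\<Sum>e\<in>B. x e) - (\<Sum>e\<in>B. \<eta> * real (c e))\<bar> \<le> (\<Sum>e\<in>B. \<bar>x e - \<eta> * real (c e)\<bar>)"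
    by (simp add: sum_subtractf[symmetric])
  also have "\<dots> \<le> (\<Sum>e\<in>B. \<eta>)" by (intro sum_mono each)
  also have "\<dots> \<le> \<eta> * real K" using K \<eta> by (simp add: B_def mult.commute)
  finally show ?thesis unfolding T[symmetric] by (simp add: B_def N_def)
qed

section \<open>Renewal equation for exponential arrivals\<close>

abbreviation exp_dist :: "real measure" where
  "exp_dist \<equiv> density lborel (exponential_density 1)"

interpretation exp_dist: prob_space exp_dist
  by (rule prob_space_exponential_density) simp

interpretation exp_seq: sequence_space exp_dist
  by unfold_locales

abbreviation exp_seq :: "(nat \<Rightarrow> real) measure" where
  "exp_seq \<equiv> Pi\<^sub>M UNIV (\<lambda>_. exp_dist)"

definition arrival :: "(nat \<Rightarrow> real) \<Rightarrow> nat \<Rightarrow> real" where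
  "arrival e k = (\<Sum>i\<le>k. e i)"

lemma arrival_measurable [measurable]: "(\<lambda>e. arrival e k) \<in> borel_measurable exp_seq"
  unfolding arrival_def by measurable

lemma arrival_case_nat: "arrival (case_nat x e) k = x + (case k of 0 \<Rightarrow> 0 | Suc j \<Rightarrow> arrival e j)"
  by (cases k) (simp_all add: arrival_def sum.atMost_Suc_shift del: sum.atMost_Suc)

text \<open>Fubini's theorem after splitting off the first waiting time: putting an independent
  exponential variable in front of the sequence preserves its law.\<close>

lemma exp_seq_integral_iter:
  fixes f :: "(nat \<Rightarrow> real) \<Rightarrow> real"
  assumes f[measurable]: "f \<in> borel_measurable exp_seq" and B: "\<And>e. \<bar>f e\<bar> \<le> B"
  shows "(LINT e|exp_seq. f e) = (LINT x|exp_dist. LINT e|exp_seq. f (case_nat x e))"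
    and "integrable exp_dist (\<lambda>x. LINT e|exp_seq. f (case_nat x e))"
proof -
  interpret pair_prob_space exp_dist exp_seq ..
  have m: "(\<lambda>(s, \<omega>). case_nat s \<omega>) \<in> measurable (exp_dist \<Otimes>\<^sub>M exp_seq) exp_seq"
    by measurable
  have fm: "(\<lambda>z. f (case z of (s, \<omega>) \<Rightarrow> case_nat s \<omega>)) \<in> borel_measurable (exp_dist \<Otimes>\<^sub>M exp_seq)"
    by (rule measurable_compose[OF m f])
  have i: "integrable (exp_dist \<Otimes>\<^sub>M exp_seq) (\<lambda>(x, e). f (case_nat x e))"
    by (rule P.integrable_const_bound[of _ B]) (use fm B in \<open>auto simp: split_beta'\<close>)
  have "(LINT e|exp_seq. f e) = (LINT e|distr (exp_dist \<Otimes>\<^sub>M exp_seq) exp_seq (\<lambda>(s, \<omega>). case_nat s \<omega>). f e)"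
    by (subst exp_seq.PiM_iter) simp
  also have "\<dots> = (LINT z|(exp_dist \<Otimes>\<^sub>M exp_seq). f (case z of (s, \<omega>) \<Rightarrow> case_nat s \<omega>))"
    by (rule integral_distr[OF m f])
  also have "\<dots> = (LINT x|exp_dist. LINT e|exp_seq. f (case_nat x e))"
    using integral_fst'[OF i] by (simp add: split_beta')
  finally show "(LINT e|exp_seq. f e) = (LINT x|exp_dist. LINT e|exp_seq. f (case_nat x e))" .
  show "integrable exp_dist (\<lambda>x. LINT e|exp_seq. f (case_nat x e))"
    using integrable_fst'[OF i] by simp
qed

text \<open>For a unit rate Poisson process the expected product of a weight over its points is exp
  (- \<integral> (1 - weight)). The aim here is this formula for the arrival times and step weights,
  obtained without the point process. The conditions on b keep the weight in [0,1].\<close>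

locale step_weight =
  fixes r :: nat and b s :: "nat \<Rightarrow> real"
  assumes b_nonneg: "\<And>i. 0 \<le> b i" and s_pos: "\<And>i. 0 < s i" and b_sum: "(\<Sum>i<r. b i) \<le> 1"
begin

definition weight :: "real \<Rightarrow> real" where
  "weight y = 1 - (\<Sum>i<r. if y < s i then b i else 0)"

text \<open>The integral of \<open>1 - weight\<close> from y to infinity, in closed form.\<close>

definition excess :: "real \<Rightarrow> real" where
  "excess y = (\<Sum>i<r. b i * max 0 (s i - y))"

text \<open>A point beyond which the weight is 1. The sum bounds every threshold and also makes
  sense for r = 0, unlike a maximum.\<close>

definition horizon :: real where
  "horizon = (\<Sum>i<r. s i)"

lemma horizon: "i < r \<Longrightarrow> s i \<le> horizon"
  unfolding horizon_def using s_pos by (intro member_le_sum) (auto intro: less_imp_le)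

lemma weight_bounds: "0 \<le> weight y" "weight y \<le> 1"
proof -
  have "(\<Sum>i<r. if y < s i then b i else 0) \<le> (\<Sum>i<r. b i)" by (intro sum_mono) (auto simp: b_nonneg)
  then show "0 \<le> weight y" using b_sum by (simp add: weight_def)
  show "weight y \<le> 1" unfolding weight_def using b_nonneg by (simp add: sum_nonneg)
qed

lemma weight_measurable [measurable]: "weight \<in> borel_measurable borel"
  unfolding weight_def by measurable

lemma weight_beyond: "horizon \<le> y \<Longrightarrow> weight y = 1"
  using horizon by (force simp: weight_def intro!: sum.neutral)

lemma excess_beyond: "horizon \<le> y \<Longrightarrow> excess y = 0"
  using horizon by (force simp: excess_def max_def intro!: sum.neutral)

lemma excess_nonneg: "0 \<le> excess y"
  unfolding excess_def using b_nonneg by (intro sum_nonneg) auto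

lemma excess_continuous: "continuous_on A excess"
  unfolding excess_def by (intro continuous_intros)

lemma excess_measurable [measurable]: "excess \<in> borel_measurable borel"
  unfolding excess_def by measurable

lemma excess_derivative:
  assumes y: "y \<notin> s ` {..<r}"
  shows "(excess has_real_derivative - (1 - weight y)) (at y)"
proof -
  have "((\<lambda>y. b i * max 0 (s i - y)) has_real_derivative - (if y < s i then b i else 0)) (at y)" if i: "i < r" for i
  proof -
    have "y \<noteq> s i" using y i by auto
    then consider "y < s i" | "s i < y" by linarith
    then show ?thesis
    proof cases
      case 1
      have "((\<lambda>y. b i * (s i - y)) has_real_derivative - b i) (at y)"
        by (auto intro!: derivative_eq_intros)
      then have "((\<lambda>y. b i * max 0 (s i - y)) has_real_derivative - b i) (at y)"
        by (rule has_field_derivative_transform_within_open[of _ _ _ "{..<s i}"]) (use 1 in auto)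
      then show ?thesis using 1 by simp
    next
      case 2
      have "((\<lambda>y. 0) has_real_derivative 0) (at y)" by simp
      then have "((\<lambda>y. b i * max 0 (s i - y)) has_real_derivative 0) (at y)"
        by (rule has_field_derivative_transform_within_open[of _ _ _ "{s i<..}"]) (use 2 in auto)
      then show ?thesis using 2 by simp
    qed
  qed
  then have "((\<lambda>y. \<Sum>i<r. b i * max 0 (s i - y)) has_real_derivative (\<Sum>i<r. - (if y < s i then b i else 0))) (at y)"
    by (intro DERIV_sum) auto
  then show ?thesis unfolding excess_def[abs_def] weight_def by (simp add: sum_negf)
qed

text \<open>The expected answer reproduces itself when the first point after u is conditioned on, so
  it is a fixed point of the renewal operator.\<close>

lemma renewal_identity:
  assumes u: "0 \<le> u"
  shows "(LINT x|exp_dist. weight (u + x) * exp (- excess (u + x))) = exp (- excess u)"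
proof -
  define R where "R = max 0 horizon"
  \<comment> \<open>An explicit antiderivative of f', smooth except at finitely many kinks. Working
    with 1 minus the integrand makes everything nonnegative and zero beyond R, so integration over a
    compact interval suffices.\<close>
  define f where "f x = exp (- x) * (exp (- excess (u + x)) - 1)" for x
  define f' where "f' x = exp (- x) * (1 - weight (u + x) * exp (- excess (u + x)))" for x
  have le1: "weight y * exp (- excess y) \<le> 1" for y
    using weight_bounds[of y] excess_nonneg[of y] by (simp add: mult_le_one)
  have cont: "continuous_on {0..R} f"
    unfolding f_def by (intro continuous_intros continuous_on_compose2[OF excess_continuous[of UNIV]]) auto
  have deriv: "(f has_vector_derivative f' x) (at x)" if "x \<in> {0<..<R} - (\<lambda>i. s i - u) ` {..<r}" for x
  proof -
    have "u + x \<notin> s ` {..<r}" using that by force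
    have g: "((\<lambda>x. u + x) has_real_derivative 1) (at x)" by (auto intro!: derivative_eq_intros)
    from DERIV_chain2[OF _ g, of excess, OF excess_derivative[OF \<open>u + x \<notin> s ` {..<r}\<close>]]
    have "((\<lambda>x. excess (u + x)) has_real_derivative - (1 - weight (u + x))) (at x)"
      by simp
    then have "(f has_real_derivative f' x) (at x)"
      unfolding f_def f'_def by (auto intro!: derivative_eq_intros simp: algebra_simps)
    then show ?thesis by (simp add: has_real_derivative_iff_has_vector_derivative)
  qed
  have "(f' has_integral f R - f 0) {0..R}"
    by (rule fundamental_theorem_of_calculus_interior_strong[OF _ _ deriv cont]) (auto simp: R_def)
  also have "f R = 0" using u by (simp add: f_def excess_beyond R_def)
  finally have hi: "(f' has_integral (1 - exp (- excess u))) {0..R}" by (simp add: f_def)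
  have "(\<integral>\<^sup>+x. ennreal (1 - weight (u + x) * exp (- excess (u + x))) \<partial>exp_dist)
      = (\<integral>\<^sup>+x. ennreal (f' x) * indicator {0..R} x \<partial>lborel)"
  proof (subst nn_integral_density)
    show "(\<integral>\<^sup>+x. ennreal (exponential_density 1 x) * ennreal (1 - weight (u + x) * exp (- excess (u + x))) \<partial>lborel)
      = (\<integral>\<^sup>+x. ennreal (f' x) * indicator {0..R} x \<partial>lborel)"
    proof (rule nn_integral_cong)
      fix x :: real
      have "weight (u + x) * exp (- excess (u + x)) = 1" if "R < x"
        using that u by (simp add: weight_beyond excess_beyond R_def)
      then show "ennreal (exponential_density 1 x) * ennreal (1 - weight (u + x) * exp (- excess (u + x)))
          = ennreal (f' x) * indicator {0..R} x"
        using le1 by (auto simp: exponential_density_def f'_def indicator_def ennreal_mult'[symmetric] not_le)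
    qed
  qed simp_all
  also have "\<dots> = ennreal (1 - exp (- excess u))"
    by (rule nn_integral_has_integral_lebesgue'[OF _ hi]) (use le1 in \<open>simp add: f'_def\<close>)
  finally have "has_bochner_integral exp_dist (\<lambda>x. 1 - weight (u + x) * exp (- excess (u + x))) (1 - exp (- excess u))"
    using le1 excess_nonneg by (intro has_bochner_integral_nn_integral) auto
  then have i2: "(LINT x|exp_dist. 1 - weight (u + x) * exp (- excess (u + x))) = 1 - exp (- excess u)"
    by (auto simp: has_bochner_integral_iff)
  have "integrable exp_dist (\<lambda>x. weight (u + x) * exp (- excess (u + x)))"
    by (rule exp_dist.integrable_const_bound[of _ 1])
      (use le1 weight_bounds in \<open>auto simp: abs_mult\<close>)
  then show ?thesis using i2 exp_dist.prob_space by simp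
qed

text \<open>The starting time u makes the family closed under conditioning on the first waiting
  time.\<close>

definition partial_gf :: "nat \<Rightarrow> real \<Rightarrow> real" where
  "partial_gf K u = (LINT e|exp_seq. (\<Prod>k<K. weight (u + arrival e k)))"

lemma prod_weight_bounds: "0 \<le> (\<Prod>k<K. weight (f k))" "(\<Prod>k<K. weight (f k)) \<le> 1"
  using weight_bounds by (auto intro!: prod_nonneg prod_le_1)

lemma prod_weight_measurable: "(\<lambda>e. \<Prod>k<K. weight (u + arrival e k)) \<in> borel_measurable exp_seq"
  by measurable

lemma partial_gf_Suc:
  "partial_gf (Suc K) u = (LINT x|exp_dist. weight (u + x) * partial_gf K (u + x))"
  "integrable exp_dist (\<lambda>x. weight (u + x) * partial_gf K (u + x))"
proof -
  have m: "(\<lambda>e. \<Prod>k<Suc K. weight (u + arrival e k)) \<in> borel_measurable exp_seq"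
    by measurable
  have bd: "\<bar>\<Prod>k<Suc K. weight (u + arrival e k)\<bar> \<le> 1" for e
    using prod_weight_bounds[of "\<lambda>k. u + arrival e k" "Suc K"] by (simp add: abs_le_iff)
  have "(\<Prod>k<Suc K. weight (u + arrival (case_nat x e) k)) = weight (u + x) * (\<Prod>k<K. weight (u + x + arrival e k))" for x e
    by (subst prod.lessThan_Suc_shift) (simp add: arrival_case_nat add.assoc)
  note eq = this
  show "partial_gf (Suc K) u = (LINT x|exp_dist. weight (u + x) * partial_gf K (u + x))"
    unfolding partial_gf_def using exp_seq_integral_iter(1)[OF m bd] by (simp only: eq) simp
  show "integrable exp_dist (\<lambda>x. weight (u + x) * partial_gf K (u + x))"
    unfolding partial_gf_def using exp_seq_integral_iter(2)[OF m bd] by (simp only: eq) simp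
qed

lemma AE_exp_dist_nonneg: "AE x in exp_dist. 0 \<le> x"
  by (subst AE_density) (auto simp: exponential_density_def)

lemma AE_exp_seq_nonneg: "AE e in exp_seq. \<forall>i. 0 \<le> e i"
  by (intro AE_all_countable[THEN iffD2] allI exp_seq.AE_component AE_exp_dist_nonneg) auto

lemma partial_gf_beyond:
  assumes u: "horizon \<le> u"
  shows "partial_gf K u = 1"
proof -
  have "(LINT e|exp_seq. (\<Prod>k<K. weight (u + arrival e k))) = (LINT e|exp_seq. 1)"
  proof (rule integral_cong_AE)
    show "AE e in exp_seq. (\<Prod>k<K. weight (u + arrival e k)) = 1"
      using AE_exp_seq_nonneg
    proof eventually_elim
      case (elim e)
      have "weight (u + arrival e k) = 1" for k
        using elim u by (intro weight_beyond) (simp add: arrival_def add_increasing2 sum_nonneg)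
      then show ?case by simp
    qed
  qed (use prod_weight_measurable[of u K] in simp_all)
  then show ?thesis by (simp add: partial_gf_def exp_seq.P.prob_space)
qed

text \<open>Both sides satisfy the same renewal equation, whose integral operator contracts by
  \<open>1 - exp (- horizon)\<close>.\<close>

lemma partial_gf_close:
  assumes u: "0 \<le> u"
  shows "\<bar>partial_gf K u - exp (- excess u)\<bar> \<le> (1 - exp (- max 0 horizon)) ^ K"
  using u
proof (induction K arbitrary: u)
  case 0
  have "0 < exp (- excess u)" "exp (- excess u) \<le> 1" using excess_nonneg by auto
  then show ?case by (simp add: partial_gf_def exp_seq.P.prob_space abs_le_iff)
next
  case (Suc K)
  define R where "R = max 0 horizon"
  define q where "q = 1 - exp (- R)"
  have q: "0 \<le> q" by (simp add: q_def R_def)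
  have i1: "integrable exp_dist (\<lambda>x. weight (u + x) * exp (- excess (u + x)))"
    by (rule exp_dist.integrable_const_bound[of _ 1])
      (use weight_bounds excess_nonneg in \<open>auto simp: abs_mult intro!: mult_le_one\<close>)
  note i2 = partial_gf_Suc(2)[of u K]
  have "\<bar>partial_gf (Suc K) u - exp (- excess u)\<bar> =
    \<bar>LINT x|exp_dist. weight (u + x) * partial_gf K (u + x) - weight (u + x) * exp (- excess (u + x))\<bar>"
    using i1 i2 by (simp add: partial_gf_Suc(1) renewal_identity[OF Suc.prems])
  also have "\<dots> \<le> (LINT x|exp_dist. \<bar>weight (u + x) * partial_gf K (u + x) - weight (u + x) * exp (- excess (u + x))\<bar>)"
    unfolding real_norm_def[symmetric] by (rule integral_norm_bound)
  \<comment> \<open>Beyond R both functions equal 1, so an error survives only if the first waiting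
    time is at most R. That has probability q, which is the contraction factor.\<close>
  also have "\<dots> \<le> (LINT x|exp_dist. q ^ K * indicator {..R} x)"
  proof (rule integral_mono_AE)
    show "integrable exp_dist (\<lambda>x. \<bar>weight (u + x) * partial_gf K (u + x) - weight (u + x) * exp (- excess (u + x))\<bar>)"
      by (intro integrable_abs Bochner_Integration.integrable_diff i1 i2)
    show "integrable exp_dist (\<lambda>x. q ^ K * indicator {..R} x)"
      by (intro integrable_mult_right integrable_real_indicator) (auto simp: less_top[symmetric])
    show "AE x in exp_dist. \<bar>weight (u + x) * partial_gf K (u + x) - weight (u + x) * exp (- excess (u + x))\<bar> \<le> q ^ K * indicator {..R} x"
      using AE_exp_dist_nonneg
    proof eventually_elim
      case (elim x)
      show ?case
      proof (cases "x \<le> R")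
        case True
        have "\<bar>weight (u + x) * partial_gf K (u + x) - weight (u + x) * exp (- excess (u + x))\<bar>
          = weight (u + x) * \<bar>partial_gf K (u + x) - exp (- excess (u + x))\<bar>"
          using weight_bounds[of "u + x"] by (simp add: abs_mult flip: right_diff_distrib)
        also have "\<dots> \<le> 1 * q ^ K"
          using weight_bounds[of "u + x"] Suc.IH[of "u + x"] Suc.prems elim
          by (intro mult_mono) (auto simp: q_def R_def)
        finally show ?thesis using True by simp
      next
        case False
        then have "horizon \<le> u + x" using Suc.prems by (auto simp: R_def)
        then show ?thesis using False by (simp add: partial_gf_beyond excess_beyond)
      qed
    qed
  qed
  also have "\<dots> = q ^ K * measure exp_dist {..R}" by simp
  also have "measure exp_dist {..R} = q"
  proof -
    have "emeasure exp_dist {..R} = ennreal q"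
      using emeasure_erlang_density[of 1 0 R] by (simp add: erlang_CDF_0 q_def R_def)
    then show ?thesis using q by (simp add: measure_def)
  qed
  finally show ?case by (simp add: q_def R_def mult.commute)
qed

lemma partial_gf_tendsto: "(\<lambda>K. partial_gf K 0) \<longlonglongrightarrow> exp (- (\<Sum>i<r. b i * s i))"
proof -
  have e0: "excess 0 = (\<Sum>i<r. b i * s i)"
    unfolding excess_def using s_pos by (intro sum.cong) (auto simp: max_def less_imp_le)
  have "(\<lambda>K. (1 - exp (- max 0 horizon)) ^ K) \<longlonglongrightarrow> 0" by (rule LIMSEQ_power_zero) simp
  then have "(\<lambda>K. partial_gf K 0 - exp (- excess 0)) \<longlonglongrightarrow> 0"
    by (rule Lim_null_comparison[rotated]) (use partial_gf_close[of 0] in auto)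
  then show ?thesis unfolding e0 by (simp add: LIM_zero_iff)
qed

end

section \<open>Growth of the arrival times\<close>

lemma AE_exp_seq_pos: "AE e in exp_seq. \<forall>i. 0 < e i"
proof -
  have "AE x in lborel. x \<noteq> (0::real)" by (rule AE_lborel_singleton)
  then have "AE x in exp_dist. 0 < x"
    by (subst AE_density) (auto simp: exponential_density_def elim!: eventually_mono)
  then show ?thesis
    by (intro AE_all_countable[THEN iffD2] allI exp_seq.AE_component) auto
qed

lemma exp_moment_arrival: "(LINT e|exp_seq. exp (- arrival e k)) = (1/2) ^ Suc k"
proof -
  have half: "(LINT x|exp_dist. exp (- x)) = 1/2"
  proof -
    interpret e2: prob_space "density lborel (exponential_density 2)" by (rule prob_space_exponential_density) simp
    \<comment> \<open>The function exp (- x) times the density of rate 1 is one half of the density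
      of rate 2.\<close>
    define h where "h = (1/2::real)"
    have h0: "0 \<le> h" by (simp add: h_def)
    have "(\<integral>\<^sup>+x. ennreal (exp (- x)) \<partial>exp_dist) = (\<integral>\<^sup>+x. ennreal h * ennreal (exponential_density 2 x) \<partial>lborel)"
    proof (subst nn_integral_density)
      show "(\<integral>\<^sup>+x. ennreal (exponential_density 1 x) * ennreal (exp (- x)) \<partial>lborel)
          = (\<integral>\<^sup>+x. ennreal h * ennreal (exponential_density 2 x) \<partial>lborel)"
      proof (rule nn_integral_cong)
        fix x :: real
        have "exponential_density 1 x * exp (- x) = h * exponential_density 2 x"
          by (simp add: exponential_density_def h_def mult_exp_exp)
        then show "ennreal (exponential_density 1 x) * ennreal (exp (- x)) = ennreal h * ennreal (exponential_density 2 x)"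
          using exponential_density_nonneg[of 1 x] exponential_density_nonneg[of 2 x] h0
          by (simp only: ennreal_mult[symmetric] exp_ge_zero zero_less_one zero_less_numeral)
      qed
    qed simp_all
    also have "\<dots> = ennreal h * (\<integral>\<^sup>+x. ennreal (exponential_density 2 x) \<partial>lborel)"
      by (rule nn_integral_cmult) simp
    also have "(\<integral>\<^sup>+x. ennreal (exponential_density 2 x) \<partial>lborel) = 1"
      using e2.emeasure_space_1 by (simp add: emeasure_density)
    finally have "(\<integral>\<^sup>+x. ennreal (exp (- x)) \<partial>exp_dist) = ennreal (1/2)" by (simp only: h_def mult_1_right)
    then have "has_bochner_integral exp_dist (\<lambda>x. exp (- x)) (1/2)"
      by (intro has_bochner_integral_nn_integral) auto
    then show ?thesis by (simp add: has_bochner_integral_iff)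
  qed
  \<comment> \<open>Fubini's step requires an integrand bounded on the whole product space, which
    also contains sequences with negative entries; clipping changes nothing almost surely.\<close>
  have clip: "(LINT e|exp_seq. exp (- arrival e k)) = (LINT e|exp_seq. (\<Prod>i\<le>k. min 1 (exp (- e i))))" for k
  proof (rule integral_cong_AE)
    show "AE e in exp_seq. exp (- arrival e k) = (\<Prod>i\<le>k. min 1 (exp (- e i)))"
      using AE_exp_seq_pos
    proof eventually_elim
      case (elim e)
      have "min 1 (exp (- e i)) = exp (- e i)" for i
        using elim[rule_format, of i] by (simp add: min_def)
      then show ?case by (simp add: arrival_def exp_sum sum_negf[symmetric])
    qed
    show "(\<lambda>e. exp (- arrival e k)) \<in> borel_measurable exp_seq" by measurable
    show "(\<lambda>e. (\<Prod>i\<le>k. min 1 (exp (- e i)))) \<in> borel_measurable exp_seq" by measurable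
  qed
  have half': "(LINT x|exp_dist. min 1 (exp (- x))) = 1/2"
    unfolding half[symmetric]
  proof (rule integral_cong_AE)
    show "AE x in exp_dist. min 1 (exp (- x)) = exp (- x)"
      by (subst AE_density) (auto simp: exponential_density_def min_def)
  qed auto
  have "(LINT e|exp_seq. (\<Prod>i<Suc k. min 1 (exp (- e i)))) = (1/2) ^ Suc k"
  proof (induction k)
    case 0
    have "(LINT e|exp_seq. min 1 (exp (- e 0))) = (LINT x|exp_dist. LINT e|exp_seq. min 1 (exp (- x)))"
      by (subst exp_seq_integral_iter(1)[where B=1]) auto
    then show ?case by (simp add: half' exp_seq.P.prob_space)
  next
    case (Suc k)
    have bd: "\<bar>\<Prod>i<Suc (Suc k). min 1 (exp (- e i :: real))\<bar> \<le> 1" for e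
      unfolding abs_prod by (intro prod_le_1) auto
    have "(LINT e|exp_seq. (\<Prod>i<Suc (Suc k). min 1 (exp (- e i)))) =
       (LINT x|exp_dist. LINT e|exp_seq. (\<Prod>i<Suc (Suc k). min 1 (exp (- case_nat x e i))))"
      by (rule exp_seq_integral_iter(1)[OF _ bd]) measurable
    also have "\<dots> = (LINT x|exp_dist. min 1 (exp (- x)) * (LINT e|exp_seq. (\<Prod>i<Suc k. min 1 (exp (- e i)))))"
      by (subst prod.lessThan_Suc_shift) simp
    also have "\<dots> = (1/2) * (1/2) ^ Suc k" unfolding Suc.IH using half' by simp
    finally show ?case by simp
  qed
  then show ?thesis unfolding clip by (simp only: lessThan_Suc_atMost)
qed

text \<open>A Chernoff bound and the Borel-Cantelli lemma: the probability that the sum of k + 1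
  waiting times is at most (k + 1) / 2 is at most (exp (1/2) / 2)^(k + 1), and exp (1/2) \<le> 7/4 <
  2.\<close>

lemma AE_arrival_linear: "AE e in exp_seq. \<forall>\<^sub>F k in sequentially. real (Suc k) / 2 \<le> arrival e k"
proof -
  define A where "A k = {e \<in> space exp_seq. exp (- (real (Suc k) / 2)) \<le> exp (- arrival e k)}" for k
  have Am: "A k \<in> sets exp_seq" for k unfolding A_def by measurable
  define q where "q = exp (1/2) / (2::real)"
  have q: "0 \<le> q" "q < 1"
  proof -
    have "exp (1/2 :: real) \<le> 1 + 1/2 + (1/2)\<^sup>2" by (rule exp_bound) auto
    then show "q < 1" by (simp add: q_def power2_eq_square)
  qed (simp add: q_def)
  have Ab: "measure exp_seq (A k) \<le> q ^ Suc k" for k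
  proof -
    have i: "integrable exp_seq (\<lambda>e. exp (- arrival e k))"
    proof (rule exp_seq.P.integrable_const_bound[of _ 1])
      show "AE e in exp_seq. norm (exp (- arrival e k)) \<le> 1"
        using AE_exp_seq_pos by eventually_elim (simp add: arrival_def sum_nonneg less_imp_le)
    qed measurable
    have "measure exp_seq (A k) \<le> (LINT e|exp_seq. exp (- arrival e k)) / exp (- (real (Suc k) / 2))"
      unfolding A_def by (rule integral_Markov_inequality_measure[OF i, of "{}"]) auto
    also have "\<dots> = (exp (1/2) / 2) ^ Suc k"
      unfolding exp_moment_arrival by (simp add: exp_minus power_divide exp_of_nat_mult[symmetric] field_simps del: of_nat_Suc power_Suc)
    finally show ?thesis by (simp add: q_def)
  qed
  have "AE e in exp_seq. \<forall>\<^sub>F k in sequentially. e \<in> space exp_seq - A k"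
  proof (rule borel_cantelli_AE1)
    show "summable (\<lambda>k. measure exp_seq (A k))"
    proof (rule summable_comparison_test')
      show "summable (\<lambda>k. q ^ Suc k)" using q by (subst summable_Suc_iff) simp
      show "norm (measure exp_seq (A k)) \<le> q ^ Suc k" if "k \<ge> 0" for k using Ab[of k] by simp
    qed
  qed (auto simp: Am less_top[symmetric])
  then show ?thesis
    by eventually_elim (auto simp: A_def elim!: eventually_mono)
qed

section \<open>Laws of counts\<close>

text \<open>A point that exceeds exactly the first q levels contributes the factor exp of minus the
  first q entries of c. The coefficient is the drop of this factor at level i, so sums of
  coefficients telescope.\<close>

definition gf_coeff :: "(nat \<Rightarrow> nat) \<Rightarrow> nat \<Rightarrow> real" where
  "gf_coeff c i = exp (- (\<Sum>j<i. real (c j))) * (1 - exp (- real (c i)))"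

lemma gf_coeff_nonneg: "0 \<le> gf_coeff c i"
  by (simp add: gf_coeff_def)

lemma gf_coeff_sum: "(\<Sum>i<q. gf_coeff c i) = 1 - exp (- (\<Sum>j<q. real (c j)))"
  by (induction q) (simp_all add: gf_coeff_def algebra_simps mult_exp_exp)

text \<open>For increasing levels the exceeded ones form an initial segment, where the coefficients
  telescope. The exponential thereby becomes an affine combination of indicators, whose mean is
  linear in the tails.\<close>

lemma step_generating_function:
  fixes t :: "nat \<Rightarrow> real"
  assumes t: "mono t"
  shows "exp (- (\<Sum>i<r. if t i < x then real (c i) else 0)) = 1 - (\<Sum>i<r. if t i < x then gf_coeff c i else 0)"
proof -
  define q where "q = card {i. i < r \<and> t i < x}"
  have seg: "{i. i < r \<and> t i < x} = {..<q}" unfolding q_def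
    by (rule initial_segment) (use monoD[OF t] in \<open>auto intro: le_less_trans\<close>)
  have "(\<Sum>i<r. if t i < x then f i else 0) = (\<Sum>i<q. f i)" for f :: "nat \<Rightarrow> real"
    using seg by (simp add: sum.If_cases Int_def)
  then show ?thesis by (simp add: gf_coeff_sum)
qed

lemma product_of_counts:
  fixes x :: "'e \<Rightarrow> real" and t :: "nat \<Rightarrow> real"
  assumes "finite I"
  shows "(\<Prod>e\<in>I. exp (- (\<Sum>i<r. if t i < x e then real (c i) else 0))) =
    (\<Prod>i<r. exp (- real (card {e \<in> I. t i < x e})) ^ c i)"
proof -
  have "(\<Prod>e\<in>I. exp (- (\<Sum>i<r. if t i < x e then real (c i) else 0))) =
    exp (- (\<Sum>e\<in>I. \<Sum>i<r. if t i < x e then real (c i) else 0))"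
    using assms by (simp add: exp_sum[symmetric] sum_negf)
  also have "(\<Sum>e\<in>I. \<Sum>i<r. if t i < x e then real (c i) else 0) = (\<Sum>i<r. \<Sum>e\<in>I. if t i < x e then real (c i) else 0)"
    by (rule sum.swap)
  also have "\<dots> = (\<Sum>i<r. real (c i) * real (card {e \<in> I. t i < x e}))"
    using assms by (simp add: sum.If_cases Int_def mult.commute)
  also have "exp (- \<dots>) = (\<Prod>i<r. exp (- (real (c i) * real (card {e \<in> I. t i < x e}))))"
    by (simp only: sum_negf[symmetric]) (rule exp_sum, simp)
  also have "\<dots> = (\<Prod>i<r. exp (- real (card {e \<in> I. t i < x e})) ^ c i)"
    by (simp add: exp_of_nat_mult[symmetric])
  finally show ?thesis .
qed

text \<open>For an infinite set \<open>card\<close> returns 0; for a ranked sequence and t > 0 the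
  set is finite.\<close>

definition tail_count :: "(nat \<Rightarrow> real) \<Rightarrow> real \<Rightarrow> nat" where
  "tail_count y t = card {k. t < y k}"

definition grid :: "real \<Rightarrow> nat \<Rightarrow> real" where
  "grid \<eta> i = \<eta> * real (Suc i)"

lemma grid_mono: "0 < \<eta> \<Longrightarrow> mono (grid \<eta>)"
  by (intro monoI) (simp add: grid_def)

lemma grid_pos: "0 < \<eta> \<Longrightarrow> 0 < grid \<eta> i"
  by (simp add: grid_def)

text \<open>The common interface of the two limit objects: the joint generating function of the counts
  of a Poisson process whose intensity measure has tail \<open>t powr (- \<alpha>)\<close>.\<close>

definition power_law_counts :: "real \<Rightarrow> 'a measure \<Rightarrow> ('a \<Rightarrow> nat \<Rightarrow> real) \<Rightarrow> bool" where
  "power_law_counts \<alpha> Q y \<longleftrightarrow>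
     prob_space Q \<and> y \<in> borel_measurable Q \<and> (AE \<omega> in Q. y \<omega> \<in> ranked_seqs) \<and>
     (\<forall>\<eta>>0. \<forall>c r. (LINT \<omega>|Q. (\<Prod>i<r. exp (- real (tail_count (y \<omega>) (grid \<eta> i))) ^ c i)) =
        exp (- (\<Sum>i<r. gf_coeff c i * grid \<eta> i powr - \<alpha>)))"

lemma ranked_seqs_tail_finite:
  assumes "y \<in> ranked_seqs" "0 < t"
  shows "finite {k. t < y k}"
proof -
  have "\<forall>\<^sub>F k in sequentially. y k < t" using assms by (intro order_tendstoD) (auto simp: ranked_seqs_def)
  then obtain K where "\<And>k. K \<le> k \<Longrightarrow> y k < t" by (auto simp: eventually_sequentially)
  then have "{k. t < y k} \<subseteq> {..<K}" by (force simp: not_less[symmetric])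
  then show ?thesis by (rule finite_subset) simp
qed

lemma tail_count_greater_iff:
  assumes "y \<in> ranked_seqs" "0 < t"
  shows "k < tail_count y t \<longleftrightarrow> t < y k"
proof -
  obtain K where K: "{k. t < y k} \<subseteq> {..<K}"
    using ranked_seqs_tail_finite[OF assms] finite_nat_iff_bounded by blast
  have anti: "antimono y" using assms by (simp add: ranked_seqs_def)
  have "{i. i < K \<and> t < y i} = {..<card {i. i < K \<and> t < y i}}"
    by (rule initial_segment) (use antimonoD[OF anti] in \<open>auto intro: less_le_trans\<close>)
  moreover have "{i. i < K \<and> t < y i} = {k. t < y k}" using K by auto
  ultimately have "{k. t < y k} = {..<tail_count y t}" by (simp add: tail_count_def)
  then show ?thesis by auto
qed

lemma tail_count_measurable:
  assumes [measurable]: "y \<in> borel_measurable Q" and fin: "AE \<omega> in Q. y \<omega> \<in> ranked_seqs" and t: "0 < t"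
  shows "(\<lambda>\<omega>. exp (- real (tail_count (y \<omega>) t))) \<in> borel_measurable Q"
proof -
  have [measurable]: "(\<lambda>\<omega>. y \<omega> k) \<in> borel_measurable Q" for k
    by (rule measurable_product_then_coordinatewise) measurable
  have "Measurable.pred Q (\<lambda>\<omega>. tail_count (y \<omega>) t = n)" for n
  proof -
    \<comment> \<open>A description by countably many measurable conditions; the last branch is the
      default value 0 of \<open>card\<close> on infinite sets.\<close>
    have "(tail_count (y \<omega>) t = n) \<longleftrightarrow>
      (if \<exists>K. \<forall>k. K \<le> k \<longrightarrow> \<not> t < y \<omega> k
       then (\<exists>K. (\<forall>k. K \<le> k \<longrightarrow> \<not> t < y \<omega> k) \<and> (\<Sum>k<K. if t < y \<omega> k then 1 else 0 :: real) = real n) else n = 0)" for \<omega>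
    proof (cases "\<exists>K. \<forall>k. K \<le> k \<longrightarrow> \<not> t < y \<omega> k")
      case True
      have "(\<Sum>k<K. if t < y \<omega> k then 1 else 0 :: real) = real (tail_count (y \<omega>) t)"
        if "\<forall>k. K \<le> k \<longrightarrow> \<not> t < y \<omega> k" for K
      proof -
        have "{k. k < K \<and> t < y \<omega> k} = {k. t < y \<omega> k}" using that by (auto simp: not_le[symmetric])
        then show ?thesis by (simp add: sum.If_cases Int_def tail_count_def)
      qed
      then show ?thesis using True by auto
    next
      case False
      have "infinite {k. t < y \<omega> k}"
        unfolding infinite_nat_iff_unbounded_le using False by auto
      then show ?thesis using False by (auto simp: tail_count_def)
    qed
    then show ?thesis by simp
  qed
  then have "(\<lambda>\<omega>. tail_count (y \<omega>) t) \<in> measurable Q (count_space UNIV)"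
    by (subst measurable_count_space_eq2_countable) (auto simp: pred_def vimage_def Int_def conj_commute)
  then show ?thesis by measurable
qed

section \<open>The point sequence built from exponential waiting times\<close>

lemma arrival_power_law_sequence:
  assumes \<alpha>: "0 < \<alpha>"
  shows "AE e in exp_seq. (\<lambda>k. arrival e k powr (- 1 / \<alpha>)) \<in> ranked_seqs"
  using AE_exp_seq_pos AE_arrival_linear
proof eventually_elim
  case (elim e)
  have pos: "0 < arrival e k" for k using elim(1) by (simp add: arrival_def sum_pos)
  have "arrival e (Suc k) powr (- 1 / \<alpha>) \<le> arrival e k powr (- 1 / \<alpha>)" for k
    using \<alpha> pos[of k] elim(1)[rule_format, of "Suc k"]
    by (intro powr_mono2') (auto simp: arrival_def)
  then have "antimono (\<lambda>k. arrival e k powr (- 1 / \<alpha>))" by (rule decseq_SucI)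
  moreover have "(\<lambda>k. arrival e k powr (- 1 / \<alpha>)) \<longlonglongrightarrow> 0"
  proof (rule tendsto_neg_powr)
    have "filterlim (\<lambda>k. real (Suc k) * (1 / 2)) at_top sequentially"
      by (rule filterlim_at_top_mult_tendsto_pos[OF tendsto_const _
            filterlim_compose[OF filterlim_real_sequentially filterlim_Suc]]) simp
    then show "filterlim (arrival e) at_top sequentially"
      by (rule filterlim_at_top_mono) (use elim(2) in simp)
  qed (use \<alpha> in simp)
  ultimately show ?case by (simp add: ranked_seqs_def)
qed

text \<open>Linear growth of the arrival times compares the terms with k powr (- 1 / \<alpha>),
  which is summable as 1 / \<alpha> > 1.\<close>

lemma arrival_power_law_summable:
  assumes \<alpha>: "0 < \<alpha>" "\<alpha> < 1"
  shows "AE e in exp_seq. summable (\<lambda>k. arrival e k powr (- 1 / \<alpha>))"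
  using AE_arrival_linear
proof eventually_elim
  case (elim e)
  have "- 1 / \<alpha> < - 1" using \<alpha> by (simp add: field_simps)
  then have "summable (\<lambda>k. real k powr (- 1 / \<alpha>))" by (simp add: summable_real_powr_iff)
  then have "summable (\<lambda>k. real (Suc k) powr (- 1 / \<alpha>))" by (subst summable_Suc_iff)
  then have s: "summable (\<lambda>k. (1/2) powr (- 1 / \<alpha>) * real (Suc k) powr (- 1 / \<alpha>))" by (rule summable_mult)
  show ?case
  proof (rule summable_comparison_test_ev[OF _ s])
    show "\<forall>\<^sub>F k in sequentially. norm (arrival e k powr (- 1 / \<alpha>)) \<le> (1/2) powr (- 1 / \<alpha>) * real (Suc k) powr (- 1 / \<alpha>)"
      using elim
    proof eventually_elim
      case (elim k)
      have "arrival e k powr (- 1 / \<alpha>) \<le> (1 / 2 * real (Suc k)) powr (- 1 / \<alpha>)"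
        using elim \<alpha> by (intro powr_mono2') auto
      then show ?case by (simp only: powr_mult) simp
    qed
  qed
qed

text \<open>A point exceeds the level g precisely when its arrival time is below g powr -\<alpha>.
  Counts above grid levels are therefore counts of arrivals below the thresholds s i, and the
  renewal argument gives their generating function.\<close>

theorem arrival_power_law_counts:
  assumes \<alpha>: "0 < \<alpha>"
  shows "power_law_counts \<alpha> exp_seq (\<lambda>e k. arrival e k powr (- 1 / \<alpha>))"
  unfolding power_law_counts_def
proof (intro conjI allI impI)
  show "prob_space exp_seq" by (rule exp_seq.P.prob_space_axioms)
  show ym: "(\<lambda>e k. arrival e k powr (- 1 / \<alpha>)) \<in> borel_measurable exp_seq"
    by (rule measurable_coordinatewise_then_product) measurable
  show rs: "AE e in exp_seq. (\<lambda>k. arrival e k powr (- 1 / \<alpha>)) \<in> ranked_seqs"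
    by (rule arrival_power_law_sequence[OF \<alpha>])
  fix \<eta> :: real and c :: "nat \<Rightarrow> nat" and r :: nat assume \<eta>: "0 < \<eta>"
  let ?y = "\<lambda>e k. arrival e k powr (- 1 / \<alpha>)"
  define s where "s i = grid \<eta> i powr - \<alpha>" for i
  interpret step_weight r "gf_coeff c" s
    by unfold_locales (auto simp: gf_coeff_nonneg gf_coeff_sum s_def grid_pos \<eta> less_imp_neq[OF grid_pos[OF \<eta>], symmetric])
  have w: "weight (arrival e k) = exp (- (\<Sum>i<r. if grid \<eta> i < ?y e k then real (c i) else 0))"
    if "\<forall>i. 0 < e i" for e k
  proof -
    have pos: "0 < arrival e k" using that by (simp add: arrival_def sum_pos)
    have "arrival e k < s i \<longleftrightarrow> grid \<eta> i < ?y e k" for i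
    proof -
      have "(s i) powr (- 1 / \<alpha>) = grid \<eta> i" using \<alpha> grid_pos[OF \<eta>, of i] by (simp add: s_def powr_powr)
      moreover have "s i powr (- 1 / \<alpha>) < arrival e k powr (- 1 / \<alpha>) \<longleftrightarrow> arrival e k < s i"
        using \<alpha> pos s_pos[of i] powr_less_mono2_neg[of "- 1 / \<alpha>" "arrival e k" "s i"]
          powr_mono2'[of "- 1 / \<alpha>" "s i" "arrival e k"] by (auto simp: not_less[symmetric])
      ultimately show ?thesis by simp
    qed
    then show ?thesis by (simp add: weight_def step_generating_function[OF grid_mono[OF \<eta>]])
  qed
  have "(\<lambda>K. LINT e|exp_seq. (\<Prod>k<K. weight (0 + arrival e k))) \<longlonglongrightarrow>
     (LINT e|exp_seq. (\<Prod>i<r. exp (- real (tail_count (?y e) (grid \<eta> i))) ^ c i))"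
  proof (rule integral_dominated_convergence[where w="\<lambda>_. 1"])
    show "(\<lambda>e. \<Prod>i<r. exp (- real (tail_count (?y e) (grid \<eta> i))) ^ c i) \<in> borel_measurable exp_seq"
      by (intro borel_measurable_prod borel_measurable_power tail_count_measurable[OF ym rs] grid_pos \<eta>)
    show "(\<lambda>e. \<Prod>k<K. weight (0 + arrival e k)) \<in> borel_measurable exp_seq" for K
      by (rule prod_weight_measurable)
    show "AE e in exp_seq. norm (\<Prod>k<K. weight (0 + arrival e k)) \<le> 1" for K
      by (rule AE_I2) (simp add: abs_of_nonneg prod_weight_bounds)
    show "AE e in exp_seq. (\<lambda>K. \<Prod>k<K. weight (0 + arrival e k)) \<longlonglongrightarrow>
       (\<Prod>i<r. exp (- real (tail_count (?y e) (grid \<eta> i))) ^ c i)"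
      using rs AE_exp_seq_pos
    proof eventually_elim
      case (elim e)
      have "\<forall>\<^sub>F k in sequentially. ?y e k < \<eta>"
        using elim \<eta> by (intro order_tendstoD) (auto simp: ranked_seqs_def)
      \<comment> \<open>Later points lie below the lowest grid level \<eta>, so the product over
        arrivals no longer changes from K0 on.\<close>
      then obtain K0 where K0: "\<And>k. K0 \<le> k \<Longrightarrow> ?y e k < \<eta>" by (auto simp: eventually_sequentially)
      have "(\<Prod>k<K. weight (0 + arrival e k)) = (\<Prod>i<r. exp (- real (tail_count (?y e) (grid \<eta> i))) ^ c i)"
        if K: "K0 \<le> K" for K
      proof -
        have "{k \<in> {..<K}. grid \<eta> i < ?y e k} = {k. grid \<eta> i < ?y e k}" for i
        proof -
          have "\<eta> \<le> grid \<eta> i" using \<eta> by (simp add: grid_def)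
          have "k < K" if "grid \<eta> i < ?y e k" for k
            using K K0[of k] that \<open>\<eta> \<le> grid \<eta> i\<close> by (cases "k < K") auto
          then show ?thesis by auto
        qed
        then show ?thesis
          using product_of_counts[where I="{..<K}" and r=r and t="grid \<eta>" and x="?y e" and c=c] by (simp add: w[OF elim(2)] tail_count_def)
      qed
      then show ?case by (intro tendsto_eventually) (auto simp: eventually_sequentially)
    qed
  qed simp
  from LIMSEQ_unique[OF this partial_gf_tendsto[unfolded partial_gf_def]]
  show "(LINT e|exp_seq. (\<Prod>i<r. exp (- real (tail_count (?y e) (grid \<eta> i))) ^ c i)) =
      exp (- (\<Sum>i<r. gf_coeff c i * grid \<eta> i powr - \<alpha>))"
    by (simp add: s_def)
qed

section \<open>Poisson processes with power intensity\<close>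

lemma power_intensity_tail:
  assumes \<alpha>: "0 < \<alpha>" and t: "0 < t"
  shows "emeasure (power_intensity \<alpha>) {t<..} = ennreal (t powr - \<alpha>)"
proof -
  have "emeasure (power_intensity \<alpha>) {t<..} =
    (\<integral>\<^sup>+x. ennreal (indicator {0<..} x * (\<alpha> * x powr (- \<alpha> - 1))) * indicator {t<..} x \<partial>lborel)"
    unfolding power_intensity_def by (rule emeasure_density) auto
  also have "\<dots> = (\<integral>\<^sup>+x. ennreal (\<alpha> * x powr (- \<alpha> - 1)) * indicator {t..} x \<partial>lborel)"
  proof (rule nn_integral_cong_AE)
    show "AE x in lborel. ennreal (indicator {0<..} x * (\<alpha> * x powr (- \<alpha> - 1))) * indicator {t<..} x =
        ennreal (\<alpha> * x powr (- \<alpha> - 1)) * indicator {t..} x"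
      using AE_lborel_singleton[of t] by eventually_elim (use t in \<open>auto simp: indicator_def\<close>)
  qed
  also have "\<dots> = ennreal (0 - (- (t powr - \<alpha>)))"
  proof (rule nn_integral_FTC_atLeast)
    show "((\<lambda>x. - (x powr - \<alpha>)) has_real_derivative \<alpha> * x powr (- \<alpha> - 1)) (at x)" if "t \<le> x" for x
      using that t by (auto intro!: derivative_eq_intros)
    have "((\<lambda>x. x powr - \<alpha>) \<longlongrightarrow> 0) at_top"
      using \<alpha> by (intro tendsto_neg_powr filterlim_ident) auto
    from tendsto_minus[OF this] show "((\<lambda>x. - (x powr - \<alpha>)) \<longlongrightarrow> 0) at_top" by simp
  qed (use \<alpha> in auto)
  finally show ?thesis by simp
qed

lemma power_intensity_nonpos: "emeasure (power_intensity \<alpha>) {..0} = 0"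
proof -
  have "emeasure (power_intensity \<alpha>) {..0} =
    (\<integral>\<^sup>+x. ennreal (indicator {0<..} x * (\<alpha> * x powr (- \<alpha> - 1))) * indicator {..0} x \<partial>lborel)"
    unfolding power_intensity_def by (rule emeasure_density) auto
  also have "\<dots> = (\<integral>\<^sup>+x. 0 \<partial>(lborel::real measure))"
    by (rule nn_integral_cong) (auto simp: indicator_def)
  finally show ?thesis by simp
qed

lemma sets_power_intensity [simp]: "sets (power_intensity \<alpha>) = sets borel"
  by (simp add: power_intensity_def)

lemma strictly_decreasing_inj:
  fixes x :: "nat \<Rightarrow> real"
  assumes "\<And>k. x (Suc k) < x k"
  shows "inj x"
proof (rule linorder_injI)
  fix i j :: nat assume "i < j"
  then have "- x i < - x j" using lift_Suc_mono_less[of "\<lambda>k. - x k" i j] assms by simp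
  then show "x i \<noteq> x j" by simp
qed

locale power_poisson =
  fixes \<alpha> :: real and Q :: "'w measure" and x :: "'w \<Rightarrow> nat \<Rightarrow> real" and \<Xi> :: "'w \<Rightarrow> real set"
  assumes \<alpha>_pos: "0 < \<alpha>" and x_meas: "x \<in> borel_measurable Q"
    and ppp: "poisson_point_process Q (power_intensity \<alpha>) \<Xi>"
    and ranked: "AE \<omega> in Q. ranked_points (x \<omega>) (\<Xi> \<omega>)"
begin

sublocale prob_space Q
  using ppp by (simp add: poisson_point_process_def)

abbreviation "num \<equiv> num_points \<Xi>"

lemma num_measurable [measurable]: "B \<in> sets borel \<Longrightarrow> num B \<in> borel_measurable Q"
  using ppp by (simp add: poisson_point_process_def)

lemma num_prob:
  assumes "B \<in> sets borel" "emeasure (power_intensity \<alpha>) B = ennreal l" "0 \<le> l"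
  shows "measure Q {\<omega> \<in> space Q. num B \<omega> = of_nat k} = l ^ k / fact k * exp (- l)"
  using ppp assms by (simp add: poisson_point_process_def measure_def)

text \<open>The Poisson probabilities add up to 1, leaving none for an infinite count.\<close>

lemma num_finite:
  assumes B: "B \<in> sets borel" and l: "emeasure (power_intensity \<alpha>) B = ennreal l" "0 \<le> l"
  shows "AE \<omega> in Q. \<exists>k::nat. num B \<omega> = of_nat k"
proof -
  let ?A = "\<lambda>k::nat. {\<omega> \<in> space Q. num B \<omega> = of_nat k}"
  have A[measurable]: "?A k \<in> sets Q" for k using B by measurable
  have dj: "disjoint_family ?A" by (auto simp: disjoint_family_on_def)
  have "(\<lambda>k. l ^ k / fact k * exp (- l)) sums (exp l * exp (- l))"
    using exp_converges[of l] by (intro sums_mult2) (simp add: field_simps)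
  then have "(\<lambda>k. measure Q (?A k)) sums 1"
    by (simp add: num_prob[OF B l] mult_exp_exp)
  moreover have "(\<lambda>k. measure Q (?A k)) sums measure Q (\<Union>k. ?A k)"
    by (rule finite_measure_UNION[OF _ dj]) auto
  ultimately have "measure Q (\<Union>k. ?A k) = 1" by (rule sums_unique2[symmetric])
  then have "AE \<omega> in Q. \<omega> \<in> (\<Union>k. ?A k)" by (intro AE_prob_1) auto
  then show ?thesis by eventually_elim auto
qed

text \<open>There is almost surely no point in (-\<infinity>, 0], which gives positivity. Beyond
  each 1 / (j + 1) there are almost surely finitely many, which forces an injective enumeration to
  tend to 0.\<close>

lemma points_ranked: "AE \<omega> in Q. x \<omega> \<in> ranked_seqs"
proof -
  have "measure Q {\<omega> \<in> space Q. num {..0} \<omega> = of_nat 0} = 1"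
    by (subst num_prob[where l=0]) (auto simp: power_intensity_nonpos)
  then have "AE \<omega> in Q. \<omega> \<in> {\<omega> \<in> space Q. num {..0} \<omega> = of_nat 0}" by (intro AE_prob_1)
  moreover have "AE \<omega> in Q. \<forall>j::nat. \<exists>k::nat. num {1 / real (Suc j)<..} \<omega> = of_nat k"
  proof (intro AE_all_countable[THEN iffD2] allI)
    fix j
    show "AE \<omega> in Q. \<exists>k::nat. num {1 / real (Suc j)<..} \<omega> = of_nat k"
      by (rule num_finite[OF _ power_intensity_tail]) (use \<alpha>_pos in auto)
  qed
  ultimately show ?thesis using ranked
  proof eventually_elim
    case (elim \<omega>)
    have dec: "\<And>k. x \<omega> (Suc k) < x \<omega> k" and ran: "range (x \<omega>) = \<Xi> \<omega>"
      using elim(3) by (auto simp: ranked_points_def)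
    have "\<Xi> \<omega> \<inter> {..0} = {}"
      using elim(1) by (simp add: num_points_def emeasure_count_space_eq_0)
    then have pos: "0 < x \<omega> k" for k using ran by (force simp: not_le[symmetric])
    have anti: "antimono (x \<omega>)" using dec by (intro decseq_SucI) (simp add: less_imp_le)
    have inj: "inj (x \<omega>)"
      by (rule strictly_decreasing_inj[of "x \<omega>", OF dec])
    have "x \<omega> \<longlonglongrightarrow> 0"
    proof (rule LIMSEQ_I)
      fix e :: real assume "0 < e"
      then obtain j where j: "1 / real (Suc j) < e" using nat_approx_posE by blast
      obtain k :: nat where "num {1 / real (Suc j)<..} \<omega> = of_nat k" using elim(2) by blast
      then have "finite (\<Xi> \<omega> \<inter> {1 / real (Suc j)<..})"
        unfolding num_points_def by (metis emeasure_count_space_infinite ennreal_of_nat_neq_top infinity_ennreal_def subset_UNIV)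
      moreover have "x \<omega> ` {k. 1 / real (Suc j) < x \<omega> k} \<subseteq> \<Xi> \<omega> \<inter> {1 / real (Suc j)<..}" using ran by auto
      ultimately have "finite {k. 1 / real (Suc j) < x \<omega> k}"
        using inj by (meson finite_imageD finite_subset inj_on_subset subset_UNIV)
      then obtain N where N: "{k. 1 / real (Suc j) < x \<omega> k} \<subseteq> {..<N}" using finite_nat_iff_bounded by blast
      have "norm (x \<omega> k - 0) < e" if "N \<le> k" for k
      proof -
        have "k \<notin> {k. 1 / real (Suc j) < x \<omega> k}" using N that by auto
        then show ?thesis using pos[of k] j by simp
      qed
      then show "\<exists>N. \<forall>k\<ge>N. norm (x \<omega> k - 0) < e" by blast
    qed
    then show ?case using anti pos by (auto simp: ranked_seqs_def less_imp_le)
  qed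
qed

lemma num_generating_function:
  assumes B: "B \<in> sets borel" and l: "emeasure (power_intensity \<alpha>) B = ennreal l" "0 \<le> l"
  shows "(\<integral>\<^sup>+\<omega>. ennreal (exp (- h * enn2real (num B \<omega>))) \<partial>Q) = ennreal (exp (- l * (1 - exp (- h))))"
proof -
  let ?A = "\<lambda>k::nat. {\<omega> \<in> space Q. num B \<omega> = of_nat k}"
  have A[measurable]: "?A k \<in> sets Q" for k using B by measurable
  have "(\<integral>\<^sup>+\<omega>. ennreal (exp (- h * enn2real (num B \<omega>))) \<partial>Q) =
    (\<integral>\<^sup>+\<omega>. (\<Sum>k. ennreal (exp (- h * real k)) * indicator (?A k) \<omega>) \<partial>Q)"
  proof (rule nn_integral_cong_AE)
    show "AE \<omega> in Q. ennreal (exp (- h * enn2real (num B \<omega>))) = (\<Sum>k. ennreal (exp (- h * real k)) * indicator (?A k) \<omega>)"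
      using num_finite[OF B l] AE_space
    proof eventually_elim
      case (elim \<omega>)
      then obtain k :: nat where k: "num B \<omega> = of_nat k" by blast
      have "(\<Sum>k. ennreal (exp (- h * real k)) * indicator (?A k) \<omega>) =
         (\<Sum>k\<in>{k}. ennreal (exp (- h * real k)) * indicator (?A k) \<omega>)"
        by (rule suminf_finite) (use k in \<open>auto simp: indicator_def\<close>)
      then show ?case using elim k by (simp add: ennreal_of_nat_eq_real_of_nat)
    qed
  qed
  also have "\<dots> = (\<Sum>k. \<integral>\<^sup>+\<omega>. ennreal (exp (- h * real k)) * indicator (?A k) \<omega> \<partial>Q)"
    by (rule nn_integral_suminf) measurable
  also have "\<dots> = (\<Sum>k. ennreal (exp (- h * real k) * (l ^ k / fact k * exp (- l))))"
  proof (rule suminf_cong)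
    fix k
    have "(\<integral>\<^sup>+\<omega>. ennreal (exp (- h * real k)) * indicator (?A k) \<omega> \<partial>Q) = ennreal (exp (- h * real k)) * emeasure Q (?A k)"
      by (rule nn_integral_cmult_indicator) measurable
    also have "emeasure Q (?A k) = ennreal (l ^ k / fact k * exp (- l))"
      by (simp add: emeasure_eq_measure num_prob[OF B l])
    finally show "(\<integral>\<^sup>+\<omega>. ennreal (exp (- h * real k)) * indicator (?A k) \<omega> \<partial>Q) =
        ennreal (exp (- h * real k) * (l ^ k / fact k * exp (- l)))"
      using l by (simp add: ennreal_mult[symmetric])
  qed
  also have "\<dots> = ennreal (exp (- l) * exp (l * exp (- h)))"
  proof (rule suminf_ennreal_eq)
    have "(\<lambda>k. exp (- l) * ((l * exp (- h)) ^ k / fact k)) sums (exp (- l) * exp (l * exp (- h)))"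
      using exp_converges[of "l * exp (- h)"] by (intro sums_mult) (simp add: field_simps)
    moreover have "exp (- l) * ((l * exp (- h)) ^ k / fact k) = exp (- h * real k) * (l ^ k / fact k * exp (- l))" for k
      by (simp add: power_mult_distrib exp_of_nat_mult[symmetric] mult.commute)
    ultimately show "(\<lambda>k. exp (- h * real k) * (l ^ k / fact k * exp (- l))) sums (exp (- l) * exp (l * exp (- h)))"
      by (simp only:)
  qed (use l in simp)
  also have "exp (- l) * exp (l * exp (- h)) = exp (- l * (1 - exp (- h)))"
    by (simp add: mult_exp_exp algebra_simps)
  finally show ?thesis .
qed

text \<open>The successive differences of the grid tails, the last one unbounded. They are disjoint,
  so their counts are independent, unlike the counts of the nested tails.\<close>

definition cell :: "real \<Rightarrow> nat \<Rightarrow> nat \<Rightarrow> real set" where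
  "cell \<eta> r j = {z. grid \<eta> j < z \<and> (Suc j < r \<longrightarrow> z \<le> grid \<eta> (Suc j))}"

definition cell_mass :: "real \<Rightarrow> nat \<Rightarrow> nat \<Rightarrow> real" where
  "cell_mass \<eta> r j = grid \<eta> j powr - \<alpha> - (if Suc j < r then grid \<eta> (Suc j) powr - \<alpha> else 0)"

lemma cell_sets: "cell \<eta> r j \<in> sets borel"
  unfolding cell_def by measurable

lemma cell_disjoint:
  assumes "0 < \<eta>"
  shows "disjoint_family_on (cell \<eta> r) {..<r}"
  unfolding disjoint_family_on_def
proof (intro ballI impI)
  have "cell \<eta> r i \<inter> cell \<eta> r j = {}" if "i < j" "j < r" for i j
  proof -
    have "grid \<eta> (Suc i) \<le> grid \<eta> j" using monoD[OF grid_mono[OF assms], of "Suc i" j] that by simp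
    then show ?thesis using that by (auto simp: cell_def)
  qed
  then show "cell \<eta> r i \<inter> cell \<eta> r j = {}" if "i \<in> {..<r}" "j \<in> {..<r}" "i \<noteq> j" for i j
    using that by (metis Int_commute lessThan_iff nat_neq_iff)
qed

lemma cell_mass_nonneg: "0 < \<eta> \<Longrightarrow> 0 \<le> cell_mass \<eta> r j"
  using \<alpha>_pos powr_mono2'[of "- \<alpha>" "grid \<eta> j" "grid \<eta> (Suc j)"] grid_pos[of \<eta> j] monoD[OF grid_mono, of \<eta> j "Suc j"]
  by (simp add: cell_mass_def)

lemma emeasure_cell:
  assumes \<eta>: "0 < \<eta>"
  shows "emeasure (power_intensity \<alpha>) (cell \<eta> r j) = ennreal (cell_mass \<eta> r j)"
proof (cases "Suc j < r")
  case True
  have "cell \<eta> r j = {grid \<eta> j<..} - {grid \<eta> (Suc j)<..}" using True by (auto simp: cell_def)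
  also have "emeasure (power_intensity \<alpha>) \<dots> =
    emeasure (power_intensity \<alpha>) {grid \<eta> j<..} - emeasure (power_intensity \<alpha>) {grid \<eta> (Suc j)<..}"
  proof (rule emeasure_Diff)
    have "grid \<eta> j \<le> grid \<eta> (Suc j)" using monoD[OF grid_mono[OF \<eta>], of j "Suc j"] by simp
    then show "{grid \<eta> (Suc j)<..} \<subseteq> {grid \<eta> j<..}" by auto
  qed (auto simp: power_intensity_tail \<alpha>_pos grid_pos \<eta>)
  finally show ?thesis using True by (simp add: power_intensity_tail \<alpha>_pos grid_pos \<eta> cell_mass_def ennreal_minus)
next
  case False
  then have "cell \<eta> r j = {grid \<eta> j<..}" by (auto simp: cell_def)
  then show ?thesis using False by (simp add: power_intensity_tail \<alpha>_pos grid_pos \<eta> cell_mass_def)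
qed

lemma sum_cell_mass: "i < r \<Longrightarrow> (\<Sum>j=i..<r. cell_mass \<eta> r j) = grid \<eta> i powr - \<alpha>"
proof (induction "r - i" arbitrary: i)
  case (Suc d)
  show ?case
  proof (cases "Suc i < r")
    case True
    then have "(\<Sum>j=Suc i..<r. cell_mass \<eta> r j) = grid \<eta> (Suc i) powr - \<alpha>" using Suc by auto
    then show ?thesis using True Suc.prems by (simp add: sum.atLeast_Suc_lessThan cell_mass_def)
  next
    case False
    then have "{i..<r} = {i}" using Suc.prems by auto
    then show ?thesis using False by (simp add: cell_mass_def)
  qed
qed simp

lemma grid_tail_cells:
  assumes \<eta>: "0 < \<eta>" and i: "i < r"
  shows "{grid \<eta> i<..} = (\<Union>j\<in>{i..<r}. cell \<eta> r j)"
proof (intro equalityI subsetI)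
  fix z assume z: "z \<in> {grid \<eta> i<..}"
  define q where "q = card {j. j < r \<and> grid \<eta> j < z}"
  have seg: "{j. j < r \<and> grid \<eta> j < z} = {..<q}" unfolding q_def
    by (rule initial_segment) (use monoD[OF grid_mono[OF \<eta>]] in \<open>auto intro: le_less_trans\<close>)
  have "i \<in> {j. j < r \<and> grid \<eta> j < z}" using z i by simp
  then have iq: "i < q" unfolding seg by simp
  then have "q - 1 \<in> {j. j < r \<and> grid \<eta> j < z}" unfolding seg by simp
  moreover have "q \<notin> {j. j < r \<and> grid \<eta> j < z}" unfolding seg by simp
  ultimately have "z \<in> cell \<eta> r (q - 1)" "q - 1 \<in> {i..<r}" using iq by (auto simp: cell_def)
  then show "z \<in> (\<Union>j\<in>{i..<r}. cell \<eta> r j)" by blast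
next
  fix z assume "z \<in> (\<Union>j\<in>{i..<r}. cell \<eta> r j)"
  then obtain j where "i \<le> j" "grid \<eta> j < z" by (auto simp: cell_def)
  then show "z \<in> {grid \<eta> i<..}" using monoD[OF grid_mono[OF \<eta>], of i j] by auto
qed

lemma tail_count_num:
  assumes \<eta>: "0 < \<eta>"
  shows "AE \<omega> in Q. \<forall>i<r. real (tail_count (x \<omega>) (grid \<eta> i)) = (\<Sum>j=i..<r. enn2real (num (cell \<eta> r j) \<omega>))"
  using points_ranked ranked
proof eventually_elim
  case (elim \<omega>)
  show ?case
  proof (intro allI impI)
    fix i assume i: "i < r"
    have dec: "\<And>k. x \<omega> (Suc k) < x \<omega> k" and ran: "range (x \<omega>) = \<Xi> \<omega>"
      using elim(2) by (auto simp: ranked_points_def)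
    have inj: "inj (x \<omega>)"
      by (rule strictly_decreasing_inj[of "x \<omega>", OF dec])
    have img: "x \<omega> ` {k. t < x \<omega> k} = \<Xi> \<omega> \<inter> {t<..}" for t using ran by auto
    have fin: "finite (\<Xi> \<omega> \<inter> {grid \<eta> i<..})"
      unfolding img[symmetric] by (intro finite_imageI ranked_seqs_tail_finite[OF elim(1)] grid_pos \<eta>)
    have finC: "finite (\<Xi> \<omega> \<inter> cell \<eta> r j)" if "j \<in> {i..<r}" for j
      by (rule finite_subset[OF _ fin]) (use that grid_tail_cells[OF \<eta> i] in blast)
    have "tail_count (x \<omega>) (grid \<eta> i) = card (\<Xi> \<omega> \<inter> {grid \<eta> i<..})"
      unfolding tail_count_def img[symmetric] using inj by (simp add: card_image inj_on_subset)
    also have "\<Xi> \<omega> \<inter> {grid \<eta> i<..} = (\<Union>j\<in>{i..<r}. \<Xi> \<omega> \<inter> cell \<eta> r j)"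
      unfolding grid_tail_cells[OF \<eta> i] by auto
    also have "card \<dots> = (\<Sum>j=i..<r. card (\<Xi> \<omega> \<inter> cell \<eta> r j))"
    proof (rule card_UN_disjoint)
      show "\<forall>j\<in>{i..<r}. finite (\<Xi> \<omega> \<inter> cell \<eta> r j)"
        using finC by blast
      show "\<forall>j\<in>{i..<r}. \<forall>k\<in>{i..<r}. j \<noteq> k \<longrightarrow> \<Xi> \<omega> \<inter> cell \<eta> r j \<inter> (\<Xi> \<omega> \<inter> cell \<eta> r k) = {}"
      proof (intro ballI impI)
        fix j k assume jk: "j \<in> {i..<r}" "k \<in> {i..<r}" "j \<noteq> k"
        then have "cell \<eta> r j \<inter> cell \<eta> r k = {}"
          by (intro disjoint_family_onD[OF cell_disjoint[OF \<eta>, of r]]) auto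
        then show "\<Xi> \<omega> \<inter> cell \<eta> r j \<inter> (\<Xi> \<omega> \<inter> cell \<eta> r k) = {}" by blast
      qed
    qed simp
    finally have "real (tail_count (x \<omega>) (grid \<eta> i)) = (\<Sum>j=i..<r. real (card (\<Xi> \<omega> \<inter> cell \<eta> r j)))" by simp
    also have "\<dots> = (\<Sum>j=i..<r. enn2real (num (cell \<eta> r j) \<omega>))"
    proof (rule sum.cong[OF refl])
      fix j assume j: "j \<in> {i..<r}"
      have "finite (\<Xi> \<omega> \<inter> cell \<eta> r j)"
        by (rule finC[OF j])
      then show "real (card (\<Xi> \<omega> \<inter> cell \<eta> r j)) = enn2real (num (cell \<eta> r j) \<omega>)"
        by (simp add: num_points_def emeasure_count_space ennreal_of_nat_eq_real_of_nat)
    qed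
    finally show "real (tail_count (x \<omega>) (grid \<eta> i)) = (\<Sum>j=i..<r. enn2real (num (cell \<eta> r j) \<omega>))" .
  qed
qed

lemma sum_triangle:
  fixes f :: "nat \<Rightarrow> nat \<Rightarrow> real"
  shows "(\<Sum>i<r. \<Sum>j=i..<r. f i j) = (\<Sum>j<r. \<Sum>i<Suc j. f i j)"
proof -
  have "(\<Sum>i<r. \<Sum>j=i..<r. f i j) = (\<Sum>(i, j)\<in>Sigma {..<r} (\<lambda>i. {i..<r}). f i j)" by (rule sum.Sigma) auto
  also have "\<dots> = (\<Sum>(j, i)\<in>Sigma {..<r} (\<lambda>j. {..<Suc j}). f i j)"
    by (rule sum.reindex_bij_witness[of _ prod.swap prod.swap]) auto
  also have "\<dots> = (\<Sum>j<r. \<Sum>i<Suc j. f i j)" by (rule sum.Sigma[symmetric]) auto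
  finally show ?thesis .
qed

text \<open>A point in cell j exceeds levels 0 to j and so carries the exponent \<open>H j\<close>,
  the sum of c over these levels. The generating function of the nested tail counts thus factorises
  over the independent cells.\<close>

theorem poisson_power_law_counts: "power_law_counts \<alpha> Q x"
  unfolding power_law_counts_def
proof (intro conjI allI impI)
  show "prob_space Q" by unfold_locales
  show "x \<in> borel_measurable Q" by (rule x_meas)
  show rs: "AE \<omega> in Q. x \<omega> \<in> ranked_seqs" by (rule points_ranked)
  fix \<eta> :: real and c :: "nat \<Rightarrow> nat" and r :: nat assume \<eta>: "0 < \<eta>"
  define H where "H j = (\<Sum>i<Suc j. real (c i))" for j
  define g where "g j \<omega> = ennreal (exp (- H j * enn2real (num (cell \<eta> r j) \<omega>)))" for j \<omega>
  have ind: "indep_vars (\<lambda>_. borel) (\<lambda>j. num (cell \<eta> r j)) {..<r}"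
    using ppp cell_disjoint[OF \<eta>, of r] cell_sets by (simp add: poisson_point_process_def)
  have ind_g: "indep_vars (\<lambda>_. borel) g {..<r}"
    unfolding g_def
    by (rule indep_vars_compose2[OF ind, where Y="\<lambda>j z. ennreal (exp (- H j * enn2real z))"]) measurable
  have AEeq: "AE \<omega> in Q. ennreal (\<Prod>i<r. exp (- real (tail_count (x \<omega>) (grid \<eta> i))) ^ c i) = (\<Prod>j<r. g j \<omega>)"
    using tail_count_num[OF \<eta>, of r]
  proof eventually_elim
    case (elim \<omega>)
    let ?n = "\<lambda>j. enn2real (num (cell \<eta> r j) \<omega>)"
    have "(\<Prod>i<r. exp (- real (tail_count (x \<omega>) (grid \<eta> i))) ^ c i) = exp (- (\<Sum>i<r. real (c i) * real (tail_count (x \<omega>) (grid \<eta> i))))"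
      by (simp add: exp_sum sum_negf[symmetric] exp_of_nat_mult[symmetric])
    also have "(\<Sum>i<r. real (c i) * real (tail_count (x \<omega>) (grid \<eta> i))) = (\<Sum>i<r. \<Sum>j=i..<r. real (c i) * ?n j)"
      using elim by (simp add: sum_distrib_left)
    also have "\<dots> = (\<Sum>j<r. H j * ?n j)" unfolding sum_triangle H_def by (simp only: sum_distrib_right)
    also have "exp (- \<dots>) = (\<Prod>j<r. exp (- H j * ?n j))" by (simp add: exp_sum sum_negf[symmetric])
    also have "ennreal \<dots> = (\<Prod>j<r. g j \<omega>)" unfolding g_def by (rule prod_ennreal[symmetric]) simp
    finally show ?case .
  qed
  have "(\<integral>\<^sup>+\<omega>. ennreal (\<Prod>i<r. exp (- real (tail_count (x \<omega>) (grid \<eta> i))) ^ c i) \<partial>Q) = (\<integral>\<^sup>+\<omega>. (\<Prod>j<r. g j \<omega>) \<partial>Q)"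
    by (rule nn_integral_cong_AE[OF AEeq])
  also have "\<dots> = (\<Prod>j<r. \<integral>\<^sup>+\<omega>. g j \<omega> \<partial>Q)"
    by (rule indep_vars_nn_integral[OF _ ind_g]) auto
  also have "\<dots> = (\<Prod>j<r. ennreal (exp (- cell_mass \<eta> r j * (1 - exp (- H j)))))"
    unfolding g_def using num_generating_function[OF cell_sets emeasure_cell[OF \<eta>] cell_mass_nonneg[OF \<eta>]] by simp
  also have "\<dots> = ennreal (\<Prod>j<r. exp (- cell_mass \<eta> r j * (1 - exp (- H j))))"
    by (rule prod_ennreal) simp
  also have "(\<Prod>j<r. exp (- cell_mass \<eta> r j * (1 - exp (- H j)))) = exp (- (\<Sum>j<r. cell_mass \<eta> r j * (1 - exp (- H j))))"
    by (simp add: exp_sum sum_negf[symmetric])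
  \<comment> \<open>1 - exp (- H j) is the telescoped sum of the coefficients up to j. Swapping the
    triangular sum back then reassembles the cells into tails.\<close>
  also have "(\<Sum>j<r. cell_mass \<eta> r j * (1 - exp (- H j))) = (\<Sum>j<r. \<Sum>i<Suc j. gf_coeff c i * cell_mass \<eta> r j)"
    unfolding H_def by (simp only: gf_coeff_sum[symmetric] sum_distrib_left mult.commute)
  also have "\<dots> = (\<Sum>i<r. \<Sum>j=i..<r. gf_coeff c i * cell_mass \<eta> r j)" by (rule sum_triangle[symmetric])
  also have "\<dots> = (\<Sum>i<r. gf_coeff c i * grid \<eta> i powr - \<alpha>)"
    by (intro sum.cong) (auto simp: sum_distrib_left[symmetric] sum_cell_mass)
  finally have "has_bochner_integral Q (\<lambda>\<omega>. \<Prod>i<r. exp (- real (tail_count (x \<omega>) (grid \<eta> i))) ^ c i)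
      (exp (- (\<Sum>i<r. gf_coeff c i * grid \<eta> i powr - \<alpha>)))"
    by (intro has_bochner_integral_nn_integral borel_measurable_prod borel_measurable_power
        tail_count_measurable[OF x_meas rs] grid_pos \<eta>) (auto intro!: prod_nonneg)
  then show "(LINT \<omega>|Q. (\<Prod>i<r. exp (- real (tail_count (x \<omega>) (grid \<eta> i))) ^ c i)) =
      exp (- (\<Sum>i<r. gf_coeff c i * grid \<eta> i powr - \<alpha>))"
    by (simp add: has_bochner_integral_iff)
qed

end

lemma ranked_poisson_power_law_counts:
  assumes "0 < \<alpha>" "ranked_poisson_points Q \<alpha> x"
  shows "power_law_counts \<alpha> Q x"
  using assms power_poisson.poisson_power_law_counts unfolding ranked_poisson_points_def power_poisson_def
  by blast

section \<open>Counts of heavy edges\<close>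

text \<open>On the unit interval powers are k-Lipschitz, so (1 - q)^k and exp (- q)^k differ by at
  most k q^2 = (k q)^2 / k, which tends to 0.\<close>

lemma one_minus_power_tendsto:
  fixes q :: "nat \<Rightarrow> real" and k :: "nat \<Rightarrow> nat"
  assumes q: "\<And>n. 0 \<le> q n \<and> q n \<le> 1" and k: "filterlim k at_top sequentially"
    and lim: "(\<lambda>n. real (k n) * q n) \<longlonglongrightarrow> l"
  shows "(\<lambda>n. (1 - q n) ^ k n) \<longlonglongrightarrow> exp (- l)"
proof -
  have quad: "\<bar>(1 - x) - exp (- x)\<bar> \<le> x\<^sup>2" if x: "0 \<le> x" for x :: real
  proof -
    have "1 - x \<le> exp (- x)" using exp_ge_add_one_self[of "- x"] by simp
    moreover have "exp (- x) \<le> 1 - x + x\<^sup>2"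
    proof -
      \<comment> \<open>The right side is 1 + x^3.\<close>
      have "1 \<le> (1 - x + x\<^sup>2) * (1 + x)" using x by (simp add: algebra_simps power2_eq_square)
      also have "\<dots> \<le> (1 - x + x\<^sup>2) * exp x"
        using exp_ge_add_one_self[of x] sum_squares_ge_zero[of "x - 1" x]
        by (intro mult_left_mono) (auto simp: power2_eq_square algebra_simps)
      finally show ?thesis by (simp add: exp_minus field_simps)
    qed
    ultimately show ?thesis by (simp add: abs_le_iff)
  qed
  have rk: "filterlim (\<lambda>n. real (k n)) at_top sequentially"
    by (rule filterlim_compose[OF filterlim_real_sequentially k])
  have "(\<lambda>n. real (k n) * q n * (real (k n) * q n) * inverse (real (k n))) \<longlonglongrightarrow> l * l * 0"
    by (intro tendsto_mult lim tendsto_inverse_0_at_top rk)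
  then have z: "(\<lambda>n. real (k n) * (q n)\<^sup>2) \<longlonglongrightarrow> 0"
    by (rule Lim_transform_eventually[THEN tendsto_eq_rhs])
       (auto simp: power2_eq_square intro!: always_eventually)
  have "(\<lambda>n. (1 - q n) ^ k n - exp (- q n) ^ k n) \<longlonglongrightarrow> 0"
  proof (rule Lim_null_comparison[OF _ z], rule always_eventually, rule allI)
    fix n
    have "norm ((1 - q n) ^ k n - exp (- q n) ^ k n) \<le> real (k n) * norm ((1 - q n) - exp (- q n))"
      by (rule norm_power_diff) (use q in auto)
    also have "\<dots> \<le> real (k n) * (q n)\<^sup>2" using quad q by (intro mult_left_mono) auto
    finally show "norm ((1 - q n) ^ k n - exp (- q n) ^ k n) \<le> real (k n) * (q n)\<^sup>2" .
  qed
  moreover have "(\<lambda>n. exp (- q n) ^ k n) \<longlonglongrightarrow> exp (- l)"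
    using tendsto_exp[OF tendsto_minus[OF lim]] by (simp add: exp_of_nat_mult[symmetric])
  ultimately show ?thesis by (rule Lim_transform[rotated])
qed

lemma (in prob_space) prob_tendsto_0:
  fixes f :: "nat \<Rightarrow> 'a \<Rightarrow> real"
  assumes f[measurable]: "\<And>j. f j \<in> borel_measurable M" and lim: "AE \<omega> in M. (\<lambda>j. f j \<omega>) \<longlonglongrightarrow> 0" and s: "0 < s"
  shows "(\<lambda>j. prob {\<omega> \<in> space M. s < f j \<omega>}) \<longlonglongrightarrow> 0"
proof -
  have "(\<lambda>j. LINT \<omega>|M. indicator {\<omega> \<in> space M. s < f j \<omega>} \<omega>) \<longlonglongrightarrow> (LINT \<omega>|M. (0::real))"
  proof (rule integral_dominated_convergence[where w="\<lambda>_. 1"])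
    show "AE \<omega> in M. (\<lambda>j. indicator {\<omega> \<in> space M. s < f j \<omega>} \<omega>) \<longlonglongrightarrow> (0::real)"
      using lim
    proof eventually_elim
      case (elim \<omega>)
      have "\<forall>\<^sub>F j in sequentially. f j \<omega> < s" using elim s by (intro order_tendstoD)
      then have "\<forall>\<^sub>F j in sequentially. indicator {\<omega> \<in> space M. s < f j \<omega>} \<omega> = (0::real)"
        by eventually_elim (simp add: indicator_def)
      then show ?case by (rule tendsto_eventually)
    qed
    show "(\<lambda>\<omega>. indicator {\<omega> \<in> space M. s < f j \<omega>} \<omega> :: real) \<in> borel_measurable M" for j
      by (intro borel_measurable_indicator) measurable
  qed (auto simp: indicator_def)
  then show ?thesis by simp
qed

definition limit_transform :: "real \<Rightarrow> ('q \<Rightarrow> nat \<Rightarrow> real) \<Rightarrow> 'q \<Rightarrow> nat \<Rightarrow> real" where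
  "limit_transform \<eta> y \<omega> i = exp (- real (tail_count (y \<omega>) (grid \<eta> i)))"

section \<open>Random weights on complete graphs\<close>

locale graph_sample = heavy_tail \<alpha> \<L>
  for \<alpha> \<L> +
  fixes P :: "nat \<Rightarrow> 'a measure" and U :: "nat \<Rightarrow> nat \<Rightarrow> nat \<Rightarrow> 'a \<Rightarrow> real"
  assumes prob_P: "\<And>n. prob_space (P n)"
    and indep_U: "\<And>n. prob_space.indep_vars (P n) (\<lambda>_. borel) (\<lambda>(i, j). U n i j) (edges n)"
    and distr_U: "\<And>n i j. 1 \<le> i \<Longrightarrow> i \<le> j \<Longrightarrow> j \<le> n \<Longrightarrow> distr (P n) borel (U n i j) = \<L>"
    and sym_U: "\<And>n i j. 1 \<le> i \<Longrightarrow> i \<le> j \<Longrightarrow> j \<le> n \<Longrightarrow> U n j i = U n i j"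
begin

definition weight_of :: "nat \<Rightarrow> nat \<times> nat \<Rightarrow> 'a \<Rightarrow> real" where
  "weight_of n = (\<lambda>(i, j). U n i j)"

definition pairs :: "nat \<Rightarrow> nat" where
  "pairs n = n * (n + 1) div 2"

definition scale :: "nat \<Rightarrow> real" where
  "scale n = a (pairs n)"

text \<open>The edges at i, loop included, written with the smaller vertex first, so that they index
  independent weights.\<close>

definition row_edges :: "nat \<Rightarrow> nat \<Rightarrow> (nat \<times> nat) set" where
  "row_edges n i = (\<lambda>j. (min i j, max i j)) ` {1..n}"

definition exceedances :: "nat \<Rightarrow> real \<Rightarrow> 'a \<Rightarrow> nat" where
  "exceedances n t \<omega> = card {e \<in> edges n. t * scale n < weight_of n e \<omega>}"

definition exceedance_transform :: "real \<Rightarrow> nat \<Rightarrow> 'a \<Rightarrow> nat \<Rightarrow> real" where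
  "exceedance_transform \<eta> n \<omega> i = exp (- real (exceedances n (grid \<eta> i) \<omega>))"

definition rho :: "nat \<Rightarrow> 'a \<Rightarrow> nat \<Rightarrow> real" where
  "rho n \<omega> = row_sum n (\<lambda>i j. U n i j \<omega>)"

definition total :: "nat \<Rightarrow> 'a \<Rightarrow> real" where
  "total n \<omega> = (\<Sum>i=1..n. rho n \<omega> i)"

lemma sample: "iid_sample \<alpha> \<L> (P n) (weight_of n) (edges n)"
proof -
  interpret M: prob_space "P n" by (rule prob_P)
  show ?thesis
  proof
    show "M.indep_vars (\<lambda>_. borel) (weight_of n) (edges n)"
      unfolding weight_of_def by (rule indep_U)
    show "distr (P n) borel (weight_of n e) = \<L>" if "e \<in> edges n" for e
      using that distr_U by (cases e) (simp add: weight_of_def edges_def)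
  qed simp
qed

lemma U_eq: "i \<in> {1..n} \<Longrightarrow> j \<in> {1..n} \<Longrightarrow> U n i j = weight_of n (min i j, max i j)"
  using sym_U[of i j n] sym_U[of j i n] by (auto simp: weight_of_def min_def max_def)

lemma edge_min_max: "i \<in> {1..n} \<Longrightarrow> j \<in> {1..n} \<Longrightarrow> (min i j, max i j) \<in> edges n"
  by (auto simp: edges_def)

lemma row_edges:
  shows "i \<in> {1..n} \<Longrightarrow> row_edges n i \<subseteq> edges n" and "card (row_edges n i) = n"
    and "inj_on (\<lambda>j. (min i j, max i j)) {1..n}"
proof -
  show inj: "inj_on (\<lambda>j. (min i j, max i j)) {1..n}"
    by (auto simp: inj_on_def min_def max_def split: if_splits)
  show "card (row_edges n i) = n" unfolding row_edges_def using inj by (simp add: card_image)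
qed (auto simp: row_edges_def edge_min_max)

lemma U_measurable: "i \<in> {1..n} \<Longrightarrow> j \<in> {1..n} \<Longrightarrow> U n i j \<in> borel_measurable (P n)"
  using iid_sample.X_measurable[OF sample edge_min_max] by (simp add: U_eq)

lemma weight_of_measurable: "e \<in> edges n \<Longrightarrow> weight_of n e \<in> borel_measurable (P n)"
  by (rule iid_sample.X_measurable[OF sample])

lemma rho_measurable: "i \<in> {1..n} \<Longrightarrow> (\<lambda>\<omega>. rho n \<omega> i) \<in> borel_measurable (P n)"
  unfolding rho_def row_sum_def using U_measurable by (intro borel_measurable_sum) auto

lemma total_measurable [measurable]: "total n \<in> borel_measurable (P n)"
  unfolding total_def using rho_measurable by (intro borel_measurable_sum) auto

lemma total_eq: "total n \<omega> = 2 * (\<Sum>e\<in>edges n. weight_of n e \<omega>) - (\<Sum>e\<in>(\<lambda>i. (i, i)) ` {1..n}. weight_of n e \<omega>)"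
proof -
  have "total n \<omega> = 2 * (\<Sum>(i, j)\<in>edges n. U n i j \<omega>) - (\<Sum>i=1..n. U n i i \<omega>)"
    unfolding total_def rho_def by (rule sum_row_sums) (simp add: U_eq min.commute max.commute)
  also have "(\<Sum>(i, j)\<in>edges n. U n i j \<omega>) = (\<Sum>e\<in>edges n. weight_of n e \<omega>)"
    by (intro sum.cong) (auto simp: weight_of_def)
  also have "(\<Sum>i=1..n. U n i i \<omega>) = (\<Sum>e\<in>(\<lambda>i. (i, i)) ` {1..n}. weight_of n e \<omega>)"
    by (subst sum.reindex) (auto simp: inj_on_def weight_of_def)
  finally show ?thesis .
qed

definition nonneg_weights :: "nat \<Rightarrow> 'a \<Rightarrow> bool" where
  "nonneg_weights n \<omega> \<longleftrightarrow> (\<forall>e\<in>edges n. 0 \<le> weight_of n e \<omega>)"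

lemma nonneg_weights_AE: "AE \<omega> in P n. nonneg_weights n \<omega>"
  using iid_sample.AE_X_nonneg[OF sample, of n] by (simp add: nonneg_weights_def)

lemma nonneg_weights_prob: "{\<omega> \<in> space (P n). \<not> nonneg_weights n \<omega>} \<in> sets (P n)"
   "measure (P n) {\<omega> \<in> space (P n). \<not> nonneg_weights n \<omega>} = 0"
proof -
  have [measurable]: "Measurable.pred (P n) (\<lambda>\<omega>. 0 \<le> weight_of n e \<omega>)" if "e \<in> edges n" for e
    using weight_of_measurable[OF that] by measurable
  show s: "{\<omega> \<in> space (P n). \<not> nonneg_weights n \<omega>} \<in> sets (P n)"
    unfolding nonneg_weights_def by (intro predE) (auto intro!: pred_intros_finite pred_intros_logic)
  show "measure (P n) {\<omega> \<in> space (P n). \<not> nonneg_weights n \<omega>} = 0"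
    using nonneg_weights_AE[of n] AE_iff_measurable[OF s, of "nonneg_weights n"] by (simp add: measure_def)
qed

lemma U_nonneg: "nonneg_weights n \<omega> \<Longrightarrow> i \<in> {1..n} \<Longrightarrow> j \<in> {1..n} \<Longrightarrow> 0 \<le> U n i j \<omega>"
  by (simp add: U_eq nonneg_weights_def edge_min_max)

lemma rho_nonneg: "nonneg_weights n \<omega> \<Longrightarrow> i \<in> {1..n} \<Longrightarrow> 0 \<le> rho n \<omega> i"
  unfolding rho_def row_sum_def by (intro sum_nonneg U_nonneg) auto

lemma total_nonneg: "nonneg_weights n \<omega> \<Longrightarrow> 0 \<le> total n \<omega>"
  unfolding total_def by (intro sum_nonneg rho_nonneg) auto

section \<open>Orders of magnitude at the scale of the largest weights\<close>

lemma real_pairs: "real (pairs n) = real n * (real n + 1) / 2"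
proof -
  have "even (n * (n + 1))" by simp
  then obtain k where k: "n * (n + 1) = 2 * k" by (rule evenE)
  then have "real n * (real n + 1) = 2 * real k" by (metis of_nat_Suc of_nat_mult of_nat_numeral Suc_eq_plus1 add.commute)
  then show ?thesis unfolding pairs_def k by simp
qed

lemma pairs_ge: "n \<le> pairs n"
proof -
  have "2 * n \<le> n * (n + 1)" by (cases n) auto
  then show ?thesis unfolding pairs_def by linarith
qed

lemma pairs_at_top: "filterlim pairs at_top sequentially"
  by (rule filterlim_at_top_mono[OF filterlim_ident]) (auto intro!: always_eventually pairs_ge)

lemma square_le_pairs: "(real n)\<^sup>2 \<le> 2 * real (pairs n)"
  by (simp add: real_pairs power2_eq_square algebra_simps)

lemma n_over_pairs: "(\<lambda>n. real n / real (pairs n)) \<longlonglongrightarrow> 0"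
proof -
  have "(\<lambda>n. 2 * inverse (real (Suc n))) \<longlonglongrightarrow> 0"
    by (intro tendsto_mult_right_zero LIMSEQ_inverse_real_of_nat)
  moreover have "\<forall>\<^sub>F n in sequentially. 2 * inverse (real (Suc n)) = real n / real (pairs n)"
    using eventually_gt_at_top[of 0] by eventually_elim (simp add: real_pairs inverse_eq_divide add.commute)
  ultimately show ?thesis by (rule Lim_transform_eventually)
qed

lemma scale_at_top: "filterlim scale at_top sequentially"
  unfolding scale_def[abs_def] by (rule filterlim_compose[OF quantile_at_top pairs_at_top])

lemma scale_pos: "\<forall>\<^sub>F n in sequentially. 0 < scale n"
  using scale_at_top by (simp add: filterlim_at_top_dense)

lemma scale_nonneg: "0 \<le> scale n"
  by (simp add: scale_def quantile_nonneg)

lemma tail_scale: "0 < t \<Longrightarrow> (\<lambda>n. real (pairs n) * G (t * scale n)) \<longlonglongrightarrow> t powr - \<alpha>"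
  unfolding scale_def by (rule filterlim_compose[OF quantile_tail_scaled pairs_at_top])

text \<open>Controls heavy loops: there are only n of them among the roughly n^2 / 2 edges.\<close>

lemma n_tail_scale: "0 < t \<Longrightarrow> (\<lambda>n. real n * G (t * scale n)) \<longlonglongrightarrow> 0"
proof -
  assume t: "0 < t"
  have "(\<lambda>n. real n / real (pairs n) * (real (pairs n) * G (t * scale n))) \<longlonglongrightarrow> 0"
    using tendsto_mult[OF n_over_pairs tail_scale[OF t]] by simp
  moreover have "\<forall>\<^sub>F n in sequentially. real n / real (pairs n) * (real (pairs n) * G (t * scale n)) = real n * G (t * scale n)"
    using eventually_gt_at_top[of 0]
  proof eventually_elim
    case (elim n)
    then have "0 < real (pairs n)" using pairs_ge[of n] by simp
    then show ?case by simp
  qed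
  ultimately show ?thesis by (rule Lim_transform_eventually)
qed

text \<open>Controls pairs of heavy edges with a common vertex: there are at most n^3 choices, each
  of probability G^2, and G is of order n^(-2) at this level.\<close>

lemma cube_tail_scale: "0 < t \<Longrightarrow> (\<lambda>n. real n ^ 3 * G (t * scale n) ^ 2) \<longlonglongrightarrow> 0"
proof -
  assume t: "0 < t"
  have "(\<lambda>n. 2 * (real (pairs n) * G (t * scale n)) * (real n * G (t * scale n))) \<longlonglongrightarrow> 2 * (t powr - \<alpha>) * 0"
    by (intro tendsto_mult tendsto_const n_tail_scale tail_scale t)
  then have z: "(\<lambda>n. 2 * (real (pairs n) * G (t * scale n)) * (real n * G (t * scale n))) \<longlonglongrightarrow> 0" by simp
  show ?thesis
  proof (rule tendsto_sandwich[OF _ _ tendsto_const z])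
    show "\<forall>\<^sub>F n in sequentially. real n ^ 3 * G (t * scale n) ^ 2 \<le> 2 * (real (pairs n) * G (t * scale n)) * (real n * G (t * scale n))"
    proof (rule always_eventually, rule allI)
      fix n
      have "real n ^ 3 * G (t * scale n) ^ 2 = (real n)\<^sup>2 * (G (t * scale n) * (real n * G (t * scale n)))"
        by (simp add: power2_eq_square power3_eq_cube)
      also have "\<dots> \<le> 2 * real (pairs n) * (G (t * scale n) * (real n * G (t * scale n)))"
        by (intro mult_right_mono square_le_pairs mult_nonneg_nonneg G_nonneg) auto
      finally show "real n ^ 3 * G (t * scale n) ^ 2 \<le> 2 * (real (pairs n) * G (t * scale n)) * (real n * G (t * scale n))"
        by (simp add: algebra_simps)
    qed
  qed (auto intro!: always_eventually)
qed

text \<open>Controls the mean light weight at a vertex.\<close>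

lemma n_mom_1:
  assumes "\<alpha> < 2" "0 < t"
  shows "(\<lambda>n. real n * mom 1 (t * scale n) / scale n) \<longlonglongrightarrow> 0"
proof -
  have "(\<lambda>n. sqrt 2 * (sqrt (real (pairs n)) * mom 1 (t * scale n) / scale n)) \<longlonglongrightarrow> sqrt 2 * 0"
    unfolding scale_def
    by (intro tendsto_mult tendsto_const filterlim_compose[OF sqrt_mom_1[OF assms] pairs_at_top])
  then have z: "(\<lambda>n. sqrt 2 * (sqrt (real (pairs n)) * mom 1 (t * scale n) / scale n)) \<longlonglongrightarrow> 0" by simp
  show ?thesis
  proof (rule tendsto_sandwich[OF _ _ tendsto_const z])
    show "\<forall>\<^sub>F n in sequentially. real n * mom 1 (t * scale n) / scale n \<le> sqrt 2 * (sqrt (real (pairs n)) * mom 1 (t * scale n) / scale n)"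
    proof (rule always_eventually, rule allI)
      fix n
      have "real n \<le> sqrt (2 * real (pairs n))" using square_le_pairs by (rule real_le_rsqrt)
      then have "real n * (mom 1 (t * scale n) / scale n) \<le> sqrt (2 * real (pairs n)) * (mom 1 (t * scale n) / scale n)"
        by (intro mult_right_mono divide_nonneg_nonneg mom_nonneg scale_nonneg)
      then show "real n * mom 1 (t * scale n) / scale n \<le> sqrt 2 * (sqrt (real (pairs n)) * mom 1 (t * scale n) / scale n)"
        by (simp add: real_sqrt_mult)
    qed
    show "\<forall>\<^sub>F n in sequentially. 0 \<le> real n * mom 1 (t * scale n) / scale n"
      by (intro always_eventually allI divide_nonneg_nonneg mult_nonneg_nonneg mom_nonneg scale_nonneg) auto
  qed
qed

section \<open>Generating functions of the heavy edge counts\<close>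

lemma exceedance_transform_measurable [measurable]: "exceedance_transform \<eta> n \<in> borel_measurable (P n)"
proof (rule measurable_coordinatewise_then_product)
  fix i
  have "exceedance_transform \<eta> n \<omega> i = exp (- (\<Sum>e\<in>edges n. indicator {grid \<eta> i * scale n<..} (weight_of n e \<omega>)))" for \<omega>
    by (simp add: exceedance_transform_def exceedances_def indicator_def sum.If_cases Int_def)
  moreover have "(\<lambda>\<omega>. exp (- (\<Sum>e\<in>edges n. indicator {grid \<eta> i * scale n<..} (weight_of n e \<omega>) :: real))) \<in> borel_measurable (P n)"
    by (intro borel_measurable_exp[THEN measurable_compose[rotated]] borel_measurable_uminus borel_measurable_sum
        measurable_compose[OF weight_of_measurable borel_measurable_indicator]) auto
  ultimately show "(\<lambda>\<omega>. exceedance_transform \<eta> n \<omega> i) \<in> borel_measurable (P n)" by simp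
qed

lemma exceedance_gf:
  assumes \<eta>: "0 < \<eta>"
  shows "(\<lambda>n. LINT \<omega>|P n. (\<Prod>i<r. exceedance_transform \<eta> n \<omega> i ^ c i)) \<longlonglongrightarrow>
     exp (- (\<Sum>i<r. gf_coeff c i * grid \<eta> i powr - \<alpha>))"
proof -
  define q where "q n = (\<Sum>i<r. gf_coeff c i * G (grid \<eta> i * scale n))" for n
  have q: "0 \<le> q n \<and> q n \<le> 1" for n
  proof
    show "0 \<le> q n" unfolding q_def by (intro sum_nonneg mult_nonneg_nonneg gf_coeff_nonneg G_nonneg)
    have "q n \<le> (\<Sum>i<r. gf_coeff c i * 1)" unfolding q_def
      by (intro sum_mono mult_left_mono gf_coeff_nonneg) (simp add: tail_def)
    then show "q n \<le> 1" by (simp add: gf_coeff_sum) (smt (verit) exp_gt_zero)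
  qed
  have eq: "(LINT \<omega>|P n. (\<Prod>i<r. exceedance_transform \<eta> n \<omega> i ^ c i)) = (1 - q n) ^ pairs n" for n
  proof -
    interpret S: iid_sample \<alpha> \<L> "P n" "weight_of n" "edges n" by (rule sample)
    define w where "w x = exp (- (\<Sum>i<r. if grid \<eta> i * scale n < x then real (c i) else 0))" for x
    have mono: "mono (\<lambda>i. grid \<eta> i * scale n)"
      using monoD[OF grid_mono[OF \<eta>]] by (auto intro!: monoI mult_right_mono scale_nonneg)
    have w: "w x = 1 - (\<Sum>i<r. if grid \<eta> i * scale n < x then gf_coeff c i else 0)" for x
      unfolding w_def by (rule step_generating_function[OF mono])
    have "(LINT \<omega>|P n. (\<Prod>i<r. exceedance_transform \<eta> n \<omega> i ^ c i)) = (LINT \<omega>|P n. (\<Prod>e\<in>edges n. w (weight_of n e \<omega>)))"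
      unfolding w_def exceedance_transform_def exceedances_def
      by (subst product_of_counts) auto
    also have "\<dots> = (LINT x|\<L>. w x) ^ card (edges n)"
    proof (rule S.generating_function)
      show "w \<in> borel_measurable borel" unfolding w_def by measurable
      show "0 \<le> w x \<and> w x \<le> 1" for x unfolding w_def by (auto intro!: sum_nonneg)
    qed
    also have "(LINT x|\<L>. w x) = (LINT x|\<L>. 1 - (\<Sum>i<r. gf_coeff c i * indicator {grid \<eta> i * scale n<..} x))"
      unfolding w by (intro Bochner_Integration.integral_cong refl arg_cong2[where f="(-)"] sum.cong) (auto simp: indicator_def)
    also have "\<dots> = 1 - q n"
    proof -
      have i: "integrable \<L> (\<lambda>x. gf_coeff c i * indicator {grid \<eta> i * scale n<..} x)" for i
        by (intro integrable_mult_right integrable_real_indicator) (auto simp: less_top[symmetric])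
      have "(LINT x|\<L>. 1 - (\<Sum>i<r. gf_coeff c i * indicator {grid \<eta> i * scale n<..} x)) =
        (LINT x|\<L>. 1) - (LINT x|\<L>. (\<Sum>i<r. gf_coeff c i * indicator {grid \<eta> i * scale n<..} x))"
        by (intro Bochner_Integration.integral_diff Bochner_Integration.integrable_sum i) simp
      also have "(LINT x|\<L>. (\<Sum>i<r. gf_coeff c i * indicator {grid \<eta> i * scale n<..} x)) = q n"
        unfolding q_def by (subst Bochner_Integration.integral_sum[OF i]) (simp add: tail_def)
      finally show ?thesis using prob_space by simp
    qed
    finally show ?thesis by (simp add: card_edges pairs_def)
  qed
  have "(\<lambda>n. \<Sum>i<r. gf_coeff c i * (real (pairs n) * G (grid \<eta> i * scale n))) \<longlonglongrightarrow> (\<Sum>i<r. gf_coeff c i * grid \<eta> i powr - \<alpha>)"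
    by (intro tendsto_intros tail_scale grid_pos \<eta>)
  then have "(\<lambda>n. real (pairs n) * q n) \<longlonglongrightarrow> (\<Sum>i<r. gf_coeff c i * grid \<eta> i powr - \<alpha>)"
    by (simp add: q_def sum_distrib_left mult.left_commute)
  from one_minus_power_tendsto[OF q pairs_at_top this] show ?thesis unfolding eq .
qed

lemma limit_transform_measurable:
  assumes y: "power_law_counts \<alpha> Q y" and \<eta>: "0 < \<eta>"
  shows "limit_transform \<eta> y \<in> borel_measurable Q"
  unfolding limit_transform_def
  by (rule measurable_coordinatewise_then_product, rule tail_count_measurable)
    (use y grid_pos[OF \<eta>] in \<open>auto simp: power_law_counts_def\<close>)

lemma transform_convergence:
  assumes y: "power_law_counts \<alpha> Q y" and \<eta>: "0 < \<eta>" and \<Phi>: "continuous_on UNIV (\<Phi> :: (nat \<Rightarrow> real) \<Rightarrow> nat \<Rightarrow> real)"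
  shows "lipschitz_convergence P (\<lambda>n \<omega>. \<Phi> (exceedance_transform \<eta> n \<omega>)) Q (\<lambda>\<omega>. \<Phi> (limit_transform \<eta> y \<omega>))"
proof (rule unit_cube_map_convergence[OF prob_P _ _ _ _ _ _ \<Phi>])
  show "prob_space Q" using y by (simp add: power_law_counts_def)
  show "(\<lambda>n. LINT \<omega>|P n. (\<Prod>i<r. exceedance_transform \<eta> n \<omega> i ^ c i)) \<longlonglongrightarrow>
     (LINT \<omega>|Q. (\<Prod>i<r. limit_transform \<eta> y \<omega> i ^ c i))" for c r
    using exceedance_gf[OF \<eta>, where r=r and c=c] y \<eta> by (simp add: power_law_counts_def limit_transform_def)
qed (auto simp: exceedance_transform_def limit_transform_def limit_transform_measurable[OF y \<eta>])

end

section \<open>Joint convergence of the ranked vertex sums\<close>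

text \<open>For a decreasing nonnegative sequence convergence to 0 means that some entry falls below
  each 1 / (j + 1), a countable condition on coordinates.\<close>

lemma ranked_seqs_borel: "ranked_seqs \<in> sets borel"
proof -
  have eq: "ranked_seqs = {v. (\<forall>k. v (Suc k) \<le> v k) \<and> (\<forall>k. 0 \<le> v k) \<and> (\<forall>j. \<exists>k. v k < 1 / real (Suc j))}"
  proof (intro set_eqI iffI)
    fix v assume v: "v \<in> ranked_seqs"
    have "\<exists>k. v k < 1 / real (Suc j)" for j
    proof -
      have "\<forall>\<^sub>F k in sequentially. v k < 1 / real (Suc j)"
        using v by (intro order_tendstoD) (auto simp: ranked_seqs_def)
      then show ?thesis by (auto simp: eventually_sequentially)
    qed
    then show "v \<in> {v. (\<forall>k. v (Suc k) \<le> v k) \<and> (\<forall>k. 0 \<le> v k) \<and> (\<forall>j. \<exists>k. v k < 1 / real (Suc j))}"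
      using v by (auto simp: ranked_seqs_def decseq_Suc_iff)
  next
    fix v :: "nat \<Rightarrow> real"
    assume v: "v \<in> {v. (\<forall>k. v (Suc k) \<le> v k) \<and> (\<forall>k. 0 \<le> v k) \<and> (\<forall>j. \<exists>k. v k < 1 / real (Suc j))}"
    then have anti: "antimono v" by (simp add: decseq_Suc_iff)
    have "v \<longlonglongrightarrow> 0"
    proof (rule LIMSEQ_I)
      fix e :: real assume "0 < e"
      then obtain j where j: "1 / real (Suc j) < e" using nat_approx_posE by blast
      obtain k where "v k < 1 / real (Suc j)" using v by blast
      then have "norm (v i - 0) < e" if "k \<le> i" for i
        using antimonoD[OF anti that] v j by (auto simp: abs_if not_less[symmetric])
      then show "\<exists>N. \<forall>i\<ge>N. norm (v i - 0) < e" by blast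
    qed
    then show "v \<in> ranked_seqs" using anti v by (auto simp: ranked_seqs_def)
  qed
  have m: "{v::nat \<Rightarrow> real. v (Suc k) \<le> v k} \<in> sets borel" "{v::nat \<Rightarrow> real. 0 \<le> v k} \<in> sets borel"
    "{v::nat \<Rightarrow> real. v k < c} \<in> sets borel" for k c
    by (intro borel_closed borel_open closed_Collect_le open_Collect_less
        continuous_on_product_coordinates continuous_on_const)+
  have eq': "ranked_seqs = (\<Inter>k. {v. v (Suc k) \<le> v k}) \<inter> (\<Inter>k. {v. 0 \<le> v k}) \<inter>
      (\<Inter>j. \<Union>k. {v. v k < 1 / real (Suc j)})"
    unfolding eq by auto
  show ?thesis unfolding eq'
    by (intro sets.Int sets.countable_INT'' sets.countable_UN'' m) simp_all
qed

lemma tail_count_antimono: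
  assumes y: "y \<in> ranked_seqs" and st: "0 < s" "s \<le> t"
  shows "tail_count y t \<le> tail_count y s"
  unfolding tail_count_def by (rule card_mono[OF ranked_seqs_tail_finite[OF y st(1)]]) (use st in auto)

lemma level_close_limit:
  assumes y: "y \<in> ranked_seqs" and \<eta>: "0 < \<eta>" and r: "0 < r" and top: "y 0 \<le> \<eta> * real r"
  shows "\<bar>y k - level \<eta> r (\<lambda>i. exp (- real (tail_count y (grid \<eta> i)))) k\<bar> \<le> \<eta>"
proof -
  have "\<bar>y k - level \<eta> r (\<lambda>i. exp (- real (tail_count y (grid \<eta> i)))) k\<bar> \<le> \<eta> + 0"
  proof (rule level_close[OF _ r _ _ \<eta>])
    show "tail_count y (grid \<eta> j) \<le> tail_count y (grid \<eta> i)" if "i \<le> j" for i j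
      by (rule tail_count_antimono[OF y grid_pos[OF \<eta>] monoD[OF grid_mono[OF \<eta>] that]])
    have "\<not> 0 < tail_count y (grid \<eta> (r - 1))"
      using tail_count_greater_iff[OF y grid_pos[OF \<eta>], of 0 "r - 1"] top r by (simp add: grid_def)
    then show "tail_count y (grid \<eta> (r - 1)) \<le> k" by simp
    show "0 \<le> y k" using y by (simp add: ranked_seqs_def)
    show "\<eta> * real (Suc i) \<le> y k" if "k < tail_count y (grid \<eta> i)" for i
      using that tail_count_greater_iff[OF y grid_pos[OF \<eta>], of k i] by (simp add: grid_def)
    show "k < tail_count y (grid \<eta> i)" if "\<eta> * real (Suc i) + 0 < y k" for i
      using that tail_count_greater_iff[OF y grid_pos[OF \<eta>], of k i] by (simp add: grid_def)
  qed simp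
  then show ?thesis by simp
qed

lemma limit_top:
  assumes y: "power_law_counts \<alpha> Q y" and \<eta>: "0 < \<eta>" and \<theta>: "0 < \<theta>"
  shows "\<forall>\<^sub>F r in sequentially. measure Q {\<omega> \<in> space Q. \<eta> * real r < y \<omega> 0} \<le> \<theta>"
proof -
  interpret Q: prob_space Q using y by (simp add: power_law_counts_def)
  have [measurable]: "(\<lambda>\<omega>. y \<omega> 0) \<in> borel_measurable Q"
    by (rule measurable_product_then_coordinatewise) (use y in \<open>simp add: power_law_counts_def\<close>)
  have etar: "filterlim (\<lambda>r. \<eta> * real r) at_top sequentially"
    by (rule filterlim_tendsto_pos_mult_at_top[OF tendsto_const \<eta> filterlim_real_sequentially])
  \<comment> \<open>The event is written as a 0/1-valued function exceeding 1/2, and for each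
    outcome that function is eventually 0.\<close>
  have "(\<lambda>r. Q.prob {\<omega> \<in> space Q. 1/2 < (if y \<omega> 0 \<le> \<eta> * real r then 0 else 1 :: real)}) \<longlonglongrightarrow> 0"
  proof (rule Q.prob_tendsto_0)
    show "AE \<omega> in Q. (\<lambda>r. if y \<omega> 0 \<le> \<eta> * real r then 0 else 1 :: real) \<longlonglongrightarrow> 0"
    proof (rule AE_I2)
      fix \<omega>
      have "\<forall>\<^sub>F r in sequentially. y \<omega> 0 \<le> \<eta> * real r" using etar by (simp add: filterlim_at_top)
      then show "(\<lambda>r. if y \<omega> 0 \<le> \<eta> * real r then 0 else 1 :: real) \<longlonglongrightarrow> 0"
        by (intro tendsto_eventually) (auto elim: eventually_mono)
    qed
    show "(\<lambda>\<omega>. if y \<omega> 0 \<le> \<eta> * real r then 0 else 1 :: real) \<in> borel_measurable Q" for r by measurable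
  qed simp
  then have "\<forall>\<^sub>F r in sequentially. Q.prob {\<omega> \<in> space Q. 1/2 < (if y \<omega> 0 \<le> \<eta> * real r then 0 else 1 :: real)} < \<theta>"
    using \<theta> by (rule order_tendstoD)
  then show ?thesis
  proof eventually_elim
    case (elim r)
    have "{\<omega> \<in> space Q. 1/2 < (if y \<omega> 0 \<le> \<eta> * real r then 0 else 1 :: real)} = {\<omega> \<in> space Q. \<eta> * real r < y \<omega> 0}"
      by (auto split: if_splits)
    then show ?case using elim by simp
  qed
qed

context graph_sample
begin

text \<open>Union bounds over loops, over pairs of edges at a vertex, and over vertices with an
  unusual light sum. The first two vanish as n grows; the third is only made small by \<epsilon>.
  The bound \<epsilon>1 lets a caller keep the heaviness threshold below its grid.\<close>

lemma good_event:
  assumes \<alpha>2: "\<alpha> < 2" and \<delta>: "0 < \<delta>" and \<theta>: "0 < \<theta>" and \<epsilon>1: "0 < \<epsilon>1"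
  shows "\<exists>\<epsilon>. 0 < \<epsilon> \<and> \<epsilon> \<le> \<epsilon>1 \<and> (\<forall>\<^sub>F n in sequentially. \<exists>Bad\<in>sets (P n). measure (P n) Bad \<le> \<theta> \<and>
     (\<forall>\<omega>\<in>space (P n) - Bad. nonneg_weights n \<omega> \<and>
        heavy_matching n (\<lambda>i j. U n i j \<omega>) (\<epsilon> * scale n) (\<delta> * scale n)))"
proof -
  obtain C where C: "0 < C" and mom2: "\<And>x. 0 < x \<Longrightarrow> \<forall>\<^sub>F m in sequentially. real m * mom 2 (x * a m) \<le> C * x powr (2 - \<alpha>) * a m powr 2"
    using trunc_moment_quantile[OF \<alpha>2] by blast
  \<comment> \<open>The second entry solves 8 C \<epsilon> powr (2 - \<alpha>) / \<delta>^2 =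
    \<theta> / 2, the budget for the light sums: n vertices with n edges each, n^2 \<le> 2 m, and
    deviations of half of \<delta> times the scale.\<close>
  define \<epsilon> where "\<epsilon> = min \<epsilon>1 ((\<theta> * \<delta>\<^sup>2 / (16 * C)) powr (1 / (2 - \<alpha>)))"
  have \<epsilon>: "0 < \<epsilon>" "\<epsilon> \<le> \<epsilon>1" using \<epsilon>1 \<theta> \<delta> C by (auto simp: \<epsilon>_def)
  have "\<epsilon> powr (2 - \<alpha>) \<le> ((\<theta> * \<delta>\<^sup>2 / (16 * C)) powr (1 / (2 - \<alpha>))) powr (2 - \<alpha>)"
    using \<epsilon> \<alpha>2 by (intro powr_mono2) (auto simp: \<epsilon>_def)
  also have "\<dots> = \<theta> * \<delta>\<^sup>2 / (16 * C)" using \<alpha>2 \<theta> \<delta> C by (simp add: powr_powr)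
  finally have \<epsilon>pow: "8 * (C * \<epsilon> powr (2 - \<alpha>)) / \<delta>\<^sup>2 \<le> \<theta> / 2"
    using C \<delta> by (simp add: field_simps)
  have "(\<lambda>n. real n * G (\<epsilon> * scale n) + real n ^ 3 * G (\<epsilon> * scale n) ^ 2) \<longlonglongrightarrow> 0 + 0"
    by (intro tendsto_add n_tail_scale cube_tail_scale \<epsilon>)
  then have ev1: "\<forall>\<^sub>F n in sequentially. real n * G (\<epsilon> * scale n) + real n ^ 3 * G (\<epsilon> * scale n) ^ 2 < \<theta> / 2"
    using \<theta> by (intro order_tendstoD) auto
  have ev2: "\<forall>\<^sub>F n in sequentially. real (pairs n) * mom 2 (\<epsilon> * scale n) \<le> C * \<epsilon> powr (2 - \<alpha>) * scale n powr 2"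
    unfolding scale_def by (rule eventually_compose_filterlim[OF mom2[OF \<epsilon>(1)] pairs_at_top])
  have ev3: "\<forall>\<^sub>F n in sequentially. real n * mom 1 (\<epsilon> * scale n) / scale n < \<delta> / 2"
    using \<delta> by (intro order_tendstoD(2)[OF n_mom_1[OF \<alpha>2 \<epsilon>(1)]]) auto
  have "\<forall>\<^sub>F n in sequentially. \<exists>Bad\<in>sets (P n). measure (P n) Bad \<le> \<theta> \<and>
     (\<forall>\<omega>\<in>space (P n) - Bad. nonneg_weights n \<omega> \<and>
        heavy_matching n (\<lambda>i j. U n i j \<omega>) (\<epsilon> * scale n) (\<delta> * scale n))"
    using ev1 ev2 ev3 scale_pos
  proof eventually_elim
    case (elim n)
    interpret S: iid_sample \<alpha> \<L> "P n" "weight_of n" "edges n" by (rule sample)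
    let ?X = "weight_of n" and ?V = "{1..n}" and ?\<beta> = "\<epsilon> * scale n" and ?D = "\<delta> * scale n"
    let ?e = "\<lambda>i j. (min i j, max i j)"
    have s: "0 < scale n" by fact
    have \<beta>: "0 \<le> ?\<beta>" using \<epsilon> s by simp
    define T where "T = {(i, j, j') \<in> ?V \<times> ?V \<times> ?V. j \<noteq> j'}"
    define B0 where "B0 = {\<omega> \<in> space (P n). \<not> nonneg_weights n \<omega>}"
    define B1 where "B1 = {\<omega> \<in> space (P n). \<exists>e\<in>(\<lambda>i. (i, i)) ` ?V. ?\<beta> < ?X e \<omega>}"
    define B2 where "B2 = (\<Union>(i, j, j')\<in>T. {\<omega> \<in> space (P n). ?\<beta> < ?X (?e i j) \<omega> \<and> ?\<beta> < ?X (?e i j') \<omega>})"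
    \<comment> \<open>Half of the allowance D is for the deviation of a light sum from its mean; the
      other half covers the mean.\<close>
    define B3 where "B3 = (\<Union>i\<in>?V. {\<omega> \<in> space (P n). ?D / 2 \<le>
        \<bar>(\<Sum>e\<in>row_edges n i. trunc ?\<beta> (?X e \<omega>)) - real (card (row_edges n i)) * mom 1 ?\<beta>\<bar>})"
    have finT: "finite T" unfolding T_def by (rule finite_subset[of _ "?V \<times> ?V \<times> ?V"]) auto
    have cardT: "card T \<le> n ^ 3"
    proof -
      have "card T \<le> card (?V \<times> ?V \<times> ?V)" unfolding T_def by (rule card_mono) auto
      also have "\<dots> = n ^ 3" by (simp add: card_cartesian_product power3_eq_cube)
      finally show ?thesis .
    qed
    have B0: "B0 \<in> sets (P n)" "measure (P n) B0 = 0"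
      unfolding B0_def by (rule nonneg_weights_prob)+
    have diag: "(\<lambda>i. (i, i)) ` ?V \<subseteq> edges n" by (auto simp: edges_def)
    have B1s: "B1 \<in> sets (P n)"
    proof -
      have "B1 = (\<Union>e\<in>(\<lambda>i. (i, i)) ` ?V. {\<omega> \<in> space (P n). ?\<beta> < ?X e \<omega>})" by (auto simp: B1_def)
      then show ?thesis using diag S.exceed_sets by (auto intro!: sets.finite_UN)
    qed
    have B1m: "measure (P n) B1 \<le> real n * G ?\<beta>"
      unfolding B1_def using S.prob_exists_exceed[OF diag, of ?\<beta>] by (simp add: card_image inj_on_def)
    have B2i: "{\<omega> \<in> space (P n). ?\<beta> < ?X (?e i j) \<omega> \<and> ?\<beta> < ?X (?e i j') \<omega>} \<in> sets (P n)"
      "measure (P n) {\<omega> \<in> space (P n). ?\<beta> < ?X (?e i j) \<omega> \<and> ?\<beta> < ?X (?e i j') \<omega>} = G ?\<beta> ^ 2"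
      if "(i, j, j') \<in> T" for i j j'
    proof -
      have ij: "i \<in> ?V" "j \<in> ?V" "j' \<in> ?V" "j \<noteq> j'" using that by (auto simp: T_def)
      have [measurable]: "?X (?e i j) \<in> borel_measurable (P n)" "?X (?e i j') \<in> borel_measurable (P n)"
        using ij by (auto intro!: weight_of_measurable edge_min_max)
      show "{\<omega> \<in> space (P n). ?\<beta> < ?X (?e i j) \<omega> \<and> ?\<beta> < ?X (?e i j') \<omega>} \<in> sets (P n)" by measurable
      have "?e i j \<noteq> ?e i j'" using inj_onD[OF row_edges(3) _ ij(2,3)] ij(4) by blast
      then show "measure (P n) {\<omega> \<in> space (P n). ?\<beta> < ?X (?e i j) \<omega> \<and> ?\<beta> < ?X (?e i j') \<omega>} = G ?\<beta> ^ 2"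
        using ij by (intro S.prob_both_exceed edge_min_max) auto
    qed
    have B2s: "B2 \<in> sets (P n)" unfolding B2_def using finT B2i(1) by (intro sets.finite_UN) auto
    have B2m: "measure (P n) B2 \<le> real n ^ 3 * G ?\<beta> ^ 2"
    proof -
      have "measure (P n) B2 \<le> (\<Sum>(i, j, j')\<in>T. measure (P n) {\<omega> \<in> space (P n). ?\<beta> < ?X (?e i j) \<omega> \<and> ?\<beta> < ?X (?e i j') \<omega>})"
        unfolding B2_def split_beta' using finT B2i(1)
        by (intro S.M.finite_measure_subadditive_finite) (auto simp: split_beta')
      also have "\<dots> = (\<Sum>z\<in>T. G ?\<beta> ^ 2)" by (intro sum.cong) (auto simp: B2i(2))
      also have "\<dots> \<le> real (n ^ 3) * G ?\<beta> ^ 2" using cardT by (simp only: sum_constant) (intro mult_right_mono, simp_all)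
      finally show ?thesis by simp
    qed
    have B3i: "{\<omega> \<in> space (P n). ?D / 2 \<le> \<bar>(\<Sum>e\<in>row_edges n i. trunc ?\<beta> (?X e \<omega>)) - real (card (row_edges n i)) * mom 1 ?\<beta>\<bar>} \<in> sets (P n)"
      if "i \<in> ?V" for i
    proof -
      have [measurable]: "(\<lambda>\<omega>. \<Sum>e\<in>row_edges n i. trunc ?\<beta> (?X e \<omega>)) \<in> borel_measurable (P n)"
        using row_edges(1)[OF that] by (intro borel_measurable_sum measurable_compose[OF weight_of_measurable trunc_measurable]) auto
      show ?thesis by measurable
    qed
    have B3s: "B3 \<in> sets (P n)" unfolding B3_def using B3i by (intro sets.finite_UN) auto
    have B3m: "measure (P n) B3 \<le> \<theta> / 2"
    proof -
      have "measure (P n) B3 \<le> (\<Sum>i\<in>?V. measure (P n) {\<omega> \<in> space (P n). ?D / 2 \<le>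
        \<bar>(\<Sum>e\<in>row_edges n i. trunc ?\<beta> (?X e \<omega>)) - real (card (row_edges n i)) * mom 1 ?\<beta>\<bar>})"
        unfolding B3_def using B3i by (intro S.M.finite_measure_subadditive_finite) auto
      also have "\<dots> \<le> (\<Sum>i\<in>?V. real n * mom 2 ?\<beta> / (?D / 2)\<^sup>2)"
      proof (intro sum_mono)
        fix i assume i: "i \<in> ?V"
        show "measure (P n) {\<omega> \<in> space (P n). ?D / 2 \<le>
        \<bar>(\<Sum>e\<in>row_edges n i. trunc ?\<beta> (?X e \<omega>)) - real (card (row_edges n i)) * mom 1 ?\<beta>\<bar>} \<le> real n * mom 2 ?\<beta> / (?D / 2)\<^sup>2"
          using S.truncated_sum_chebyshev[OF row_edges(1)[OF i] \<beta>, of "?D / 2"] \<delta> s by (simp add: row_edges(2))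
      qed
      also have "\<dots> = (real n)\<^sup>2 * (mom 2 ?\<beta> / (?D / 2)\<^sup>2)" by (simp add: power2_eq_square)
      also have "\<dots> \<le> 2 * real (pairs n) * (mom 2 ?\<beta> / (?D / 2)\<^sup>2)"
        by (intro mult_right_mono square_le_pairs divide_nonneg_nonneg mom_nonneg) auto
      also have "\<dots> = 2 * (real (pairs n) * mom 2 ?\<beta>) / (?D / 2)\<^sup>2" by simp
      also have "\<dots> \<le> 2 * (C * \<epsilon> powr (2 - \<alpha>) * scale n powr 2) / (?D / 2)\<^sup>2"
        by (intro divide_right_mono mult_left_mono elim(2)) auto
      also have "\<dots> = 8 * (C * \<epsilon> powr (2 - \<alpha>)) / \<delta>\<^sup>2"
        using s \<delta> by (simp add: power2_eq_square field_simps)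
      finally show ?thesis using \<epsilon>pow by simp
    qed
    have "measure (P n) (B0 \<union> B1 \<union> B2 \<union> B3) \<le> \<theta>"
    proof -
      have "measure (P n) (B0 \<union> B1 \<union> B2 \<union> B3) \<le> measure (P n) (B0 \<union> B1 \<union> B2) + measure (P n) B3"
        using B0 B1s B2s B3s by (intro measure_Un_le) auto
      also have "measure (P n) (B0 \<union> B1 \<union> B2) \<le> measure (P n) (B0 \<union> B1) + measure (P n) B2"
        using B0 B1s B2s by (intro measure_Un_le) auto
      also have "measure (P n) (B0 \<union> B1) \<le> measure (P n) B0 + measure (P n) B1"
        using B0 B1s by (intro measure_Un_le) auto
      finally show ?thesis using B0(2) B1m B2m B3m elim(1) by linarith
    qed
    moreover have "nonneg_weights n \<omega> \<and> heavy_matching n (\<lambda>i j. U n i j \<omega>) ?\<beta> ?D"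
      if w: "\<omega> \<in> space (P n) - (B0 \<union> B1 \<union> B2 \<union> B3)" for \<omega>
    proof
      show nn: "nonneg_weights n \<omega>" using w by (simp add: B0_def)
      show "heavy_matching n (\<lambda>i j. U n i j \<omega>) ?\<beta> ?D"
      proof
        show "U n i j \<omega> = U n j i \<omega>" if "i \<in> ?V" "j \<in> ?V" for i j
          using that by (simp add: U_eq min.commute max.commute)
        show "0 \<le> U n i j \<omega>" if "i \<in> ?V" "j \<in> ?V" for i j using U_nonneg[OF nn that] .
        show "0 \<le> ?\<beta>" by (rule \<beta>)
        show "U n i i \<omega> \<le> ?\<beta>" if "i \<in> ?V" for i
          using that w by (force simp: B1_def U_eq[OF that that] not_less)
        show "\<not> (?\<beta> < U n i j \<omega> \<and> ?\<beta> < U n i j' \<omega>)" if ij: "i \<in> ?V" "j \<in> ?V" "j' \<in> ?V" "j \<noteq> j'" for i j j'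
        proof -
          have "(i, j, j') \<in> T" using ij by (simp add: T_def)
          moreover have "\<omega> \<notin> B2" "\<omega> \<in> space (P n)" using w by auto
          ultimately have "\<not> (?\<beta> < ?X (?e i j) \<omega> \<and> ?\<beta> < ?X (?e i j') \<omega>)" unfolding B2_def by blast
          then show ?thesis using ij by (simp add: U_eq)
        qed
        show "(\<Sum>j=1..n. if U n i j \<omega> \<le> ?\<beta> then U n i j \<omega> else 0) \<le> ?D" if i: "i \<in> ?V" for i
        proof -
          have "(\<Sum>j=1..n. if U n i j \<omega> \<le> ?\<beta> then U n i j \<omega> else 0) = (\<Sum>j=1..n. trunc ?\<beta> (?X (?e i j) \<omega>))"
            using U_nonneg[OF nn i] by (intro sum.cong) (auto simp: U_eq[OF i] trunc_def)
          also have "\<dots> = (\<Sum>e\<in>row_edges n i. trunc ?\<beta> (?X e \<omega>))"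
            unfolding row_edges_def by (subst sum.reindex[OF row_edges(3)]) simp
          finally have eq: "(\<Sum>j=1..n. if U n i j \<omega> \<le> ?\<beta> then U n i j \<omega> else 0) = (\<Sum>e\<in>row_edges n i. trunc ?\<beta> (?X e \<omega>))" .
          have "\<bar>(\<Sum>e\<in>row_edges n i. trunc ?\<beta> (?X e \<omega>)) - real (card (row_edges n i)) * mom 1 ?\<beta>\<bar> < ?D / 2"
            using w i unfolding B3_def by (auto simp: not_le)
          moreover have "real n * mom 1 ?\<beta> \<le> ?D / 2" using elim(3) s by (simp add: field_simps)
          ultimately show ?thesis unfolding eq row_edges(2) abs_less_iff by linarith
        qed
      qed
    qed
    ultimately show ?case using B0 B1s B2s B3s by (intro bexI[of _ "B0 \<union> B1 \<union> B2 \<union> B3"]) auto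
  qed
  with \<epsilon> show ?thesis by blast
qed

lemma exceedances_antimono: "s \<le> t \<Longrightarrow> exceedances n t \<omega> \<le> exceedances n s \<omega>"
  unfolding exceedances_def
  by (rule card_mono) (auto intro: le_less_trans[OF mult_right_mono[OF _ scale_nonneg]])

lemma large_weight_prob:
  assumes t: "0 < t" and \<theta>: "t powr - \<alpha> < \<theta>"
  shows "\<forall>\<^sub>F n in sequentially. {\<omega> \<in> space (P n). \<exists>e\<in>edges n. t * scale n < weight_of n e \<omega>} \<in> sets (P n) \<and>
     measure (P n) {\<omega> \<in> space (P n). \<exists>e\<in>edges n. t * scale n < weight_of n e \<omega>} \<le> \<theta>"
  using order_tendstoD(2)[OF tail_scale[OF t] \<theta>]
proof eventually_elim
  case (elim n)
  interpret S: iid_sample \<alpha> \<L> "P n" "weight_of n" "edges n" by (rule sample)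
  have "{\<omega> \<in> space (P n). \<exists>e\<in>edges n. t * scale n < weight_of n e \<omega>} =
     (\<Union>e\<in>edges n. {\<omega> \<in> space (P n). t * scale n < weight_of n e \<omega>})" by auto
  then show ?case
    using S.prob_exists_exceed[of "edges n" "t * scale n"] elim S.exceed_sets
    by (auto simp: card_edges pairs_def intro!: sets.finite_UN)
qed

text \<open>Since \<epsilon> \<le> \<eta>, every grid level lies above the heaviness threshold,
  where vertex counts are twice edge counts. The hypothesis \<open>top\<close> says that the grid
  reaches past the largest weight.\<close>

lemma ranked_rho_close:
  assumes hm: "heavy_matching n (\<lambda>i j. U n i j \<omega>) (\<epsilon> * scale n) (\<delta> * scale n)"
    and \<epsilon>: "0 < \<epsilon>" "\<epsilon> \<le> \<eta>" and \<delta>: "0 < \<delta>" and s: "0 < scale n" and r: "0 < r"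
    and nn: "nonneg_weights n \<omega>"
    and top: "\<not> (\<exists>e\<in>edges n. (\<eta> * real r) * scale n < weight_of n e \<omega>)"
  shows "\<bar>ranked_vector n (rho n \<omega>) k / scale n - level \<eta> r (exceedance_transform \<eta> n \<omega>) (k div 2)\<bar> \<le> \<eta> + \<delta>"
proof -
  interpret hm: heavy_matching n "\<lambda>i j. U n i j \<omega>" "\<epsilon> * scale n" "\<delta> * scale n" by (rule hm)
  have \<eta>: "0 < \<eta>" using \<epsilon> by simp
  have heavy: "card (hm.heavy (grid \<eta> i * scale n)) = exceedances n (grid \<eta> i) \<omega>" for i
    unfolding exceedances_def by (rule arg_cong[of _ _ card]) (auto simp: hm.heavy_def weight_of_def)
  have ge: "\<epsilon> * scale n \<le> grid \<eta> i * scale n" for i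
  proof -
    have "\<eta> \<le> grid \<eta> i" using \<eta> by (simp add: grid_def)
    then show ?thesis using \<epsilon> s by (intro mult_right_mono) auto
  qed
  have D0: "0 \<le> \<delta> * scale n" using \<delta> s by simp
  show ?thesis
    unfolding exceedance_transform_def
  proof (rule level_close[OF _ r _ _ \<eta>])
    show "exceedances n (grid \<eta> j) \<omega> \<le> exceedances n (grid \<eta> i) \<omega>" if "i \<le> j" for i j
      by (rule exceedances_antimono[OF monoD[OF grid_mono[OF \<eta>] that]])
    have "{e \<in> edges n. grid \<eta> (r - 1) * scale n < weight_of n e \<omega>} = {}" using top r by (auto simp: grid_def)
    then show "exceedances n (grid \<eta> (r - 1)) \<omega> \<le> k div 2"
      by (simp only: exceedances_def card.empty)
    show "0 \<le> ranked_vector n (rho n \<omega>) k / scale n"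
      using s ranked_vector_nonneg[of n "rho n \<omega>" k] rho_nonneg[OF nn] by simp
    show "\<eta> * real (Suc i) \<le> ranked_vector n (rho n \<omega>) k / scale n" if "k div 2 < exceedances n (grid \<eta> i) \<omega>" for i
    proof -
      have "Suc (k div 2) \<le> card (hm.heavy (grid \<eta> i * scale n))" using that unfolding heavy by simp
      from hm.ranked_row_sums(1)[OF ge D0 this] show ?thesis
        using s by (simp add: rho_def grid_def pos_le_divide_eq less_imp_le)
    qed
    show "k div 2 < exceedances n (grid \<eta> i) \<omega>" if "\<eta> * real (Suc i) + \<delta> < ranked_vector n (rho n \<omega>) k / scale n" for i
    proof -
      have "grid \<eta> i * scale n + \<delta> * scale n < ranked_vector n (row_sum n (\<lambda>i j. U n i j \<omega>)) k"
        using that s by (simp add: rho_def grid_def pos_less_divide_eq algebra_simps)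
      from hm.ranked_row_sums(2)[OF ge D0 this] show ?thesis by (simp add: heavy)
    qed
  qed (use \<delta> in simp)
qed

text \<open>Up to the given accuracy, T and T' are the same continuous function of the count
  transforms, with a common mesh. This is what allows them to be joined to the ranked coordinates,
  which are read off the same transforms.\<close>

definition approximable_head :: "(nat \<Rightarrow> 'a \<Rightarrow> real) \<Rightarrow> 'q measure \<Rightarrow> ('q \<Rightarrow> nat \<Rightarrow> real) \<Rightarrow> ('q \<Rightarrow> real) \<Rightarrow> bool" where
  "approximable_head T Q y T' \<longleftrightarrow>
    (\<forall>\<epsilon>>0. \<exists>\<eta>>0. \<eta> \<le> \<epsilon> \<and> (\<forall>r0::nat. \<exists>r\<ge>r0. \<exists>h. continuous_on UNIV h \<and>
       (\<forall>\<^sub>F n in sequentially. \<exists>A\<in>sets (P n). measure (P n) A \<le> \<epsilon> \<and>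
          (\<forall>\<omega>\<in>space (P n) - A. \<bar>T n \<omega> - h (exceedance_transform \<eta> n \<omega>)\<bar> \<le> \<epsilon>)) \<and>
       (\<exists>A\<in>sets Q. measure Q A \<le> \<epsilon> \<and> (\<forall>\<omega>\<in>space Q - A. \<bar>T' \<omega> - h (limit_transform \<eta> y \<omega>)\<bar> \<le> \<epsilon>))))"

definition headed :: "real \<Rightarrow> (nat \<Rightarrow> real) \<Rightarrow> nat \<Rightarrow> real" where
  "headed t v = case_nat t v"

lemma headed_measurable:
  assumes t: "t \<in> borel_measurable M" and v: "\<And>k. (\<lambda>\<omega>. v \<omega> k) \<in> borel_measurable M"
  shows "(\<lambda>\<omega>. headed (t \<omega>) (v \<omega>)) \<in> borel_measurable M"
proof (rule measurable_coordinatewise_then_product)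
  fix k
  show "(\<lambda>\<omega>. headed (t \<omega>) (v \<omega>) k) \<in> borel_measurable M"
    using t v by (cases k) (simp_all add: headed_def)
qed

text \<open>Head and ranked coordinates are images of one transform under one continuous map, so
  their joint convergence costs no more than convergence of the transform.\<close>

lemma joint_convergence:
  fixes Q :: "'q measure" and y :: "'q \<Rightarrow> nat \<Rightarrow> real"
  assumes \<alpha>2: "\<alpha> < 2" and y: "power_law_counts \<alpha> Q y"
    and T: "\<And>n. T n \<in> borel_measurable (P n)" and T': "T' \<in> borel_measurable Q"
    and head: "approximable_head T Q y T'"
  shows "lipschitz_convergence P (\<lambda>n \<omega>. headed (T n \<omega>) (\<lambda>k. ranked_vector n (rho n \<omega>) k / (2 * scale n)))
     Q (\<lambda>\<omega>. headed (T' \<omega>) (half_doubled (y \<omega>)))"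
proof -
  interpret Q: prob_space Q using y by (simp add: power_law_counts_def)
  have ym: "y \<in> borel_measurable Q" and yr: "AE \<omega> in Q. y \<omega> \<in> ranked_seqs"
    using y by (auto simp: power_law_counts_def)
  have yk: "(\<lambda>\<omega>. y \<omega> k) \<in> borel_measurable Q" for k
    by (rule measurable_product_then_coordinatewise[OF ym])
  show ?thesis
  proof (rule lipschitz_convergence_approx[OF prob_P Q.prob_space_axioms])
    show "(\<lambda>\<omega>. headed (T n \<omega>) (\<lambda>k. ranked_vector n (rho n \<omega>) k / (2 * scale n))) \<in> borel_measurable (P n)" for n
      using measurable_product_then_coordinatewise[OF ranked_vector_measurable[OF rho_measurable, of n]]
      by (intro headed_measurable T) simp
    show "(\<lambda>\<omega>. headed (T' \<omega>) (half_doubled (y \<omega>))) \<in> borel_measurable Q"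
      using yk by (intro headed_measurable T') (simp add: half_doubled_def)
    fix \<epsilon>0 :: real assume \<epsilon>0: "0 < \<epsilon>0"
    \<comment> \<open>Three exceptional events of probability \<epsilon> each must fit into
      \<epsilon>0, and a coordinatewise error \<epsilon> becomes a distance of up to 2
      \<epsilon>.\<close>
    define \<epsilon> where "\<epsilon> = \<epsilon>0 / 4"
    have \<epsilon>: "0 < \<epsilon>" using \<epsilon>0 by (simp add: \<epsilon>_def)
    obtain \<eta> where \<eta>: "0 < \<eta>" "\<eta> \<le> \<epsilon>" and rest: "\<And>r0::nat. \<exists>r\<ge>r0. \<exists>h. continuous_on UNIV h \<and>
       (\<forall>\<^sub>F n in sequentially. \<exists>A\<in>sets (P n). measure (P n) A \<le> \<epsilon> \<and>
          (\<forall>\<omega>\<in>space (P n) - A. \<bar>T n \<omega> - h (exceedance_transform \<eta> n \<omega>)\<bar> \<le> \<epsilon>)) \<and>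
       (\<exists>A\<in>sets Q. measure Q A \<le> \<epsilon> \<and> (\<forall>\<omega>\<in>space Q - A. \<bar>T' \<omega> - h (limit_transform \<eta> y \<omega>)\<bar> \<le> \<epsilon>))"
      using head \<epsilon> unfolding approximable_head_def by meson
    have etar: "filterlim (\<lambda>r. \<eta> * real r) at_top sequentially"
      by (rule filterlim_tendsto_pos_mult_at_top[OF tendsto_const \<eta>(1) filterlim_real_sequentially])
    have "(\<lambda>r. (\<eta> * real r) powr - \<alpha>) \<longlonglongrightarrow> 0"
      using \<alpha>_pos by (intro tendsto_neg_powr etar) auto
    then have e1: "\<forall>\<^sub>F r in sequentially. (\<eta> * real r) powr - \<alpha> < \<epsilon>" using \<epsilon> by (rule order_tendstoD)
    obtain r0 where r0: "\<And>r. r0 \<le> r \<Longrightarrow> (\<eta> * real r) powr - \<alpha> < \<epsilon> \<and>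
        Q.prob {\<omega> \<in> space Q. \<eta> * real r < y \<omega> 0} \<le> \<epsilon>"
      using eventually_conj[OF e1 limit_top[OF y \<eta>(1) \<epsilon>]] by (auto simp: eventually_sequentially)
    obtain r h where r: "max r0 1 \<le> r" and h: "continuous_on UNIV h"
      and hP: "\<forall>\<^sub>F n in sequentially. \<exists>A\<in>sets (P n). measure (P n) A \<le> \<epsilon> \<and>
          (\<forall>\<omega>\<in>space (P n) - A. \<bar>T n \<omega> - h (exceedance_transform \<eta> n \<omega>)\<bar> \<le> \<epsilon>)"
      and hQ: "\<exists>A\<in>sets Q. measure Q A \<le> \<epsilon> \<and> (\<forall>\<omega>\<in>space Q - A. \<bar>T' \<omega> - h (limit_transform \<eta> y \<omega>)\<bar> \<le> \<epsilon>)"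
      using rest[of "max r0 1"] by blast
    have rpos: "0 < r" and \<eta>r: "0 < \<eta> * real r" using r \<eta> by auto
    define \<Phi> where "\<Phi> \<xi> = headed (h \<xi>) (half_doubled (level \<eta> r \<xi>))" for \<xi>
    have \<Phi>: "continuous_on UNIV \<Phi>"
    proof (rule continuous_on_coordinatewise_then_product)
      fix k
      show "continuous_on UNIV (\<lambda>\<xi>. \<Phi> \<xi> k)"
        using h by (cases k) (auto simp: \<Phi>_def headed_def half_doubled_def intro!: continuous_on_divide level_continuous continuous_on_const)
    qed
    have \<Phi>m: "\<Phi> \<in> borel_measurable borel" by (rule borel_measurable_continuous_onI[OF \<Phi>])
    have close: "dist (headed t v) (\<Phi> \<xi>) \<le> \<epsilon>0"
      if "\<bar>t - h \<xi>\<bar> \<le> \<epsilon>" "\<And>k. \<bar>v k - level \<eta> r \<xi> (k div 2) / 2\<bar> \<le> \<epsilon>" for t v \<xi>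
    proof -
      have "\<bar>headed t v k - \<Phi> \<xi> k\<bar> \<le> \<epsilon>" for k
        using that by (cases k) (auto simp: \<Phi>_def headed_def half_doubled_def)
      from dist_fun_le[of "headed t v" "\<Phi> \<xi>" \<epsilon>, OF this] show ?thesis using \<epsilon>0 by (simp add: \<epsilon>_def)
    qed
    obtain \<epsilon>' where \<epsilon>': "0 < \<epsilon>'" "\<epsilon>' \<le> \<eta>" and good: "\<forall>\<^sub>F n in sequentially. \<exists>Bad\<in>sets (P n). measure (P n) Bad \<le> \<epsilon> \<and>
     (\<forall>\<omega>\<in>space (P n) - Bad. nonneg_weights n \<omega> \<and>
        heavy_matching n (\<lambda>i j. U n i j \<omega>) (\<epsilon>' * scale n) (\<epsilon> * scale n))"
      using good_event[OF \<alpha>2 \<epsilon> \<epsilon> \<eta>(1)] by blast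
    have top: "\<forall>\<^sub>F n in sequentially. {\<omega> \<in> space (P n). \<exists>e\<in>edges n. (\<eta> * real r) * scale n < weight_of n e \<omega>} \<in> sets (P n) \<and>
     measure (P n) {\<omega> \<in> space (P n). \<exists>e\<in>edges n. (\<eta> * real r) * scale n < weight_of n e \<omega>} \<le> \<epsilon>"
      using r0[of r] r by (intro large_weight_prob \<eta>r) auto
    have P_close: "\<forall>\<^sub>F n in sequentially. close_except (P n) \<epsilon>0
       (\<lambda>\<omega>. headed (T n \<omega>) (\<lambda>k. ranked_vector n (rho n \<omega>) k / (2 * scale n))) (\<lambda>\<omega>. \<Phi> (exceedance_transform \<eta> n \<omega>))"
      using hP good top scale_pos
    proof eventually_elim
      case (elim n)
      obtain A where A: "A \<in> sets (P n)" "measure (P n) A \<le> \<epsilon>"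
        "\<And>\<omega>. \<omega> \<in> space (P n) - A \<Longrightarrow> \<bar>T n \<omega> - h (exceedance_transform \<eta> n \<omega>)\<bar> \<le> \<epsilon>" using elim(1) by blast
      obtain B where B: "B \<in> sets (P n)" "measure (P n) B \<le> \<epsilon>"
        "\<And>\<omega>. \<omega> \<in> space (P n) - B \<Longrightarrow> nonneg_weights n \<omega>"
        "\<And>\<omega>. \<omega> \<in> space (P n) - B \<Longrightarrow> heavy_matching n (\<lambda>i j. U n i j \<omega>) (\<epsilon>' * scale n) (\<epsilon> * scale n)"
        using elim(2) by blast
      let ?M = "{\<omega> \<in> space (P n). \<exists>e\<in>edges n. (\<eta> * real r) * scale n < weight_of n e \<omega>}"
      have M: "?M \<in> sets (P n)" "measure (P n) ?M \<le> \<epsilon>" using elim(3) by auto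
      have "measure (P n) (A \<union> B \<union> ?M) \<le> measure (P n) (A \<union> B) + measure (P n) ?M"
        using A B M by (intro measure_Un_le) auto
      also have "measure (P n) (A \<union> B) \<le> measure (P n) A + measure (P n) B"
        using A B by (intro measure_Un_le) auto
      finally have m: "measure (P n) (A \<union> B \<union> ?M) \<le> \<epsilon>0" using A(2) B(2) M(2) \<epsilon>0 by (simp add: \<epsilon>_def)
      have "dist (headed (T n \<omega>) (\<lambda>k. ranked_vector n (rho n \<omega>) k / (2 * scale n))) (\<Phi> (exceedance_transform \<eta> n \<omega>)) \<le> \<epsilon>0"
        if w: "\<omega> \<in> space (P n) - (A \<union> B \<union> ?M)" for \<omega>
      proof (rule close)
        show "\<bar>T n \<omega> - h (exceedance_transform \<eta> n \<omega>)\<bar> \<le> \<epsilon>" using A(3) w by auto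
        fix k
        have "\<bar>ranked_vector n (rho n \<omega>) k / scale n - level \<eta> r (exceedance_transform \<eta> n \<omega>) (k div 2)\<bar> \<le> \<eta> + \<epsilon>"
          by (rule ranked_rho_close[OF B(4) \<epsilon>' \<epsilon> elim(4) rpos B(3)]) (use w in auto)
        \<comment> \<open>Division by 2 turns the error \<eta> + \<epsilon> into at most \<epsilon>,
          since \<eta> \<le> \<epsilon>.\<close>
        then show "\<bar>ranked_vector n (rho n \<omega>) k / (2 * scale n) - level \<eta> r (exceedance_transform \<eta> n \<omega>) (k div 2) / 2\<bar> \<le> \<epsilon>"
          using \<eta>(2) by (simp add: abs_le_iff field_simps)
      qed
      then show ?case unfolding close_except_def using A B M m by (intro bexI[of _ "A \<union> B \<union> ?M"]) auto
    qed
    have Q_close: "close_except Q \<epsilon>0 (\<lambda>\<omega>. headed (T' \<omega>) (half_doubled (y \<omega>))) (\<lambda>\<omega>. \<Phi> (limit_transform \<eta> y \<omega>))"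
    proof -
      obtain A where A: "A \<in> sets Q" "measure Q A \<le> \<epsilon>"
        "\<And>\<omega>. \<omega> \<in> space Q - A \<Longrightarrow> \<bar>T' \<omega> - h (limit_transform \<eta> y \<omega>)\<bar> \<le> \<epsilon>" using hQ by blast
      let ?M = "{\<omega> \<in> space Q. \<eta> * real r < y \<omega> 0}"
      let ?N = "{\<omega> \<in> space Q. y \<omega> \<notin> ranked_seqs}"
      have [measurable]: "(\<lambda>\<omega>. y \<omega> 0) \<in> borel_measurable Q" by (rule yk)
      have M: "?M \<in> sets Q" by measurable
      have M2: "measure Q ?M \<le> \<epsilon>" using r0[of r] r by (auto simp: less_imp_le)
      have N: "?N \<in> sets Q" using ym ranked_seqs_borel by measurable
      have N0: "measure Q ?N = 0"
        using yr AE_iff_measurable[OF N, of "\<lambda>\<omega>. y \<omega> \<in> ranked_seqs"] by (simp add: measure_def)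
      have "measure Q (A \<union> ?M \<union> ?N) \<le> measure Q (A \<union> ?M) + measure Q ?N"
        using A M N by (intro measure_Un_le) auto
      also have "measure Q (A \<union> ?M) \<le> measure Q A + measure Q ?M"
        using A M by (intro measure_Un_le) auto
      finally have m: "measure Q (A \<union> ?M \<union> ?N) \<le> \<epsilon>0" using A(2) M2 N0 \<epsilon>0 by (simp add: \<epsilon>_def)
      have "dist (headed (T' \<omega>) (half_doubled (y \<omega>))) (\<Phi> (limit_transform \<eta> y \<omega>)) \<le> \<epsilon>0"
        if w: "\<omega> \<in> space Q - (A \<union> ?M \<union> ?N)" for \<omega>
      proof (rule close)
        show "\<bar>T' \<omega> - h (limit_transform \<eta> y \<omega>)\<bar> \<le> \<epsilon>" using A(3) w by auto
        fix k
        have "y \<omega> 0 \<le> \<eta> * real r" using w by auto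
        then have "\<bar>y \<omega> (k div 2) - level \<eta> r (limit_transform \<eta> y \<omega>) (k div 2)\<bar> \<le> \<eta>"
          unfolding limit_transform_def using w by (intro level_close_limit \<eta> rpos) auto
        then show "\<bar>half_doubled (y \<omega>) k - level \<eta> r (limit_transform \<eta> y \<omega>) (k div 2) / 2\<bar> \<le> \<epsilon>"
          using \<eta>(2) \<epsilon> by (simp add: half_doubled_def abs_le_iff field_simps)
      qed
      then show ?thesis unfolding close_except_def using A M N m by (intro bexI[of _ "A \<union> ?M \<union> ?N"]) auto
    qed
    show "\<exists>Z Y'. (\<forall>n. Z n \<in> borel_measurable (P n)) \<and> Y' \<in> borel_measurable Q \<and> lipschitz_convergence P Z Q Y' \<and>
       (\<forall>\<^sub>F n in sequentially. close_except (P n) \<epsilon>0 (\<lambda>\<omega>. headed (T n \<omega>) (\<lambda>k. ranked_vector n (rho n \<omega>) k / (2 * scale n))) (Z n)) \<and>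
       close_except Q \<epsilon>0 (\<lambda>\<omega>. headed (T' \<omega>) (half_doubled (y \<omega>))) Y'"
      by (intro exI[of _ "\<lambda>n \<omega>. \<Phi> (exceedance_transform \<eta> n \<omega>)"] exI[of _ "\<lambda>\<omega>. \<Phi> (limit_transform \<eta> y \<omega>)"] conjI allI
          measurable_compose[OF exceedance_transform_measurable \<Phi>m] measurable_compose[OF limit_transform_measurable[OF y \<eta>(1)] \<Phi>m]
          transform_convergence[OF y \<eta>(1) \<Phi>] P_close Q_close)
  qed
qed

end

section \<open>The invariant probability vector\<close>

lemma ranked_seqs_scale:
  assumes "v \<in> ranked_seqs" "0 \<le> c"
  shows "(\<lambda>k. c * v k) \<in> ranked_seqs"
  using assms tendsto_mult_right_zero[of v sequentially c]
  by (auto simp: ranked_seqs_def antimono_def intro!: mult_left_mono)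

lemma ranked_seqs_half_doubled:
  assumes v: "v \<in> ranked_seqs"
  shows "half_doubled v \<in> ranked_seqs"
proof -
  have "filterlim (\<lambda>k. k div 2 :: nat) at_top sequentially"
    unfolding filterlim_at_top
  proof
    fix Z :: nat
    show "\<forall>\<^sub>F k in sequentially. Z \<le> k div 2"
      unfolding eventually_sequentially by (intro exI[of _ "2 * Z"]) auto
  qed
  moreover have "v \<longlonglongrightarrow> 0" using v by (simp add: ranked_seqs_def)
  ultimately have "(\<lambda>k. v (k div 2)) \<longlonglongrightarrow> 0" by (rule filterlim_compose[rotated])
  then have "(\<lambda>k. v (k div 2) / 2) \<longlonglongrightarrow> 0 / 2" by (intro tendsto_divide tendsto_const) simp_all
  moreover have "antimono v" and "\<And>k. 0 \<le> v k" using v by (simp_all add: ranked_seqs_def)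
  ultimately show ?thesis
    unfolding ranked_seqs_def half_doubled_def[abs_def]
    by (simp add: monotone_def div_le_mono)
qed

lemma half_doubled_measurable: "half_doubled \<in> borel_measurable borel"
proof (rule measurable_coordinatewise_then_product)
  fix k
  have "(\<lambda>v::nat \<Rightarrow> real. v (k div 2)) \<in> borel_measurable borel"
    by (rule borel_measurable_continuous_onI[OF continuous_on_product_coordinates])
  then show "(\<lambda>v. half_doubled v k) \<in> borel_measurable borel"
    unfolding half_doubled_def by (rule borel_measurable_divide) simp
qed

text \<open>A natural-number-valued count is tight.\<close>

lemma tail_count_exceeds_prob:
  assumes y: "power_law_counts \<alpha> Q y" and t: "0 < t" and \<theta>: "0 < \<theta>"
  shows "\<forall>\<^sub>F K in sequentially. {\<omega> \<in> space Q. K < tail_count (y \<omega>) t} \<in> sets Q \<and>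
    measure Q {\<omega> \<in> space Q. K < tail_count (y \<omega>) t} \<le> \<theta>"
proof -
  interpret Q: prob_space Q using y by (simp add: power_law_counts_def)
  have [measurable]: "(\<lambda>\<omega>. exp (- real (tail_count (y \<omega>) t))) \<in> borel_measurable Q"
    by (rule tail_count_measurable) (use y t in \<open>auto simp: power_law_counts_def\<close>)
  define f where "f K \<omega> = (if exp (- real K) \<le> exp (- real (tail_count (y \<omega>) t)) then 0 else 1 :: real)" for K \<omega>
  have [measurable]: "f K \<in> borel_measurable Q" for K unfolding f_def by measurable
  have eq: "{\<omega> \<in> space Q. K < tail_count (y \<omega>) t} = {\<omega> \<in> space Q. 1/2 < f K \<omega>}" for K
    by (auto simp: f_def)
  have "(\<lambda>K. Q.prob {\<omega> \<in> space Q. 1/2 < f K \<omega>}) \<longlonglongrightarrow> 0"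
  proof (rule Q.prob_tendsto_0)
    show "AE \<omega> in Q. (\<lambda>K. f K \<omega>) \<longlonglongrightarrow> 0"
    proof (rule AE_I2)
      fix \<omega>
      have "f K \<omega> = 0" if "tail_count (y \<omega>) t \<le> K" for K using that by (simp add: f_def)
      then show "(\<lambda>K. f K \<omega>) \<longlonglongrightarrow> 0"
        by (intro tendsto_eventually) (auto simp: eventually_sequentially)
    qed
  qed simp_all
  then have "\<forall>\<^sub>F K in sequentially. Q.prob {\<omega> \<in> space Q. 1/2 < f K \<omega>} < \<theta>" using \<theta> by (rule order_tendstoD)
  then show ?thesis unfolding eq by eventually_elim simp
qed

text \<open>Tannery's theorem: each term is at most 1 / (j + 1), and the terms are dominated by the
  summable y.\<close>

lemma small_terms_tendsto:
  fixes y :: "nat \<Rightarrow> real"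
  assumes nn: "\<And>k. 0 \<le> y k" and s: "summable y"
  shows "(\<lambda>j. \<Sum>k. if y k \<le> 1 / real (Suc j) then y k else 0) \<longlonglongrightarrow> 0"
proof -
  have lim: "((\<lambda>j. if y k \<le> 1 / real (Suc j) then y k else 0) \<longlongrightarrow> 0) sequentially" for k
  proof (rule tendsto_sandwich[OF _ _ tendsto_const LIMSEQ_inverse_real_of_nat])
    show "\<forall>\<^sub>F j in sequentially. 0 \<le> (if y k \<le> 1 / real (Suc j) then y k else 0)" using nn by simp
    show "\<forall>\<^sub>F j in sequentially. (if y k \<le> 1 / real (Suc j) then y k else 0) \<le> inverse (real (Suc j))"
      by (auto simp: inverse_eq_divide intro!: always_eventually)
  qed
  have "(\<forall>\<^sub>F j in sequentially. summable (\<lambda>k. norm (if y k \<le> 1 / real (Suc j) then y k else 0))) \<and>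
     summable (\<lambda>k. norm (0::real)) \<and>
     ((\<lambda>j. \<Sum>k. if y k \<le> 1 / real (Suc j) then y k else 0) \<longlongrightarrow> (\<Sum>k. 0)) sequentially"
    by (rule tannerys_theorem[where M=y]) (use lim s nn in \<open>auto intro!: always_eventually\<close>)
  then show ?thesis by simp
qed

context graph_sample
begin

lemma sum_weights_le_total:
  assumes "nonneg_weights n \<omega>"
  shows "(\<Sum>e\<in>edges n. weight_of n e \<omega>) \<le> total n \<omega>"
proof -
  have "(\<Sum>e\<in>(\<lambda>i. (i, i)) ` {1..n}. weight_of n e \<omega>) \<le> (\<Sum>e\<in>edges n. weight_of n e \<omega>)"
    by (rule sum_mono2[OF finite_edges]) (use assms in \<open>auto simp: nonneg_weights_def edges_def\<close>)
  then show ?thesis by (simp add: total_eq)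
qed

text \<open>With nonnegative weights a total of at most 0 forces every edge weight to vanish. That
  has probability at most (1 - G 0)^m, and G 0 is positive.\<close>

lemma total_nonpos_prob: "(\<lambda>n. measure (P n) {\<omega> \<in> space (P n). total n \<omega> \<le> 0}) \<longlonglongrightarrow> 0"
proof -
  have nm: "norm (1 - G 0) < 1"
    using G_pos[of 0] prob_le_1[of "{0<..}"] unfolding tail_def real_norm_def abs_less_iff by linarith
  have lim: "(\<lambda>n. (1 - G 0) ^ pairs n) \<longlonglongrightarrow> 0"
    by (rule filterlim_compose[OF LIMSEQ_power_zero[OF nm] pairs_at_top])
  show ?thesis
  proof (rule tendsto_sandwich[OF _ _ tendsto_const lim])
    show "\<forall>\<^sub>F n in sequentially. measure (P n) {\<omega> \<in> space (P n). total n \<omega> \<le> 0} \<le> (1 - G 0) ^ pairs n"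
    proof (rule always_eventually, rule allI)
      fix n
      interpret S: iid_sample \<alpha> \<L> "P n" "weight_of n" "edges n" by (rule sample)
      \<comment> \<open>The indicator of the half-line rather than of the point 0, so that its mean
        is the distribution function at 0, that is 1 - G 0.\<close>
      let ?w = "indicator {..0} :: real \<Rightarrow> real"
      have prodm: "(\<lambda>\<omega>. \<Prod>e\<in>edges n. ?w (weight_of n e \<omega>)) \<in> borel_measurable (P n)"
        by (intro borel_measurable_prod measurable_compose[OF weight_of_measurable]) auto
      have "measure (P n) {\<omega> \<in> space (P n). total n \<omega> \<le> 0} = (LINT \<omega>|P n. indicator {\<omega> \<in> space (P n). total n \<omega> \<le> 0} \<omega>)"
        by simp
      also have "\<dots> \<le> (LINT \<omega>|P n. (\<Prod>e\<in>edges n. ?w (weight_of n e \<omega>)))"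
      proof (rule integral_mono_AE)
        show "integrable (P n) (\<lambda>\<omega>. indicator {\<omega> \<in> space (P n). total n \<omega> \<le> 0} \<omega> :: real)"
          by (intro integrable_real_indicator) (auto simp: less_top[symmetric])
        show "integrable (P n) (\<lambda>\<omega>. \<Prod>e\<in>edges n. ?w (weight_of n e \<omega>))"
          by (rule S.M.integrable_const_bound[of _ 1])
            (use prodm in \<open>auto simp: abs_prod indicator_def intro!: prod_le_1 AE_I2\<close>)
        show "AE \<omega> in P n. indicator {\<omega> \<in> space (P n). total n \<omega> \<le> 0} \<omega> \<le> (\<Prod>e\<in>edges n. ?w (weight_of n e \<omega>))"
          using nonneg_weights_AE
        proof eventually_elim
          case (elim \<omega>)
          show ?case
          proof (cases "total n \<omega> \<le> 0")
            case True
            then have "(\<Sum>e\<in>edges n. weight_of n e \<omega>) \<le> 0" using sum_weights_le_total[OF elim] by linarith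
            then have "(\<Sum>e\<in>edges n. weight_of n e \<omega>) = 0"
              using elim by (intro antisym sum_nonneg) (auto simp: nonneg_weights_def)
            then have "\<forall>e\<in>edges n. weight_of n e \<omega> = 0"
              using elim by (subst (asm) sum_nonneg_eq_0_iff) (auto simp: nonneg_weights_def)
            then have "(\<Prod>e\<in>edges n. ?w (weight_of n e \<omega>)) = 1" by (intro prod.neutral) auto
            then show ?thesis by (simp add: indicator_def)
          next
            case False
            then show ?thesis by (auto intro!: prod_nonneg)
          qed
        qed
      qed
      also have "\<dots> = (LINT x|\<L>. ?w x) ^ card (edges n)" by (rule S.generating_function) auto
      also have "(LINT x|\<L>. ?w x) = 1 - G 0" by (simp add: G_cdf cdf_def)
      finally show "measure (P n) {\<omega> \<in> space (P n). total n \<omega> \<le> 0} \<le> (1 - G 0) ^ pairs n"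
        by (simp add: card_edges pairs_def)
    qed
  qed (auto intro!: always_eventually)
qed

definition quotient_by_head :: "(nat \<Rightarrow> real) \<Rightarrow> nat \<Rightarrow> real" where
  "quotient_by_head v k = v (Suc k) / v 0"

lemma quotient_by_head_continuous: "continuous_on {v. 0 < v 0} quotient_by_head"
  unfolding quotient_by_head_def
  by (intro continuous_on_coordinatewise_then_product continuous_on_divide
      continuous_on_subset[OF continuous_on_product_coordinates]) auto

text \<open>Where the total is positive, dividing the ranked sums over 2 scale by the total over 2 c
  gives c / scale times the ranked invariant vector. The remaining event, on which
  \<open>rhat\<close> is arbitrary, has vanishing probability. The relation for s is asked only
  eventually, as the scale may be 0 for small n.\<close>

theorem invariant_vector_convergence:
  fixes Q :: "'q measure" and y :: "'q \<Rightarrow> nat \<Rightarrow> real"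
  assumes \<alpha>2: "\<alpha> < 2" and y: "power_law_counts \<alpha> Q y"
    and T': "T' \<in> borel_measurable Q" "AE \<omega> in Q. 0 < T' \<omega>"
    and c: "\<forall>\<^sub>F n in sequentially. 0 < c n"
    and head: "approximable_head (\<lambda>n \<omega>. total n \<omega> / (2 * c n)) Q y T'"
    and rhat: "\<And>n i. i \<in> {1..n} \<Longrightarrow> (\<lambda>\<omega>. rhat n \<omega> i) \<in> borel_measurable (P n)"
      "\<And>n \<omega>. \<omega> \<in> space (P n) \<Longrightarrow> invariant_vector n (\<lambda>i j. U n i j \<omega>) (rhat n \<omega>)"
    and s: "\<And>n. 0 \<le> s n" "\<forall>\<^sub>F n in sequentially. s n = c n / scale n"
  shows "converges_in_distribution_on ranked_seqs P (\<lambda>n \<omega> k. s n * ranked_vector n (rhat n \<omega>) k)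
     Q (\<lambda>\<omega> k. half_doubled (y \<omega>) k / T' \<omega>)"
proof -
  interpret Q: prob_space Q using y by (simp add: power_law_counts_def)
  let ?X = "\<lambda>n \<omega> k. s n * ranked_vector n (rhat n \<omega>) k" and ?Y = "\<lambda>\<omega> k. half_doubled (y \<omega>) k / T' \<omega>"
  have ym: "y \<in> borel_measurable Q" and yr: "AE \<omega> in Q. y \<omega> \<in> ranked_seqs"
    using y by (auto simp: power_law_counts_def)
  have rhat_eq: "rhat n \<omega> i = rho n \<omega> i / total n \<omega>"
    if "\<omega> \<in> space (P n)" "total n \<omega> \<noteq> 0" "i \<in> {1..n}" for n \<omega> i
    using rhat(2)[OF that(1)] that(2,3) by (simp add: invariant_vector_def total_def rho_def)
  have rhat_nonneg: "0 \<le> rhat n \<omega> i"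
    if "\<omega> \<in> space (P n)" "nonneg_weights n \<omega>" "i \<in> {1..n}" for n \<omega> i
  proof (cases "total n \<omega> = 0")
    case True
    then show ?thesis using rhat(2)[OF that(1)] that(3) by (simp add: invariant_vector_def total_def rho_def)
  next
    case False
    then show ?thesis using rhat_eq[OF that(1) False that(3)] rho_nonneg[OF that(2,3)] total_nonneg[OF that(2)] by simp
  qed
  have Xm: "?X n \<in> borel_measurable (P n)" for n
    using measurable_product_then_coordinatewise[OF ranked_vector_measurable[OF rhat(1), of n]]
    by (intro measurable_coordinatewise_then_product borel_measurable_times borel_measurable_const) simp
  have XS: "AE \<omega> in P n. ?X n \<omega> \<in> ranked_seqs" for n
    using nonneg_weights_AE[of n] AE_space
    by eventually_elim (intro ranked_seqs_scale ranked_vector_in_ranked_seqs rhat_nonneg s(1))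
  have yk: "(\<lambda>\<omega>. half_doubled (y \<omega>) k) \<in> borel_measurable Q" for k
    using measurable_product_then_coordinatewise[OF measurable_compose[OF ym half_doubled_measurable]] by simp
  have Ym: "?Y \<in> borel_measurable Q"
    by (intro measurable_coordinatewise_then_product borel_measurable_divide yk T'(1))
  have YS: "AE \<omega> in Q. ?Y \<omega> \<in> ranked_seqs"
    using yr T'(2)
  proof eventually_elim
    case (elim \<omega>)
    from ranked_seqs_scale[OF ranked_seqs_half_doubled[OF elim(1)], of "1 / T' \<omega>"] elim(2)
    show ?case by simp
  qed
  let ?T = "\<lambda>n \<omega>. total n \<omega> / (2 * c n)"
  let ?R = "\<lambda>n \<omega>. headed (?T n \<omega>) (\<lambda>k. ranked_vector n (rho n \<omega>) k / (2 * scale n))"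
  let ?R' = "\<lambda>\<omega>. headed (T' \<omega>) (half_doubled (y \<omega>))"
  let ?D = "{v::nat \<Rightarrow> real. 0 < v 0}"
  have Tm: "?T n \<in> borel_measurable (P n)" for n by measurable
  have joint: "lipschitz_convergence P ?R Q ?R'"
    by (rule joint_convergence[OF \<alpha>2 y Tm T'(1) head])
  have Rm: "?R n \<in> borel_measurable (P n)" for n
    using measurable_product_then_coordinatewise[OF ranked_vector_measurable[OF rho_measurable, of n]]
    by (intro headed_measurable Tm) simp
  have R'm: "?R' \<in> borel_measurable Q"
    by (intro headed_measurable T'(1) yk)
  have D: "?D \<in> sets borel"
    by (intro borel_open open_Collect_less continuous_on_const continuous_on_product_coordinates)
  have R'D: "AE \<omega> in Q. ?R' \<omega> \<in> ?D" using T'(2) by eventually_elim (simp add: headed_def)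
  have RD: "(\<lambda>n. measure (P n) {\<omega> \<in> space (P n). ?R n \<omega> \<notin> ?D}) \<longlonglongrightarrow> 0"
  proof (rule Lim_transform_eventually[OF total_nonpos_prob])
    show "\<forall>\<^sub>F n in sequentially. measure (P n) {\<omega> \<in> space (P n). total n \<omega> \<le> 0} = measure (P n) {\<omega> \<in> space (P n). ?R n \<omega> \<notin> ?D}"
      using c by eventually_elim (auto simp: headed_def not_less divide_le_0_iff intro!: arg_cong2[where f=measure])
  qed
  \<comment> \<open>The inf-convolution result serves twice: here for the open set on which division
    is continuous, and afterwards for test functions that are continuous only on
    \<open>ranked_seqs\<close>.\<close>
  have "lipschitz_convergence P ?X Q ?Y"
    unfolding lipschitz_convergence_def
  proof (intro allI impI)
    fix g :: "(nat \<Rightarrow> real) \<Rightarrow> real" and B L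
    assume B: "\<forall>x. \<bar>g x\<bar> \<le> B" and L: "\<forall>x z. \<bar>g x - g z\<bar> \<le> L * dist x z"
    have B0: "0 \<le> B" using B by (meson abs_ge_zero order_trans)
    have gc: "continuous_on UNIV g" by (rule lipschitz_imp_continuous) (use L in blast)
    have gm: "g \<in> borel_measurable borel" by (rule borel_measurable_continuous_onI[OF gc])
    define F where "F v = g (quotient_by_head v)" for v
    have Fc: "continuous_on ?D F"
      unfolding F_def by (rule continuous_on_compose2[OF gc quotient_by_head_continuous]) simp
    have main: "(\<lambda>n. LINT \<omega>|P n. indicator ?D (?R n \<omega>) * F (?R n \<omega>)) \<longlonglongrightarrow> (LINT \<omega>|Q. indicator ?D (?R' \<omega>) * F (?R' \<omega>))"
      by (rule lipschitz_convergence_imp_continuous[OF joint prob_P Q.prob_space_axioms Rm R'm D R'D RD Fc, of B])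
        (use B in \<open>simp add: F_def\<close>)
    have FDm: "(\<lambda>v. indicator ?D v * F v) \<in> borel_measurable borel" by (rule indicator_mult_borel_measurable[OF D Fc])
    have eqQ: "(LINT \<omega>|Q. indicator ?D (?R' \<omega>) * F (?R' \<omega>)) = (LINT \<omega>|Q. g (?Y \<omega>))"
    proof (rule integral_cong_AE)
      show "AE \<omega> in Q. indicator ?D (?R' \<omega>) * F (?R' \<omega>) = g (?Y \<omega>)"
        using R'D by eventually_elim (simp add: F_def quotient_by_head_def[abs_def] headed_def)
    qed (intro measurable_compose[OF R'm FDm] measurable_compose[OF Ym gm])+
    have diff: "(\<lambda>n. (LINT \<omega>|P n. g (?X n \<omega>)) - (LINT \<omega>|P n. indicator ?D (?R n \<omega>) * F (?R n \<omega>))) \<longlonglongrightarrow> 0"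
    proof (rule Lim_null_comparison)
      show "(\<lambda>n. B * measure (P n) {\<omega> \<in> space (P n). total n \<omega> \<le> 0}) \<longlonglongrightarrow> 0"
        by (rule tendsto_mult_right_zero[OF total_nonpos_prob])
      show "\<forall>\<^sub>F n in sequentially. norm ((LINT \<omega>|P n. g (?X n \<omega>)) - (LINT \<omega>|P n. indicator ?D (?R n \<omega>) * F (?R n \<omega>)))
         \<le> B * measure (P n) {\<omega> \<in> space (P n). total n \<omega> \<le> 0}"
        using c s(2) scale_pos
      proof eventually_elim
        case (elim n)
        interpret M: prob_space "P n" by (rule prob_P)
        have i1: "integrable (P n) (\<lambda>\<omega>. g (?X n \<omega>))"
          by (rule M.integrable_const_bound[of _ B]) (use B measurable_compose[OF Xm gm] in auto)
        have i2: "integrable (P n) (\<lambda>\<omega>. indicator ?D (?R n \<omega>) * F (?R n \<omega>))"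
          by (rule M.integrable_const_bound[of _ B])
            (use B B0 measurable_compose[OF Rm FDm] in \<open>auto simp: F_def indicator_def\<close>)
        have "norm ((LINT \<omega>|P n. g (?X n \<omega>)) - (LINT \<omega>|P n. indicator ?D (?R n \<omega>) * F (?R n \<omega>))) =
          norm (LINT \<omega>|P n. g (?X n \<omega>) - indicator ?D (?R n \<omega>) * F (?R n \<omega>))"
          by (subst Bochner_Integration.integral_diff[OF i1 i2]) simp
        also have "\<dots> \<le> (LINT \<omega>|P n. norm (g (?X n \<omega>) - indicator ?D (?R n \<omega>) * F (?R n \<omega>)))"
          by (rule integral_norm_bound)
        also have "\<dots> \<le> (LINT \<omega>|P n. B * indicator {\<omega> \<in> space (P n). total n \<omega> \<le> 0} \<omega>)"
        proof (rule integral_mono_AE)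
          show "integrable (P n) (\<lambda>\<omega>. norm (g (?X n \<omega>) - indicator ?D (?R n \<omega>) * F (?R n \<omega>)))"
            by (intro integrable_norm Bochner_Integration.integrable_diff i1 i2)
          show "integrable (P n) (\<lambda>\<omega>. B * indicator {\<omega> \<in> space (P n). total n \<omega> \<le> 0} \<omega>)"
            by (intro integrable_mult_right integrable_real_indicator) (auto simp: less_top[symmetric])
          show "AE \<omega> in P n. norm (g (?X n \<omega>) - indicator ?D (?R n \<omega>) * F (?R n \<omega>)) \<le> B * indicator {\<omega> \<in> space (P n). total n \<omega> \<le> 0} \<omega>"
            using nonneg_weights_AE[of n] AE_space
          proof eventually_elim
            fix \<omega> assume nn: "nonneg_weights n \<omega>" and w: "\<omega> \<in> space (P n)"
            show "norm (g (?X n \<omega>) - indicator ?D (?R n \<omega>) * F (?R n \<omega>)) \<le> B * indicator {\<omega> \<in> space (P n). total n \<omega> \<le> 0} \<omega>"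
            proof (cases "total n \<omega> \<le> 0")
              case True
              then have "?R n \<omega> \<notin> ?D" using elim(1) by (simp add: headed_def not_less divide_le_0_iff)
              then show ?thesis using True w B by simp
            next
              case False
              then have t: "0 < total n \<omega>" by simp
              have inD: "?R n \<omega> \<in> ?D" using t elim(1) by (simp add: headed_def)
              have "ranked_vector n (rhat n \<omega>) k = (1 / total n \<omega>) * ranked_vector n (rho n \<omega>) k" for k
                by (rule ranked_vector_scale) (use t rho_nonneg[OF nn] rhat_eq[OF w] in auto)
              then have "?X n \<omega> = quotient_by_head (?R n \<omega>)"
                using elim t by (auto simp: quotient_by_head_def headed_def fun_eq_iff field_simps)
              then show ?thesis using inD False by (simp add: F_def)
            qed
          qed
        qed
        also have "\<dots> = B * measure (P n) {\<omega> \<in> space (P n). total n \<omega> \<le> 0}" by simp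
        finally show ?case .
      qed
    qed
    from Lim_transform[OF main diff]
    show "(\<lambda>n. LINT \<omega>|P n. g (?X n \<omega>)) \<longlonglongrightarrow> (LINT \<omega>|Q. g (?Y \<omega>))"
      unfolding eqQ .
  qed
  note conv = this
  show ?thesis
    unfolding converges_in_distribution_on_def
  proof (intro conjI allI impI Xm XS Ym YS)
    fix f :: "(nat \<Rightarrow> real) \<Rightarrow> real" assume f: "continuous_on ranked_seqs f" and "bounded (f ` ranked_seqs)"
    then obtain B where B: "\<And>x. x \<in> ranked_seqs \<Longrightarrow> \<bar>f x\<bar> \<le> B" by (auto simp: bounded_iff)
    have z: "measure (P n) {\<omega> \<in> space (P n). ?X n \<omega> \<notin> ranked_seqs} = 0" for n
    proof -
      have "{\<omega> \<in> space (P n). ?X n \<omega> \<notin> ranked_seqs} \<in> sets (P n)"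
        using measurable_sets[OF Xm[of n] sets.compl_sets[OF ranked_seqs_borel]]
        by (simp add: vimage_def Int_def conj_commute)
      from AE_iff_measurable[OF this, of "\<lambda>\<omega>. ?X n \<omega> \<in> ranked_seqs"] XS[of n] show ?thesis by (simp add: measure_def)
    qed
    show "(\<lambda>n. LINT \<omega>|P n. indicator ranked_seqs (?X n \<omega>) * f (?X n \<omega>)) \<longlonglongrightarrow>
        (LINT \<omega>|Q. indicator ranked_seqs (?Y \<omega>) * f (?Y \<omega>))"
      by (rule lipschitz_convergence_imp_continuous[OF conv prob_P Q.prob_space_axioms Xm Ym ranked_seqs_borel YS _ f B])
        (simp_all add: z)
  qed
qed

end

section \<open>The total weight\<close>

context graph_sample
begin

text \<open>Loops are counted once in the total, unlike other edges. With high probability none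
  exceeds the scale, and by Markov's inequality the sum of the truncated ones is small against
  it.\<close>

lemma diagonal_negligible:
  assumes \<alpha>2: "\<alpha> < 2" and s: "0 < s" and \<theta>: "0 < \<theta>"
  shows "\<forall>\<^sub>F n in sequentially. \<exists>A\<in>sets (P n). measure (P n) A \<le> \<theta> \<and>
     (\<forall>\<omega>\<in>space (P n) - A. nonneg_weights n \<omega> \<and> 0 \<le> (\<Sum>e\<in>(\<lambda>i. (i, i)) ` {1..n}. weight_of n e \<omega>) \<and>
        (\<Sum>e\<in>(\<lambda>i. (i, i)) ` {1..n}. weight_of n e \<omega>) \<le> s * scale n)"
proof -
  have "(\<lambda>n. real n * G (1 * scale n) + 1 / s * (real n * mom 1 (1 * scale n) / scale n)) \<longlonglongrightarrow> 0 + 1 / s * 0"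
    by (intro tendsto_add tendsto_mult tendsto_const n_tail_scale n_mom_1 \<alpha>2) auto
  then have "\<forall>\<^sub>F n in sequentially. real n * G (1 * scale n) + 1 / s * (real n * mom 1 (1 * scale n) / scale n) < \<theta>"
    using \<theta> by (intro order_tendstoD) auto
  then show ?thesis using scale_pos
  proof eventually_elim
    case (elim n)
    interpret S: iid_sample \<alpha> \<L> "P n" "weight_of n" "edges n" by (rule sample)
    let ?I = "(\<lambda>i. (i, i)) ` {1..n}"
    let ?A0 = "{\<omega> \<in> space (P n). \<not> nonneg_weights n \<omega>}"
    let ?A1 = "{\<omega> \<in> space (P n). \<exists>e\<in>?I. scale n < weight_of n e \<omega>}"
    let ?A2 = "{\<omega> \<in> space (P n). s * scale n \<le> (\<Sum>e\<in>?I. trunc (scale n) (weight_of n e \<omega>))}"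
    have I: "?I \<subseteq> edges n" by (auto simp: edges_def)
    have cI: "card ?I = n" by (simp add: card_image inj_on_def)
    have s0: "0 < s * scale n" using s elim(2) by simp
    have A1: "?A1 \<in> sets (P n)"
    proof -
      have "?A1 = (\<Union>e\<in>?I. {\<omega> \<in> space (P n). scale n < weight_of n e \<omega>})" by auto
      then show ?thesis using I S.exceed_sets by (auto intro!: sets.finite_UN)
    qed
    have A2: "?A2 \<in> sets (P n)"
      using borel_measurable_integrable[OF S.truncated_sum_expectation(1)[OF I, of "scale n"]] by measurable
    have "measure (P n) (?A0 \<union> ?A1 \<union> ?A2) \<le> measure (P n) (?A0 \<union> ?A1) + measure (P n) ?A2"
      using nonneg_weights_prob(1) A1 A2 by (intro measure_Un_le sets.Un)
    also have "measure (P n) (?A0 \<union> ?A1) \<le> measure (P n) ?A0 + measure (P n) ?A1"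
      using nonneg_weights_prob(1) A1 by (intro measure_Un_le)
    also have "measure (P n) ?A1 \<le> real n * G (scale n)" using S.prob_exists_exceed[OF I, of "scale n"] by (simp only: cI)
    also have "measure (P n) ?A2 \<le> real n * mom 1 (scale n) / (s * scale n)"
      using S.truncated_sum_markov[OF I s0, of "scale n"] by (simp only: cI)
    also have "measure (P n) ?A0 = 0" by (rule nonneg_weights_prob(2))
    finally have m: "measure (P n) (?A0 \<union> ?A1 \<union> ?A2) \<le> \<theta>" using elim(1) by simp
    have "nonneg_weights n \<omega> \<and> 0 \<le> (\<Sum>e\<in>?I. weight_of n e \<omega>) \<and> (\<Sum>e\<in>?I. weight_of n e \<omega>) \<le> s * scale n"
      if w: "\<omega> \<in> space (P n) - (?A0 \<union> ?A1 \<union> ?A2)" for \<omega>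
    proof (intro conjI)
      show nn: "nonneg_weights n \<omega>" using w by auto
      then have wn: "0 \<le> weight_of n e \<omega>" if "e \<in> ?I" for e using that I by (auto simp: nonneg_weights_def)
      then show "0 \<le> (\<Sum>e\<in>?I. weight_of n e \<omega>)" by (rule sum_nonneg)
      have "(\<Sum>e\<in>?I. weight_of n e \<omega>) = (\<Sum>e\<in>?I. trunc (scale n) (weight_of n e \<omega>))"
      proof (rule sum.cong[OF refl])
        fix e assume e: "e \<in> ?I"
        have "\<not> scale n < weight_of n e \<omega>" using w e by blast
        then show "weight_of n e \<omega> = trunc (scale n) (weight_of n e \<omega>)" using wn[OF e] by (simp add: trunc_def)
      qed
      then show "(\<Sum>e\<in>?I. weight_of n e \<omega>) \<le> s * scale n" using w by auto
    qed
    then show ?case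
      using nonneg_weights_prob(1) A1 A2 m by (intro bexI[of _ "?A0 \<union> ?A1 \<union> ?A2"]) auto
  qed
qed

lemma mom_1_pos: "\<forall>\<^sub>F n in sequentially. 0 < mom 1 (scale n)"
proof -
  have "(\<lambda>n. G (scale n)) \<longlonglongrightarrow> 0" by (rule filterlim_compose[OF G_tendsto_0 scale_at_top])
  then have "\<forall>\<^sub>F n in sequentially. G (scale n) < G 1" by (rule order_tendstoD) (rule G_pos)
  moreover have "\<forall>\<^sub>F n in sequentially. 1 \<le> scale n" using scale_at_top by (simp add: filterlim_at_top)
  ultimately show ?thesis
  proof eventually_elim
    case (elim n)
    then show ?case using mom_diff_ge[of 1 "scale n"] mom_nonneg[of 1 1] by simp
  qed
qed

text \<open>Weights are truncated at l times the scale, with l so large that all weights probably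
  stay below. The truncated second moments are of order scale^2, and the scale is negligible against
  the mean c n, so Chebyshev's inequality applies.\<close>

lemma weak_law:
  assumes \<alpha>2: "\<alpha> < 2"
    and neg: "(\<lambda>n. scale n / (real (pairs n) * mom 1 (scale n))) \<longlonglongrightarrow> 0"
    and s: "0 < s" and \<theta>: "0 < \<theta>"
  shows "\<forall>\<^sub>F n in sequentially. \<exists>A\<in>sets (P n). measure (P n) A \<le> \<theta> \<and>
     (\<forall>\<omega>\<in>space (P n) - A. \<bar>total n \<omega> / (2 * (real (pairs n) * mom 1 (scale n))) - 1\<bar> \<le> s)"
proof -
  have "((\<lambda>x. x powr - \<alpha>) \<longlongrightarrow> 0) at_top"
    using \<alpha>_pos by (intro tendsto_neg_powr filterlim_ident) auto
  then have "\<forall>\<^sub>F x in at_top. x powr - \<alpha> < \<theta> / 3" using \<theta> by (intro order_tendstoD) auto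
  then obtain l where l: "l powr - \<alpha> < \<theta> / 3" "1 \<le> l"
    using eventually_ge_at_top[of "1::real"] by (metis (mono_tags, lifting) eventually_conj eventually_happens trivial_limit_at_top_linorder)
  have l0: "0 < l" using l by simp
  obtain C where C: "0 < C" and mom2: "\<And>x. 0 < x \<Longrightarrow> \<forall>\<^sub>F m in sequentially. real m * mom 2 (x * a m) \<le> C * x powr (2 - \<alpha>) * a m powr 2"
    using trunc_moment_quantile[OF \<alpha>2] by blast
  define c where "c n = real (pairs n) * mom 1 (scale n)" for n
  define u where "u n = scale n / c n" for n
  define K where "K = C * l powr (2 - \<alpha>)"
  have u: "u \<longlonglongrightarrow> 0" using neg by (simp add: u_def[abs_def] c_def)
  have "(\<lambda>n. 16 * K / s\<^sup>2 * (u n * u n)) \<longlonglongrightarrow> 16 * K / s\<^sup>2 * (0 * 0)"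
    by (intro tendsto_mult tendsto_const u)
  then have ev1: "\<forall>\<^sub>F n in sequentially. 16 * K / s\<^sup>2 * (u n * u n) < \<theta> / 3"
    using \<theta> by (intro order_tendstoD) auto
  have "(\<lambda>n. l * u n) \<longlonglongrightarrow> 0" by (rule tendsto_mult_right_zero[OF u])
  then have ev2: "\<forall>\<^sub>F n in sequentially. l * u n < s / 4" using s by (intro order_tendstoD) auto
  have ev3: "\<forall>\<^sub>F n in sequentially. real (pairs n) * mom 2 (l * scale n) \<le> K * scale n powr 2"
    unfolding scale_def K_def by (rule eventually_compose_filterlim[OF mom2[OF l0] pairs_at_top])
  have th3: "0 < \<theta> / 3" using \<theta> by simp
  note ev4 = diagonal_negligible[OF \<alpha>2 zero_less_one th3]
  note ev5 = large_weight_prob[OF l0 l(1)]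
  have ev6: "\<forall>\<^sub>F n in sequentially. 0 < pairs n"
    using eventually_gt_at_top[of 0] by eventually_elim (use pairs_ge in \<open>force intro: less_le_trans\<close>)
  have "\<forall>\<^sub>F n in sequentially. \<exists>A\<in>sets (P n). measure (P n) A \<le> \<theta> \<and>
     (\<forall>\<omega>\<in>space (P n) - A. \<bar>total n \<omega> / (2 * c n) - 1\<bar> \<le> s)"
    using ev1 ev2 ev3 ev4 ev5 ev6 mom_1_pos scale_pos
  proof eventually_elim
    case (elim n)
    interpret S: iid_sample \<alpha> \<L> "P n" "weight_of n" "edges n" by (rule sample)
    have A0: "0 < scale n" by fact
    have c0: "0 < c n" using elim(6,7) by (simp add: c_def)
    obtain D where D: "D \<in> sets (P n)" "measure (P n) D \<le> \<theta> / 3"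
      and D': "\<And>\<omega>. \<omega> \<in> space (P n) - D \<Longrightarrow> nonneg_weights n \<omega>"
        "\<And>\<omega>. \<omega> \<in> space (P n) - D \<Longrightarrow> 0 \<le> (\<Sum>e\<in>(\<lambda>i. (i, i)) ` {1..n}. weight_of n e \<omega>)"
        "\<And>\<omega>. \<omega> \<in> space (P n) - D \<Longrightarrow> (\<Sum>e\<in>(\<lambda>i. (i, i)) ` {1..n}. weight_of n e \<omega>) \<le> 1 * scale n"
      using elim(4) by auto
    let ?M = "{\<omega> \<in> space (P n). \<exists>e\<in>edges n. l * scale n < weight_of n e \<omega>}"
    let ?B = "{\<omega> \<in> space (P n). s / 4 * c n \<le> \<bar>(\<Sum>e\<in>edges n. trunc (l * scale n) (weight_of n e \<omega>)) - real (card (edges n)) * mom 1 (l * scale n)\<bar>}"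
    have M: "?M \<in> sets (P n)" "measure (P n) ?M \<le> \<theta> / 3" using elim(5) by auto
    have Bs: "?B \<in> sets (P n)"
      using borel_measurable_integrable[OF S.truncated_sum_expectation(1)[OF order_refl, of "l * scale n"]] by measurable
    have "measure (P n) ?B \<le> real (card (edges n)) * mom 2 (l * scale n) / (s / 4 * c n)\<^sup>2"
      using l0 A0 c0 s by (intro S.truncated_sum_chebyshev) auto
    also have "\<dots> \<le> K * scale n powr 2 / (s / 4 * c n)\<^sup>2"
      using elim(3) by (intro divide_right_mono) (auto simp: card_edges pairs_def)
    also have "\<dots> = 16 * K / s\<^sup>2 * (u n * u n)"
      using A0 by (simp add: u_def power2_eq_square field_simps)
    finally have Bm: "measure (P n) ?B \<le> \<theta> / 3" using elim(1) by simp
    have "measure (P n) (D \<union> ?M \<union> ?B) \<le> measure (P n) (D \<union> ?M) + measure (P n) ?B"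
      using D M Bs by (intro measure_Un_le sets.Un)
    also have "measure (P n) (D \<union> ?M) \<le> measure (P n) D + measure (P n) ?M"
      using D M by (intro measure_Un_le)
    finally have m: "measure (P n) (D \<union> ?M \<union> ?B) \<le> \<theta>" using D(2) M(2) Bm by simp
    have w1: "mom 1 (scale n) \<le> mom 1 (l * scale n)"
      using A0 l by (intro mom_mono) auto
    \<comment> \<open>Raising the truncation level from the scale to l times the scale adds at most
      l * scale n to the mean of the sum, because m G is at most 1 at the quantile; this is
      negligible against c n.\<close>
    have w2: "real (pairs n) * mom 1 (l * scale n) \<le> c n + l * scale n"
    proof -
      have "mom 1 (l * scale n) \<le> mom 1 (scale n) + (l * scale n) powr 1 * G (scale n)"
        using A0 l by (intro mom_diff_le) auto
      then have "real (pairs n) * mom 1 (l * scale n) \<le> real (pairs n) * (mom 1 (scale n) + l * scale n * G (scale n))"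
        using A0 l0 by (intro mult_left_mono) auto
      also have "\<dots> = c n + l * scale n * (real (pairs n) * G (scale n))" by (simp add: c_def algebra_simps)
      also have "\<dots> \<le> c n + l * scale n * 1"
        using quantile_le_1[of "pairs n"] A0 l0 by (intro add_left_mono mult_left_mono) (auto simp: scale_def)
      finally show ?thesis by simp
    qed
    have "\<bar>total n \<omega> / (2 * c n) - 1\<bar> \<le> s" if w: "\<omega> \<in> space (P n) - (D \<union> ?M \<union> ?B)" for \<omega>
    proof -
      let ?S = "\<Sum>e\<in>edges n. weight_of n e \<omega>" and ?d = "\<Sum>e\<in>(\<lambda>i. (i, i)) ` {1..n}. weight_of n e \<omega>"
      have nn: "nonneg_weights n \<omega>" and d: "0 \<le> ?d" "?d \<le> scale n" using D'[of \<omega>] w by auto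
      have "?S = (\<Sum>e\<in>edges n. trunc (l * scale n) (weight_of n e \<omega>))"
      proof (rule sum.cong[OF refl])
        fix e assume e: "e \<in> edges n"
        have "\<not> l * scale n < weight_of n e \<omega>" using w e by blast
        then show "weight_of n e \<omega> = trunc (l * scale n) (weight_of n e \<omega>)"
          using nn e by (simp add: trunc_def nonneg_weights_def)
      qed
      moreover have "\<omega> \<notin> ?B" "\<omega> \<in> space (P n)" using w by auto
      ultimately have S: "\<bar>?S - real (pairs n) * mom 1 (l * scale n)\<bar> < s / 4 * c n"
        by (simp add: card_edges pairs_def not_le)
      then have S': "4 * \<bar>?S - real (pairs n) * mom 1 (l * scale n)\<bar> < s * c n" by simp
      have lu: "4 * (l * scale n) \<le> s * c n" using elim(2) c0 by (simp add: u_def field_simps)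
      have arith: "4 * \<bar>S - m\<bar> < sc \<Longrightarrow> m \<le> c + L \<Longrightarrow> 4 * L \<le> sc \<Longrightarrow> A \<le> L \<Longrightarrow> c \<le> m \<Longrightarrow>
          0 \<le> d \<Longrightarrow> d \<le> A \<Longrightarrow> 0 \<le> sc \<Longrightarrow> \<bar>2 * S - d - 2 * c\<bar> \<le> 2 * sc" for S m c sc L A d :: real
        by (auto simp: abs_if split: if_splits)
      have sc: "0 \<le> s * c n" using s c0 by simp
      have Al: "scale n \<le> l * scale n" using l A0 by simp
      have low: "c n \<le> real (pairs n) * mom 1 (l * scale n)" unfolding c_def by (intro mult_left_mono w1) simp
      have "\<bar>2 * ?S - ?d - 2 * c n\<bar> \<le> 2 * (s * c n)"
        by (rule arith[OF S' w2 lu Al low d sc])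
      then have "\<bar>total n \<omega> - 2 * c n\<bar> \<le> s * (2 * c n)" unfolding total_eq by (simp add: mult.commute mult.left_commute)
      moreover have "\<bar>total n \<omega> / (2 * c n) - 1\<bar> = \<bar>total n \<omega> - 2 * c n\<bar> / (2 * c n)"
      proof -
        have "total n \<omega> / (2 * c n) - 1 = (total n \<omega> - 2 * c n) / (2 * c n)"
          using c0 by (simp add: diff_divide_distrib)
        then show ?thesis using c0 by (simp add: abs_divide)
      qed
      ultimately show ?thesis using c0 by (simp add: pos_divide_le_eq)
    qed
    then show ?case using D M Bs m by (intro bexI[of _ "D \<union> ?M \<union> ?B"]) auto
  qed
  then show ?thesis by (simp only: c_def)
qed

text \<open>With a deterministic limit the constant function 1 approximates the normalised total,
  whatever the transform. The norming c may be any sequence asymptotic to the truncated mean of the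
  edge sum.\<close>

lemma approximable_head_const:
  assumes \<alpha>2: "\<alpha> < 2" and Q: "prob_space Q"
    and neg: "(\<lambda>n. scale n / (real (pairs n) * mom 1 (scale n))) \<longlonglongrightarrow> 0"
    and c: "(\<lambda>n. real (pairs n) * mom 1 (scale n) / c n) \<longlonglongrightarrow> 1"
  shows "approximable_head (\<lambda>n \<omega>. total n \<omega> / (2 * c n)) Q y (\<lambda>_. 1)"
  unfolding approximable_head_def
proof (intro allI impI)
  fix \<epsilon> :: real assume \<epsilon>: "0 < \<epsilon>"
  have half: "0 < \<epsilon> / 4" using \<epsilon> by simp
  \<comment> \<open>The bound by 1 makes the ratio at most 2 and keeps it away from 0, which
    excludes a vanishing denominator.\<close>
  have r1: "\<forall>\<^sub>F n in sequentially. \<bar>real (pairs n) * mom 1 (scale n) / c n - 1\<bar> < min 1 (\<epsilon> / 4)"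
    using tendstoD[OF c, of "min 1 (\<epsilon> / 4)"] \<epsilon> by (simp add: dist_real_def)
  have "\<forall>\<^sub>F n in sequentially. \<exists>A\<in>sets (P n). measure (P n) A \<le> \<epsilon> \<and>
          (\<forall>\<omega>\<in>space (P n) - A. \<bar>total n \<omega> / (2 * c n) - 1\<bar> \<le> \<epsilon>)"
    using weak_law[OF \<alpha>2 neg half \<epsilon>] r1
  proof eventually_elim
    case (elim n)
    define \<rho> where "\<rho> = real (pairs n) * mom 1 (scale n) / c n"
    obtain A where A: "A \<in> sets (P n)" "measure (P n) A \<le> \<epsilon>"
      "\<And>\<omega>. \<omega> \<in> space (P n) - A \<Longrightarrow> \<bar>total n \<omega> / (2 * (real (pairs n) * mom 1 (scale n))) - 1\<bar> \<le> \<epsilon> / 4"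
      using elim(1) by blast
    have \<rho>: "\<bar>\<rho> - 1\<bar> < 1" "\<bar>\<rho> - 1\<bar> < \<epsilon> / 4" using elim(2) by (auto simp: \<rho>_def)
    have nz: "real (pairs n) * mom 1 (scale n) \<noteq> 0"
    proof
      assume "real (pairs n) * mom 1 (scale n) = 0"
      then have "\<rho> = 0" by (simp only: \<rho>_def div_0)
      then show False using \<rho>(1) by simp
    qed
    have "\<bar>total n \<omega> / (2 * c n) - 1\<bar> \<le> \<epsilon>" if w: "\<omega> \<in> space (P n) - A" for \<omega>
    proof -
      define \<tau> where "\<tau> = total n \<omega> / (2 * (real (pairs n) * mom 1 (scale n)))"
      have "total n \<omega> / (2 * c n) - 1 = (\<tau> - 1) * \<rho> + (\<rho> - 1)"
        using nz by (simp add: \<tau>_def \<rho>_def algebra_simps)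
      also have "\<bar>\<dots>\<bar> \<le> \<bar>\<tau> - 1\<bar> * \<bar>\<rho>\<bar> + \<bar>\<rho> - 1\<bar>"
        using abs_triangle_ineq[of "(\<tau> - 1) * \<rho>" "\<rho> - 1"] by (simp add: abs_mult)
      also have "\<bar>\<tau> - 1\<bar> * \<bar>\<rho>\<bar> \<le> \<epsilon> / 4 * 2"
        using A(3)[OF w] \<rho>(1) \<epsilon> by (intro mult_mono) (auto simp: \<tau>_def)
      finally show ?thesis using \<rho>(2) \<epsilon> by simp
    qed
    with A show ?case by blast
  qed
  then show "\<exists>\<eta>>0. \<eta> \<le> \<epsilon> \<and> (\<forall>r0::nat. \<exists>r\<ge>r0. \<exists>h. continuous_on UNIV h \<and>
       (\<forall>\<^sub>F n in sequentially. \<exists>A\<in>sets (P n). measure (P n) A \<le> \<epsilon> \<and>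
          (\<forall>\<omega>\<in>space (P n) - A. \<bar>total n \<omega> / (2 * c n) - h (exceedance_transform \<eta> n \<omega>)\<bar> \<le> \<epsilon>)) \<and>
       (\<exists>A\<in>sets Q. measure Q A \<le> \<epsilon> \<and> (\<forall>\<omega>\<in>space Q - A. \<bar>1 - h (limit_transform \<eta> y \<omega>)\<bar> \<le> \<epsilon>)))"
    using \<epsilon> by (intro exI[of _ \<epsilon>] conjI allI exI[of _ "_ :: nat"] exI[of _ "\<lambda>_. 1"] bexI[of _ "{}"]) auto
qed

text \<open>The mean of the count is m G, so Markov's inequality bounds it without reference to its
  limit law.\<close>

lemma exceedances_prob:
  assumes t: "0 < t"
  shows "{\<omega> \<in> space (P n). K < exceedances n t \<omega>} \<in> sets (P n)"
    and "measure (P n) {\<omega> \<in> space (P n). K < exceedances n t \<omega>} \<le> real (pairs n) * G (t * scale n) / real (Suc K)"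
proof -
  interpret S: iid_sample \<alpha> \<L> "P n" "weight_of n" "edges n" by (rule sample)
  let ?f = "\<lambda>\<omega>. \<Sum>e\<in>edges n. indicator {t * scale n<..} (weight_of n e \<omega>) :: real"
  have eq: "?f \<omega> = real (exceedances n t \<omega>)" for \<omega>
    by (simp add: exceedances_def indicator_def sum.If_cases Int_def)
  have ind: "integrable \<L> (indicator {t * scale n<..} :: real \<Rightarrow> real)"
    by (intro integrable_real_indicator) (auto simp: less_top[symmetric])
  have i: "integrable (P n) (\<lambda>\<omega>. indicator {t * scale n<..} (weight_of n e \<omega>) :: real)" if "e \<in> edges n" for e
    by (rule S.integrable_X[OF that _ ind]) simp
  have fi: "integrable (P n) ?f" by (intro Bochner_Integration.integrable_sum i)
  have "(LINT \<omega>|P n. ?f \<omega>) = (\<Sum>e\<in>edges n. LINT \<omega>|P n. indicator {t * scale n<..} (weight_of n e \<omega>))"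
    by (intro Bochner_Integration.integral_sum i)
  also have "\<dots> = (\<Sum>e\<in>edges n. LINT x|\<L>. indicator {t * scale n<..} x)"
    by (intro sum.cong refl S.integral_X) auto
  finally have E: "(LINT \<omega>|P n. ?f \<omega>) = real (pairs n) * G (t * scale n)"
    by (simp add: tail_def card_edges pairs_def)
  have set_eq: "{\<omega> \<in> space (P n). K < exceedances n t \<omega>} = {\<omega> \<in> space (P n). real (Suc K) \<le> ?f \<omega>}"
    by (auto simp: eq)
  show "{\<omega> \<in> space (P n). K < exceedances n t \<omega>} \<in> sets (P n)"
    unfolding set_eq using borel_measurable_integrable[OF fi] by measurable
  show "measure (P n) {\<omega> \<in> space (P n). K < exceedances n t \<omega>} \<le> real (pairs n) * G (t * scale n) / real (Suc K)"
    unfolding set_eq E[symmetric]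
    by (rule integral_Markov_inequality_measure[OF fi, of "{}"]) (auto intro!: AE_I2 sum_nonneg)
qed

text \<open>For \<alpha> < 1 Karamata's bound applies to first moments: weights below \<beta> times
  the scale add up to order \<beta> powr (1 - \<alpha>) times the scale in mean, uniformly in large
  n. So the sum is carried by finitely many points above \<beta>, which the grid formula
  recovers.\<close>

lemma approximable_head_sum:
  fixes Q :: "'q measure" and y :: "'q \<Rightarrow> nat \<Rightarrow> real"
  assumes \<alpha>1: "\<alpha> < 1" and y: "power_law_counts \<alpha> Q y" and sum: "AE \<omega> in Q. summable (y \<omega>)"
  shows "approximable_head (\<lambda>n \<omega>. total n \<omega> / (2 * scale n)) Q y (\<lambda>\<omega>. \<Sum>k. y \<omega> k)"
  unfolding approximable_head_def
proof (intro allI impI)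
  fix \<epsilon> :: real assume \<epsilon>: "0 < \<epsilon>"
  interpret Q: prob_space Q using y by (simp add: power_law_counts_def)
  have \<alpha>2: "\<alpha> < 2" using \<alpha>1 by simp
  \<comment> \<open>Here t is the mass of the small points and d the loop correction. They enter
    with opposite signs, so only the larger of them adds to the grid error e.\<close>
  have arith: "\<bar>B - H\<bar> \<le> e \<Longrightarrow> 0 \<le> t \<Longrightarrow> t \<le> \<epsilon> / 2 \<Longrightarrow> 0 \<le> d \<Longrightarrow> d \<le> \<epsilon> / 4 \<Longrightarrow> e \<le> \<epsilon> / 4 \<Longrightarrow>
      \<bar>B + t - d - H\<bar> \<le> \<epsilon>" for B H e t d :: real
    using \<epsilon> by (auto simp: abs_if split: if_splits)
  have e4: "0 < \<epsilon> / 4" and e2: "0 < \<epsilon> / 2" using \<epsilon> by auto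
  have ym: "y \<in> borel_measurable Q" and yr: "AE \<omega> in Q. y \<omega> \<in> ranked_seqs"
    using y by (auto simp: power_law_counts_def)
  have yk: "(\<lambda>\<omega>. y \<omega> k) \<in> borel_measurable Q" for k
    by (rule measurable_product_then_coordinatewise[OF ym])
  obtain C where C: "0 < C" and mom1: "\<And>x. 0 < x \<Longrightarrow> \<forall>\<^sub>F m in sequentially. real m * mom 1 (x * a m) \<le> C * x powr (1 - \<alpha>) * a m powr 1"
    using trunc_moment_quantile[OF \<alpha>1] by blast
  define small where "small j \<omega> = (\<Sum>k. if y \<omega> k \<le> 1 / real (Suc j) then y \<omega> k else 0)" for j \<omega>
  have small_meas: "small j \<in> borel_measurable Q" for j
    unfolding small_def using yk by (intro borel_measurable_suminf measurable_If borel_measurable_const) simp_all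
  have "(\<lambda>j. Q.prob {\<omega> \<in> space Q. \<epsilon> / 2 < small j \<omega>}) \<longlonglongrightarrow> 0"
  proof (rule Q.prob_tendsto_0[OF small_meas _ e2])
    show "AE \<omega> in Q. (\<lambda>j. small j \<omega>) \<longlonglongrightarrow> 0"
      using sum yr unfolding small_def by eventually_elim (intro small_terms_tendsto, auto simp: ranked_seqs_def)
  qed
  then have ev1: "\<forall>\<^sub>F j in sequentially. Q.prob {\<omega> \<in> space Q. \<epsilon> / 2 < small j \<omega>} < \<epsilon> / 4"
    using e4 by (rule order_tendstoD)
  have "(\<lambda>j. inverse (real (Suc j)) powr (1 - \<alpha>)) \<longlonglongrightarrow> 0 powr (1 - \<alpha>)"
    using \<alpha>1 by (intro tendsto_powr2 LIMSEQ_inverse_real_of_nat tendsto_const) auto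
  then have "(\<lambda>j. inverse (real (Suc j)) powr (1 - \<alpha>)) \<longlonglongrightarrow> 0" unfolding powr_0 .
  then have "(\<lambda>j. 4 / \<epsilon> * (C * inverse (real (Suc j)) powr (1 - \<alpha>))) \<longlonglongrightarrow> 0"
    by (intro tendsto_mult_right_zero)
  then have ev2: "\<forall>\<^sub>F j in sequentially. 4 / \<epsilon> * (C * inverse (real (Suc j)) powr (1 - \<alpha>)) < \<epsilon> / 4"
    using e4 by (rule order_tendstoD)
  obtain j where j1: "Q.prob {\<omega> \<in> space Q. \<epsilon> / 2 < small j \<omega>} < \<epsilon> / 4"
    and j2: "4 / \<epsilon> * (C * inverse (real (Suc j)) powr (1 - \<alpha>)) < \<epsilon> / 4"
    using eventually_happens'[OF sequentially_bot eventually_conj[OF ev1 ev2]] by auto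
  \<comment> \<open>One threshold has to make the small points negligible both for the graph and for
    the limit sequence.\<close>
  define \<beta> where "\<beta> = 1 / real (Suc j)"
  have \<beta>: "0 < \<beta>" by (simp add: \<beta>_def)
  have j2': "4 / \<epsilon> * (C * \<beta> powr (1 - \<alpha>)) < \<epsilon> / 4" using j2 by (simp add: \<beta>_def inverse_eq_divide)
  have "(\<lambda>K. (\<beta> powr - \<alpha> + 1) * inverse (real (Suc K))) \<longlonglongrightarrow> 0"
    by (intro tendsto_mult_right_zero LIMSEQ_inverse_real_of_nat)
  then have "\<forall>\<^sub>F K in sequentially. (\<beta> powr - \<alpha> + 1) * inverse (real (Suc K)) < \<epsilon> / 4"
    using e4 by (rule order_tendstoD)
  then obtain K where K1: "(\<beta> powr - \<alpha> + 1) * inverse (real (Suc K)) < \<epsilon> / 4"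
    and K2: "{\<omega> \<in> space Q. K < tail_count (y \<omega>) \<beta>} \<in> sets Q" "measure Q {\<omega> \<in> space Q. K < tail_count (y \<omega>) \<beta>} \<le> \<epsilon> / 4"
    using eventually_happens'[OF sequentially_bot eventually_conj[OF _ tail_count_exceeds_prob[OF y \<beta> e4]]] by blast
  have K1': "(\<beta> powr - \<alpha> + 1) / real (Suc K) < \<epsilon> / 4" using K1 by (simp only: divide_inverse)
  \<comment> \<open>The mesh will be \<beta> divided by i0 = i1 + 1, so that \<beta> is a grid
    level. The two lower bounds make the mesh at most \<epsilon> and the rounding error of K points
    at most \<epsilon> / 4.\<close>
  obtain i1 :: nat where i1: "max (\<beta> / \<epsilon>) (4 * \<beta> * real K / \<epsilon>) \<le> real i1" using real_arch_simple by blast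
  define i0 where "i0 = Suc i1"
  define \<eta> where "\<eta> = \<beta> / real i0"
  have \<eta>: "0 < \<eta>" using \<beta> by (simp add: \<eta>_def i0_def)
  have \<eta>i0: "\<eta> * real i0 = \<beta>" by (simp add: \<eta>_def i0_def)
  have ge: "\<beta> / \<epsilon> \<le> real i0" "4 * \<beta> * real K / \<epsilon> \<le> real i0" using i1 by (auto simp: i0_def)
  have \<eta>le: "\<eta> \<le> \<epsilon>" using ge(1) \<epsilon> by (simp add: \<eta>_def i0_def field_simps)
  have \<eta>K: "\<eta> * real K \<le> \<epsilon> / 4" using ge(2) \<epsilon> by (simp add: \<eta>_def i0_def field_simps)
  have "filterlim (\<lambda>r. \<eta> * real r) at_top sequentially"
    by (rule filterlim_tendsto_pos_mult_at_top[OF tendsto_const \<eta> filterlim_real_sequentially])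
  then have "(\<lambda>r. (\<eta> * real r) powr - \<alpha>) \<longlonglongrightarrow> 0" using \<alpha>_pos by (intro tendsto_neg_powr) auto
  then have evr: "\<forall>\<^sub>F r in sequentially. (\<eta> * real r) powr - \<alpha> < \<epsilon> / 4" using e4 by (rule order_tendstoD)
  have "\<exists>r\<ge>r0. \<exists>h. continuous_on UNIV h \<and>
       (\<forall>\<^sub>F n in sequentially. \<exists>A\<in>sets (P n). measure (P n) A \<le> \<epsilon> \<and>
          (\<forall>\<omega>\<in>space (P n) - A. \<bar>total n \<omega> / (2 * scale n) - h (exceedance_transform \<eta> n \<omega>)\<bar> \<le> \<epsilon>)) \<and>
       (\<exists>A\<in>sets Q. measure Q A \<le> \<epsilon> \<and> (\<forall>\<omega>\<in>space Q - A. \<bar>(\<Sum>k. y \<omega> k) - h (limit_transform \<eta> y \<omega>)\<bar> \<le> \<epsilon>))" for r0 :: nat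
  proof -
    obtain r where r: "max r0 i0 \<le> r" "(\<eta> * real r) powr - \<alpha> < \<epsilon> / 4" "measure Q {\<omega> \<in> space Q. \<eta> * real r < y \<omega> 0} \<le> \<epsilon> / 4"
      using eventually_happens'[OF sequentially_bot eventually_conj[OF eventually_ge_at_top[of "max r0 i0"] eventually_conj[OF evr limit_top[OF y \<eta> e4]]]]
      by blast
    have i0r: "0 < i0" "i0 \<le> r" using r by (auto simp: i0_def)
    have \<eta>r: "0 < \<eta> * real r" using \<eta> i0r by simp
    let ?h = "total_level \<eta> r i0 K"
    have hP: "\<forall>\<^sub>F n in sequentially. \<exists>A\<in>sets (P n). measure (P n) A \<le> \<epsilon> \<and>
          (\<forall>\<omega>\<in>space (P n) - A. \<bar>total n \<omega> / (2 * scale n) - ?h (exceedance_transform \<eta> n \<omega>)\<bar> \<le> \<epsilon>)"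
    proof -
      have c1: "\<forall>\<^sub>F n in sequentially. real (pairs n) * mom 1 (\<beta> * scale n) \<le> C * \<beta> powr (1 - \<alpha>) * scale n powr 1"
        unfolding scale_def by (rule eventually_compose_filterlim[OF mom1[OF \<beta>] pairs_at_top])
      have c2: "\<forall>\<^sub>F n in sequentially. real (pairs n) * G (\<beta> * scale n) < \<beta> powr - \<alpha> + 1"
        by (rule order_tendstoD(2)[OF tail_scale[OF \<beta>]]) simp
      show ?thesis
        using c1 c2 diagonal_negligible[OF \<alpha>2 e2 e4] large_weight_prob[OF \<eta>r r(2)] scale_pos
      proof eventually_elim
        case (elim n)
        interpret S: iid_sample \<alpha> \<L> "P n" "weight_of n" "edges n" by (rule sample)
        have s: "0 < scale n" by fact
        obtain D where D: "D \<in> sets (P n)" "measure (P n) D \<le> \<epsilon> / 4"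
          and D': "\<And>\<omega>. \<omega> \<in> space (P n) - D \<Longrightarrow> nonneg_weights n \<omega>"
            "\<And>\<omega>. \<omega> \<in> space (P n) - D \<Longrightarrow> 0 \<le> (\<Sum>e\<in>(\<lambda>i. (i, i)) ` {1..n}. weight_of n e \<omega>)"
            "\<And>\<omega>. \<omega> \<in> space (P n) - D \<Longrightarrow> (\<Sum>e\<in>(\<lambda>i. (i, i)) ` {1..n}. weight_of n e \<omega>) \<le> \<epsilon> / 2 * scale n"
          using elim(3) by auto
        let ?M = "{\<omega> \<in> space (P n). \<exists>e\<in>edges n. (\<eta> * real r) * scale n < weight_of n e \<omega>}"
        let ?B = "{\<omega> \<in> space (P n). \<epsilon> / 4 * scale n \<le> (\<Sum>e\<in>edges n. trunc (\<beta> * scale n) (weight_of n e \<omega>))}"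
        let ?E = "{\<omega> \<in> space (P n). K < exceedances n \<beta> \<omega>}"
        have M: "?M \<in> sets (P n)" "measure (P n) ?M \<le> \<epsilon> / 4" using elim(4) by auto
        have E: "?E \<in> sets (P n)" by (rule exceedances_prob(1)[OF \<beta>])
        have "measure (P n) ?E \<le> real (pairs n) * G (\<beta> * scale n) / real (Suc K)" by (rule exceedances_prob(2)[OF \<beta>])
        also have "\<dots> \<le> (\<beta> powr - \<alpha> + 1) / real (Suc K)" using elim(2) by (intro divide_right_mono) auto
        finally have Em: "measure (P n) ?E \<le> \<epsilon> / 4" using K1' by linarith
        have Bs: "?B \<in> sets (P n)"
          using borel_measurable_integrable[OF S.truncated_sum_expectation(1)[OF order_refl, of "\<beta> * scale n"]] by measurable
        have es: "0 < \<epsilon> / 4 * scale n" using e4 s by simp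
        have "measure (P n) ?B \<le> real (card (edges n)) * mom 1 (\<beta> * scale n) / (\<epsilon> / 4 * scale n)"
          by (rule S.truncated_sum_markov[OF order_refl es])
        also have "\<dots> \<le> C * \<beta> powr (1 - \<alpha>) * scale n powr 1 / (\<epsilon> / 4 * scale n)"
          using elim(1) es by (intro divide_right_mono) (auto simp: card_edges pairs_def)
        also have "\<dots> = 4 / \<epsilon> * (C * \<beta> powr (1 - \<alpha>))" using s \<epsilon> by simp
        finally have Bm: "measure (P n) ?B \<le> \<epsilon> / 4" using j2' by linarith
        have "measure (P n) (D \<union> ?M \<union> ?B \<union> ?E) \<le> measure (P n) (D \<union> ?M \<union> ?B) + measure (P n) ?E"
          using D M Bs E by (intro measure_Un_le sets.Un)
        also have "measure (P n) (D \<union> ?M \<union> ?B) \<le> measure (P n) (D \<union> ?M) + measure (P n) ?B"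
          using D M Bs by (intro measure_Un_le sets.Un)
        also have "measure (P n) (D \<union> ?M) \<le> measure (P n) D + measure (P n) ?M"
          using D M by (intro measure_Un_le)
        finally have m: "measure (P n) (D \<union> ?M \<union> ?B \<union> ?E) \<le> \<epsilon>" using D(2) M(2) Bm Em by linarith
        have "\<bar>total n \<omega> / (2 * scale n) - ?h (exceedance_transform \<eta> n \<omega>)\<bar> \<le> \<epsilon>"
          if w: "\<omega> \<in> space (P n) - (D \<union> ?M \<union> ?B \<union> ?E)" for \<omega>
        proof -
          let ?x = "\<lambda>e. weight_of n e \<omega> / scale n"
          let ?Big = "{e \<in> edges n. \<eta> * real i0 < ?x e}"
          have nn: "nonneg_weights n \<omega>" using D'(1)[of \<omega>] w by auto
          have conv: "(t < ?x e) = (t * scale n < weight_of n e \<omega>)" for t e using s by (simp add: pos_less_divide_eq)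
          have tl: "\<bar>(\<Sum>e\<in>?Big. ?x e) - total_level \<eta> r i0 K (\<lambda>i. exp (- real (card {e \<in> edges n. \<eta> * real (Suc i) < ?x e})))\<bar> \<le> \<eta> * real K"
          proof (rule total_level_close[OF \<eta> i0r])
            show "card ?Big \<le> K" using w unfolding \<eta>i0 conv by (auto simp: exceedances_def not_less)
            show "?x e \<le> \<eta> * real r" if "e \<in> edges n" for e
              using w that unfolding not_less[symmetric] conv by blast
          qed simp
          have tr: "(\<lambda>i. exp (- real (card {e \<in> edges n. \<eta> * real (Suc i) < ?x e}))) = exceedance_transform \<eta> n \<omega>"
            unfolding conv by (simp add: exceedance_transform_def exceedances_def grid_def fun_eq_iff)
          have split: "(\<Sum>e\<in>edges n. ?x e) = (\<Sum>e\<in>?Big. ?x e) + (\<Sum>e\<in>edges n. trunc (\<beta> * scale n) (weight_of n e \<omega>)) / scale n"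
          proof -
            have "(\<Sum>e\<in>edges n. ?x e) = (\<Sum>e\<in>edges n. (if \<eta> * real i0 < ?x e then ?x e else 0) + trunc (\<beta> * scale n) (weight_of n e \<omega>) / scale n)"
              using nn unfolding conv \<eta>i0 by (intro sum.cong) (auto simp: trunc_def nonneg_weights_def)
            also have "\<dots> = (\<Sum>e\<in>edges n. if \<eta> * real i0 < ?x e then ?x e else 0) + (\<Sum>e\<in>edges n. trunc (\<beta> * scale n) (weight_of n e \<omega>) / scale n)"
              by (rule sum.distrib)
            finally show ?thesis by (simp add: sum.inter_filter sum_divide_distrib)
          qed
          have "(\<Sum>e\<in>edges n. trunc (\<beta> * scale n) (weight_of n e \<omega>)) \<le> \<epsilon> / 4 * scale n" using w by auto
          then have b1: "(\<Sum>e\<in>edges n. trunc (\<beta> * scale n) (weight_of n e \<omega>)) / scale n \<le> \<epsilon> / 4" using s by (simp add: pos_divide_le_eq)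
          have b0: "0 \<le> (\<Sum>e\<in>edges n. trunc (\<beta> * scale n) (weight_of n e \<omega>)) / scale n"
            using s by (intro divide_nonneg_nonneg sum_nonneg trunc_bounds) auto
          let ?d = "(\<Sum>e\<in>(\<lambda>i. (i, i)) ` {1..n}. weight_of n e \<omega>) / (2 * scale n)"
          have tot: "total n \<omega> / (2 * scale n) = (\<Sum>e\<in>edges n. ?x e) - ?d"
            unfolding total_eq using s by (simp add: sum_divide_distrib[symmetric] diff_divide_distrib)
          have d: "0 \<le> ?d" "?d \<le> \<epsilon> / 4" using D'(2,3)[of \<omega>] w s by (auto simp: pos_divide_le_eq)
          show ?thesis using arith[OF tl b0 _ d \<eta>K] b1 \<epsilon> unfolding tr tot split by simp
        qed
        then show ?case using D M Bs E m by (intro bexI[of _ "D \<union> ?M \<union> ?B \<union> ?E"]) auto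
      qed
    qed
    have hQ: "\<exists>A\<in>sets Q. measure Q A \<le> \<epsilon> \<and> (\<forall>\<omega>\<in>space Q - A. \<bar>(\<Sum>k. y \<omega> k) - ?h (limit_transform \<eta> y \<omega>)\<bar> \<le> \<epsilon>)"
    proof -
      have "AE \<omega> in Q. y \<omega> \<in> ranked_seqs \<and> summable (y \<omega>)" using yr sum by eventually_elim simp
      then obtain N where N: "{\<omega> \<in> space Q. \<not> (y \<omega> \<in> ranked_seqs \<and> summable (y \<omega>))} \<subseteq> N" "emeasure Q N = 0" "N \<in> sets Q"
        by (rule AE_E)
      let ?B = "{\<omega> \<in> space Q. \<epsilon> / 2 < small j \<omega>}" and ?M = "{\<omega> \<in> space Q. \<eta> * real r < y \<omega> 0}"
      let ?E = "{\<omega> \<in> space Q. K < tail_count (y \<omega>) \<beta>}"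
      have B: "?B \<in> sets Q" using small_meas[of j] by measurable
      have M: "?M \<in> sets Q" using yk[of 0] by measurable
      have N0: "measure Q N = 0" using N(2) by (simp add: measure_def)
      have "measure Q (N \<union> ?B \<union> ?M \<union> ?E) \<le> measure Q (N \<union> ?B \<union> ?M) + measure Q ?E"
        using N(3) B M K2(1) by (intro measure_Un_le sets.Un)
      also have "measure Q (N \<union> ?B \<union> ?M) \<le> measure Q (N \<union> ?B) + measure Q ?M"
        using N(3) B M by (intro measure_Un_le sets.Un)
      also have "measure Q (N \<union> ?B) \<le> measure Q N + measure Q ?B"
        using N(3) B by (intro measure_Un_le)
      finally have m: "measure Q (N \<union> ?B \<union> ?M \<union> ?E) \<le> \<epsilon>" using N0 j1 r(3) K2(2) \<epsilon> by linarith
      have "\<bar>(\<Sum>k. y \<omega> k) - ?h (limit_transform \<eta> y \<omega>)\<bar> \<le> \<epsilon>" if w: "\<omega> \<in> space Q - (N \<union> ?B \<union> ?M \<union> ?E)" for \<omega>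
      proof -
        have rs: "y \<omega> \<in> ranked_seqs" and sm: "summable (y \<omega>)" using w N(1) by auto
        have nn: "0 \<le> y \<omega> k" and anti: "antimono (y \<omega>)" for k using rs by (auto simp: ranked_seqs_def)
        let ?Big = "{k \<in> UNIV. \<eta> * real i0 < y \<omega> k}"
        have fin: "finite ?Big" using ranked_seqs_tail_finite[OF rs \<beta>] unfolding \<eta>i0 by simp
        have tl: "\<bar>(\<Sum>k\<in>?Big. y \<omega> k) - total_level \<eta> r i0 K (\<lambda>i. exp (- real (card {k \<in> UNIV. \<eta> * real (Suc i) < y \<omega> k})))\<bar> \<le> \<eta> * real K"
        proof (rule total_level_close[OF \<eta> i0r fin])
          show "card ?Big \<le> K" using w unfolding \<eta>i0 by (auto simp: tail_count_def not_less)
          show "y \<omega> k \<le> \<eta> * real r" for k using w antimonoD[OF anti, of 0 k] by auto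
        qed
        have tr: "(\<lambda>i. exp (- real (card {k \<in> UNIV. \<eta> * real (Suc i) < y \<omega> k}))) = limit_transform \<eta> y \<omega>"
          by (simp add: limit_transform_def tail_count_def grid_def fun_eq_iff)
        have s1: "(\<lambda>k. if k \<in> ?Big then y \<omega> k else 0) sums (\<Sum>k\<in>?Big. y \<omega> k)" by (rule sums_If_finite_set[OF fin])
        have sm2: "summable (\<lambda>k. if y \<omega> k \<le> 1 / real (Suc j) then y \<omega> k else 0)"
          by (rule summable_comparison_test'[OF sm]) (use nn in auto)
        have "(\<Sum>k. y \<omega> k) = (\<Sum>k. (if k \<in> ?Big then y \<omega> k else 0) + (if y \<omega> k \<le> 1 / real (Suc j) then y \<omega> k else 0))"
          unfolding \<eta>i0 \<beta>_def by (intro suminf_cong) auto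
        also have "\<dots> = (\<Sum>k\<in>?Big. y \<omega> k) + small j \<omega>"
          using suminf_add[OF sums_summable[OF s1] sm2] sums_unique[OF s1] by (simp add: small_def)
        finally have split: "(\<Sum>k. y \<omega> k) = (\<Sum>k\<in>?Big. y \<omega> k) + small j \<omega>" .
        have "0 \<le> small j \<omega>" unfolding small_def by (rule suminf_nonneg[OF sm2]) (use nn in auto)
        moreover have "small j \<omega> \<le> \<epsilon> / 2" using w by auto
        ultimately show ?thesis using arith[OF tl _ _ order_refl _ \<eta>K, of "small j \<omega>"] \<epsilon> unfolding tr split by simp
      qed
      then show ?thesis using N B M K2(1) m by (intro bexI[of _ "N \<union> ?B \<union> ?M \<union> ?E"]) auto
    qed
    show ?thesis
      by (rule exI[of _ r], intro conjI, use r in simp, rule exI[of _ ?h], intro conjI total_level_continuous hP hQ)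
  qed
  then show "\<exists>\<eta>>0. \<eta> \<le> \<epsilon> \<and> (\<forall>r0::nat. \<exists>r\<ge>r0. \<exists>h. continuous_on UNIV h \<and>
       (\<forall>\<^sub>F n in sequentially. \<exists>A\<in>sets (P n). measure (P n) A \<le> \<epsilon> \<and>
          (\<forall>\<omega>\<in>space (P n) - A. \<bar>total n \<omega> / (2 * scale n) - h (exceedance_transform \<eta> n \<omega>)\<bar> \<le> \<epsilon>)) \<and>
       (\<exists>A\<in>sets Q. measure Q A \<le> \<epsilon> \<and> (\<forall>\<omega>\<in>space Q - A. \<bar>(\<Sum>k. y \<omega> k) - h (limit_transform \<eta> y \<omega>)\<bar> \<le> \<epsilon>)))"
    using \<eta> \<eta>le by blast
qed

end

theorem theorem1p8:
  fixes \<alpha> :: real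
    and \<L> :: "real measure"
    and P :: "nat \<Rightarrow> 'a measure"
    and U :: "nat \<Rightarrow> nat \<Rightarrow> nat \<Rightarrow> 'a \<Rightarrow> real"
    and rhat :: "nat \<Rightarrow> 'a \<Rightarrow> nat \<Rightarrow> real"
  assumes "\<alpha> > 0"
    and "\<L> \<in> heavy_tailed \<alpha>"
    and "\<And>n. prob_space (P n)"
    and "\<And>n. prob_space.indep_vars (P n) (\<lambda>_. borel) (\<lambda>(i, j). U n i j)
               {(i, j). 1 \<le> i \<and> i \<le> j \<and> j \<le> n}"
    and "\<And>n i j. 1 \<le> i \<Longrightarrow> i \<le> j \<Longrightarrow> j \<le> n \<Longrightarrow> distr (P n) borel (U n i j) = \<L>"
    and "\<And>n i j. 1 \<le> i \<Longrightarrow> i \<le> j \<Longrightarrow> j \<le> n \<Longrightarrow> U n j i = U n i j"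
    and "\<And>n i. i \<in> {1..n} \<Longrightarrow> (\<lambda>\<omega>. rhat n \<omega> i) \<in> borel_measurable (P n)"
    and "\<And>n \<omega>. \<omega> \<in> space (P n) \<Longrightarrow> invariant_vector n (\<lambda>i j. U n i j \<omega>) (rhat n \<omega>)"
  shows
    "(\<alpha> < 1 \<longrightarrow>
       (\<forall>(Q :: 'v measure) V. prob_space Q \<longrightarrow> V \<in> borel_measurable Q \<longrightarrow>
          distr Q borel V = poisson_dirichlet \<alpha> \<longrightarrow>
          converges_in_distribution_on ranked_seqs P
            (\<lambda>n \<omega>. ranked_vector n (rhat n \<omega>))
            Q (\<lambda>\<omega>. half_doubled (V \<omega>)))) \<and>
     (1 < \<alpha> \<and> \<alpha> < 2 \<and> has_bochner_integral \<L> (\<lambda>x. x) 1 \<longrightarrow>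
       (\<forall>(Q :: 'w measure) x. ranked_poisson_points Q \<alpha> x \<longrightarrow>
          converges_in_distribution_on ranked_seqs P
            (\<lambda>n \<omega> k. kappa \<L> (n * (n + 1) div 2) * ranked_vector n (rhat n \<omega>) k)
            Q (\<lambda>\<omega>. half_doubled (x \<omega>)))) \<and>
     (\<alpha> = 1 \<longrightarrow>
       (\<forall>(Q :: 'w measure) x. ranked_poisson_points Q \<alpha> x \<longrightarrow>
          converges_in_distribution_on ranked_seqs P
            (\<lambda>n \<omega> k. kappa \<L> (n * (n + 1) div 2) * truncated_mean \<L> (n * (n + 1) div 2)
                      * ranked_vector n (rhat n \<omega>) k)
            Q (\<lambda>\<omega>. half_doubled (x \<omega>))))"
proof -
  interpret H: heavy_tail \<alpha> \<L> by (rule heavy_tail.intro[OF assms(1,2)])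
  interpret S: graph_sample \<alpha> \<L> P U
    by (intro graph_sample.intro graph_sample_axioms.intro H.heavy_tail_axioms
        assms(3) assms(4)[folded edges_def] assms(5) assms(6))
  have scale_eq: "tail_quantile \<L> (n * (n + 1) div 2) = S.scale n" for n
    by (simp add: S.scale_def S.pairs_def)
  have mean_eq: "truncated_mean \<L> (n * (n + 1) div 2) = trunc_moment \<L> 1 (S.scale n)" for n
    by (simp only: H.truncated_mean_eq scale_eq)
  have kappa_eq: "kappa \<L> (n * (n + 1) div 2) = real (S.pairs n) / S.scale n" for n
    by (simp only: kappa_def scale_eq S.pairs_def)
  have pairs_pos: "\<forall>\<^sub>F n in sequentially. 0 < real (S.pairs n)"
    using eventually_gt_at_top[of 0] by eventually_elim (use S.pairs_ge in \<open>force intro: less_le_trans\<close>)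
  have stable: "converges_in_distribution_on ranked_seqs P (\<lambda>n \<omega>. ranked_vector n (rhat n \<omega>)) Q (\<lambda>\<omega>. half_doubled (V \<omega>))"
    if \<alpha>1: "\<alpha> < 1" and Q: "prob_space Q" and V: "V \<in> borel_measurable Q"
      and law: "distr Q borel V = poisson_dirichlet \<alpha>" for Q :: "'v measure" and V
  proof -
    let ?y = "\<lambda>e k. arrival e k powr (- 1 / \<alpha>)"
    let ?\<psi> = "\<lambda>e k. ?y e k / (\<Sum>m. ?y e m)"
    have y: "power_law_counts \<alpha> exp_seq ?y" by (rule arrival_power_law_counts[OF assms(1)])
    have sum: "AE e in exp_seq. summable (?y e)" by (rule arrival_power_law_summable[OF assms(1) \<alpha>1])
    have sum_meas: "(\<lambda>e. \<Sum>m. ?y e m) \<in> borel_measurable exp_seq" by measurable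
    have pos: "AE e in exp_seq. 0 < (\<Sum>m. ?y e m)"
      using sum AE_exp_seq_pos
    proof eventually_elim
      case (elim e)
      have "0 < arrival e k" for k using elim(2) by (simp add: arrival_def sum_pos)
      then show ?case using elim(1) by (intro suminf_pos) (auto simp: less_imp_neq[symmetric])
    qed
    have "converges_in_distribution_on ranked_seqs P (\<lambda>n \<omega> k. 1 * ranked_vector n (rhat n \<omega>) k)
        exp_seq (\<lambda>e k. half_doubled (?y e) k / (\<Sum>m. ?y e m))"
    proof (rule S.invariant_vector_convergence[where c=S.scale])
      show "S.approximable_head (\<lambda>n \<omega>. S.total n \<omega> / (2 * S.scale n)) exp_seq ?y (\<lambda>e. \<Sum>m. ?y e m)"
        by (rule S.approximable_head_sum[OF \<alpha>1 y sum])
      show "\<forall>\<^sub>F n in sequentially. 1 = S.scale n / S.scale n"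
        using S.scale_pos by eventually_elim simp
    qed (use \<alpha>1 y sum_meas pos S.scale_pos assms(7,8) in auto)
    moreover have "(\<lambda>k. half_doubled (?y e) k / (\<Sum>m. ?y e m)) = half_doubled (?\<psi> e)" for e
      by (simp add: half_doubled_def fun_eq_iff)
    ultimately have conv: "converges_in_distribution_on ranked_seqs P (\<lambda>n \<omega>. ranked_vector n (rhat n \<omega>)) exp_seq (\<lambda>e. half_doubled (?\<psi> e))"
      by simp
    have \<psi>: "?\<psi> \<in> borel_measurable exp_seq"
      by (intro measurable_coordinatewise_then_product borel_measurable_divide sum_meas) measurable
    have pd: "poisson_dirichlet \<alpha> = distr exp_seq borel ?\<psi>"
      by (simp add: poisson_dirichlet_def Let_def arrival_def)
    have hS: "{v \<in> space borel. half_doubled v \<in> ranked_seqs} \<in> sets borel"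
      using measurable_sets[OF half_doubled_measurable ranked_seqs_borel] by (simp add: vimage_def)
    have AE_V: "AE \<omega> in Q. half_doubled (V \<omega>) \<in> ranked_seqs"
    proof -
      have "AE e in exp_seq. half_doubled (?\<psi> e) \<in> ranked_seqs"
        using conv by (simp add: converges_in_distribution_on_def)
      then have "AE v in distr exp_seq borel ?\<psi>. half_doubled v \<in> ranked_seqs"
        by (subst AE_distr_iff[OF \<psi> hS]) 
      then have "AE v in distr Q borel V. half_doubled v \<in> ranked_seqs" by (simp only: law pd)
      then show ?thesis by (subst (asm) AE_distr_iff[OF V hS])
    qed
    \<comment> \<open>Only the law of V is prescribed, so expectations are carried through that law
      to the space of waiting times, where the convergence was proved.\<close>
    have int: "(LINT \<omega>|Q. indicator ranked_seqs (half_doubled (V \<omega>)) * f (half_doubled (V \<omega>))) =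
        (LINT e|exp_seq. indicator ranked_seqs (half_doubled (?\<psi> e)) * f (half_doubled (?\<psi> e)))"
      if f: "continuous_on ranked_seqs f" for f :: "(nat \<Rightarrow> real) \<Rightarrow> real"
    proof -
      let ?F = "\<lambda>v. indicator ranked_seqs (half_doubled v) * f (half_doubled v)"
      have F: "?F \<in> borel_measurable borel"
        by (rule measurable_compose[OF half_doubled_measurable indicator_mult_borel_measurable[OF ranked_seqs_borel f]])
      have "(LINT \<omega>|Q. ?F (V \<omega>)) = (LINT v|distr Q borel V. ?F v)" by (rule integral_distr[OF V F, symmetric])
      also have "\<dots> = (LINT v|distr exp_seq borel ?\<psi>. ?F v)" by (simp only: law pd)
      also have "\<dots> = (LINT e|exp_seq. ?F (?\<psi> e))" by (rule integral_distr[OF \<psi> F])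
      finally show ?thesis .
    qed
    show ?thesis
      using conv AE_V int measurable_compose[OF V half_doubled_measurable]
      by (simp add: converges_in_distribution_on_def)
  qed
  \<comment> \<open>Both cases with \<alpha> \<ge> 1 divide by a total that is asymptotically
    deterministic, so the limit head is 1 and only the norming sequence differs.\<close>
  have mean: "converges_in_distribution_on ranked_seqs P (\<lambda>n \<omega> k. s n * ranked_vector n (rhat n \<omega>) k)
      Q (\<lambda>\<omega>. half_doubled (x \<omega>))"
    if \<alpha>2: "\<alpha> < 2" and pts: "ranked_poisson_points Q \<alpha> x"
      and neg: "(\<lambda>n. S.scale n / (real (S.pairs n) * trunc_moment \<L> 1 (S.scale n))) \<longlonglongrightarrow> 0"
      and c: "(\<lambda>n. real (S.pairs n) * trunc_moment \<L> 1 (S.scale n) / norming n) \<longlonglongrightarrow> 1"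
      and c_pos: "\<forall>\<^sub>F n in sequentially. 0 < norming n" and c_nonneg: "\<And>n. 0 \<le> norming n" and s: "\<And>n. s n = norming n / S.scale n"
    for Q :: "'w measure" and x norming s
  proof -
    have y: "power_law_counts \<alpha> Q x" by (rule ranked_poisson_power_law_counts[OF assms(1) pts])
    have Q: "prob_space Q" using y by (simp add: power_law_counts_def)
    have "converges_in_distribution_on ranked_seqs P (\<lambda>n \<omega> k. s n * ranked_vector n (rhat n \<omega>) k)
        Q (\<lambda>\<omega> k. half_doubled (x \<omega>) k / 1)"
    proof (rule S.invariant_vector_convergence[OF \<alpha>2 y _ _ c_pos])
      show "S.approximable_head (\<lambda>n \<omega>. S.total n \<omega> / (2 * norming n)) Q x (\<lambda>_. 1)"
        by (rule S.approximable_head_const[OF \<alpha>2 Q neg c])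
      show "0 \<le> s n" for n using c_nonneg S.scale_nonneg by (simp add: s)
    qed (use s assms(7,8) in auto)
    then show ?thesis by simp
  qed
  have mean_ii: "converges_in_distribution_on ranked_seqs P
      (\<lambda>n \<omega> k. kappa \<L> (n * (n + 1) div 2) * ranked_vector n (rhat n \<omega>) k) Q (\<lambda>\<omega>. half_doubled (x \<omega>))"
    if \<alpha>2: "\<alpha> < 2" and hm: "has_bochner_integral \<L> (\<lambda>x. x) 1" and pts: "ranked_poisson_points Q \<alpha> x"
    for Q :: "'w measure" and x
  proof (rule mean[OF \<alpha>2 pts _ _ pairs_pos _ kappa_eq])
    show "(\<lambda>n. S.scale n / (real (S.pairs n) * trunc_moment \<L> 1 (S.scale n))) \<longlonglongrightarrow> 0"
      unfolding S.scale_def by (rule filterlim_compose[OF H.quantile_negligible_of_mean[OF hm] S.pairs_at_top]) simp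
    have lim: "(\<lambda>n. trunc_moment \<L> 1 (S.scale n)) \<longlonglongrightarrow> 1"
      unfolding S.scale_def by (rule filterlim_compose[OF H.mom_1_tendsto_mean[OF hm] S.pairs_at_top])
    show "(\<lambda>n. real (S.pairs n) * trunc_moment \<L> 1 (S.scale n) / real (S.pairs n)) \<longlonglongrightarrow> 1"
      by (rule Lim_transform_eventually[OF lim]) (use pairs_pos in eventually_elim, simp)
  qed simp
  have mean_one: "converges_in_distribution_on ranked_seqs P
      (\<lambda>n \<omega> k. kappa \<L> (n * (n + 1) div 2) * truncated_mean \<L> (n * (n + 1) div 2) * ranked_vector n (rhat n \<omega>) k)
      Q (\<lambda>\<omega>. half_doubled (x \<omega>))"
    if \<alpha>1: "\<alpha> = 1" and pts: "ranked_poisson_points Q \<alpha> x" for Q :: "'w measure" and x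
  proof -
    \<comment> \<open>At \<alpha> = 1 the norming is the truncated mean of the edge sum itself, so
      the required ratio is identically 1 as soon as it is positive.\<close>
    have pos: "\<forall>\<^sub>F n in sequentially. 0 < real (S.pairs n) * trunc_moment \<L> 1 (S.scale n)"
      using pairs_pos S.mom_1_pos by eventually_elim simp
    have s: "kappa \<L> (n * (n + 1) div 2) * truncated_mean \<L> (n * (n + 1) div 2) =
        real (S.pairs n) * trunc_moment \<L> 1 (S.scale n) / S.scale n" for n
      by (simp only: kappa_eq mean_eq times_divide_eq_left)
    show ?thesis
    proof (rule mean[OF _ pts _ _ pos _ s])
      show "(\<lambda>n. S.scale n / (real (S.pairs n) * trunc_moment \<L> 1 (S.scale n))) \<longlonglongrightarrow> 0"
        unfolding S.scale_def by (rule filterlim_compose[OF H.quantile_negligible_of_one[OF \<alpha>1] S.pairs_at_top])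
      show "(\<lambda>n. real (S.pairs n) * trunc_moment \<L> 1 (S.scale n) / (real (S.pairs n) * trunc_moment \<L> 1 (S.scale n))) \<longlonglongrightarrow> 1"
        by (rule Lim_transform_eventually[OF tendsto_const[of 1]], rule eventually_mono[OF pos])
          (rule divide_self[symmetric], rule less_imp_neq[THEN not_sym])
      show "0 \<le> real (S.pairs n) * trunc_moment \<L> 1 (S.scale n)" for n
        using H.mom_nonneg by simp
    qed (use \<alpha>1 in simp)
  qed
  show ?thesis
    using stable mean_ii mean_one by blast
qed

end
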